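(* Let $\mathcal{C}$ be a $\mathbb{C}$-linear abelian rigid monoidal category and let $X$ be a Frobenius algebra in $\mathcal{C}$ that is semisimple of finite length as an object. Let $\mathcal{B}$ be a basis of $X$. Then the subposet of the Frobenius subalgebra poset of $X$ consisting of the classes of Frobenius $\mathcal{B}$-subalgebras (the Frobenius $\mathcal{B}$-subalgebra poset) is a lattice with $[A]\wedge[B]=[A\cap B]$.
   Context: Monoidal categories are taken strict. A left dual of $X$ is a triple $(X^*,\mathrm{ev}_X:X^*\otimes X\to\mathbf 1,\mathrm{coev}_X:\mathbf 1\to X\otimes X^* )$ satisfying the zigzag identities; $f^*:Y^*\to X^*$ denotes the dual of $f:X\to Y$. A Frobenius algebra is $(X,m,\delta,e,\epsilon)$ with $(X,m,e)$ a unital algebra, $(X,\delta,\epsilon)$ a counital coalgebra and $(\mathrm{id}_X\otimes m)\circ(\delta\otimes \mathrm{id}_X)=\delta\circ m=(m\otimes \mathrm{id}_X)\circ(\mathrm{id}_X\otimes\delta)$. It is always regarded as selfdual, $X^*=X$, with $\mathrm{ev}_X=\epsilon\circ m$, $\mathrm{coev}_X=\delta\circ e$. A Frobenius algebra $X'$ is a Frobenius subalgebra of $X$ if there is a unital algebra monomorphism $i:X'\to X$ with $i^{**}=i$ and $i^*\circ i=\mathrm{id}_{X'}$; put $b_{X'}:=i\circ i^*$, an idempotent. Two Frobenius subalgebras $X_1,X_2$ are equivalent iff $b_{X_1}=b_{X_2}$; the class of $X_1$ is $[X_1]$. The Frobenius subalgebra poset of $X$ is the set of classes with $[X_1]\le[X_2]$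 iff $b_{X_1}\circ b_{X_2}=b_{X_1}=b_{X_2}\circ b_{X_1}$. $A\cap B$ is the intersection (pullback) of subobjects of $X$. Rigidity invariance. Let $C$ be a semisimple object of finite length. A basis $\mathcal{B}$ of $C$ is a family $(\mathcal{B}_S)_S$, $S$ running over representatives of isomorphism classes of simple objects, with $\mathcal{B}_S$ a basis of the multiplicity space $\mathrm{Hom}_{\mathcal C}(C,S)$. For each simple $S$ (with $\mathrm{End}_{\mathcal C}(S)=\mathbb{C}$ by Schur's lemma), a bilinear form $\kappa'_{C,S}:\mathrm{Hom}(C,S)\times\mathrm{Hom}(C^*,S^* )\to\mathbb{C}$ is defined by $(f\otimes g)\circ\mathrm{coev}_C=\kappa'_{C,S}(f,g)\,\mathrm{coev}_S$. Let $\langle\cdot,\cdot\rangle$ be the Hermitian form on $\mathrm{Hom}(C,S)$, conjugate-linear in the second argument, for which $\mathcal{B}_S$ is orthonormal, and let $M'_{C,S}:\mathrm{Hom}(C^*,S^* )\to\mathrm{Hom}(C,S)$ be the conjugate-linear map with $\langle f,M'_{C,S}g\rangle=\kappa'_{C,S}(f,g)$. A split subobject $(A,i,p)$ of $C$ ($p\circ i=\mathrm{id}_A$) is $\mathcal{B}$-rigid invariant if $M'_{C,S}(\mathrm{Hom}(A^*,S^* )\circ i^* )=\mathrm{Hom}(A,S)\circ p$ for all simple $S$. A Frobenius $\mathcal{B}$-subalgebra of $X$ is a Frobenius subalgebra $A$ of $X$ such that $(A,i,i^* )$ is $\mathcal{B}$-rigid invariant. *)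

theory Defs
  imports Complex_Main "HOL-Algebra.Module" "HOL-Algebra.Lattice"
begin

section \<open>Categories with linear and tensor structure\<close>

text \<open>Objects and arrows are the elements of the carriers \<open>obs\<close> and \<open>arrs\<close>; every operation is
  only constrained on these carriers, and \<open>hadd\<close> only on pairs of parallel arrows.\<close>

record ('o, 'm) lmcat =
  obs :: "'o set"
  arrs :: "'m set"
  src :: "'m \<Rightarrow> 'o"
  tgt :: "'m \<Rightarrow> 'o"
  iden :: "'o \<Rightarrow> 'm"
  compo :: "'m \<Rightarrow> 'm \<Rightarrow> 'm" (infixr "\<cdot>\<index>" 60)
  hzero :: "'o \<Rightarrow> 'o \<Rightarrow> 'm"
  hadd :: "'m \<Rightarrow> 'm \<Rightarrow> 'm"
  hscale :: "complex \<Rightarrow> 'm \<Rightarrow> 'm"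
  tobj :: "'o \<Rightarrow> 'o \<Rightarrow> 'o" (infixr "\<otimes>\<^sub>o\<index>" 70)
  tarr :: "'m \<Rightarrow> 'm \<Rightarrow> 'm" (infixr "\<otimes>\<^sub>a\<index>" 70)
  tunit :: "'o"

definition homset :: "('o, 'm) lmcat \<Rightarrow> 'o \<Rightarrow> 'o \<Rightarrow> 'm set" where
  "homset C x y = {f \<in> arrs C. src C f = x \<and> tgt C f = y}"

definition complex_ring :: "complex ring" where
  "complex_ring = \<lparr>carrier = UNIV, mult = (*), one = 1, zero = 0, add = (+)\<rparr>"

text \<open>The fields \<open>mult\<close> and \<open>one\<close> are forced by the record type and play no role.\<close>

definition hom_space :: "('o, 'm) lmcat \<Rightarrow> 'o \<Rightarrow> 'o \<Rightarrow> (complex, 'm) module" where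
  "hom_space C x y = \<lparr>carrier = homset C x y, mult = (\<lambda>_ _. undefined), one = undefined,
     zero = hzero C x y, add = hadd C, smult = hscale C\<rparr>"

locale lm_category =
  fixes C :: "('o, 'm) lmcat" (structure)
  assumes src_closed: "f \<in> arrs C \<Longrightarrow> src C f \<in> obs C"
    and tgt_closed: "f \<in> arrs C \<Longrightarrow> tgt C f \<in> obs C"
    and iden_closed: "x \<in> obs C \<Longrightarrow> iden C x \<in> homset C x x"
    and compo_closed: "\<lbrakk>f \<in> homset C x y; g \<in> homset C y z\<rbrakk> \<Longrightarrow> g \<cdot> f \<in> homset C x z"
    and iden_left: "f \<in> homset C x y \<Longrightarrow> iden C y \<cdot> f = f"
    and iden_right: "f \<in> homset C x y \<Longrightarrow> f \<cdot> iden C x = f"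
    and compo_assoc: "\<lbrakk>f \<in> homset C w x; g \<in> homset C x y; h \<in> homset C y z\<rbrakk>
          \<Longrightarrow> (h \<cdot> g) \<cdot> f = h \<cdot> (g \<cdot> f)"

locale linear_category = lm_category +
  assumes hom_module: "\<lbrakk>x \<in> obs C; y \<in> obs C\<rbrakk> \<Longrightarrow> module complex_ring (hom_space C x y)"
    and compo_add_left: "\<lbrakk>f \<in> homset C x y; g \<in> homset C y z; g' \<in> homset C y z\<rbrakk>
          \<Longrightarrow> hadd C g g' \<cdot> f = hadd C (g \<cdot> f) (g' \<cdot> f)"
    and compo_add_right: "\<lbrakk>f \<in> homset C x y; f' \<in> homset C x y; g \<in> homset C y z\<rbrakk>
          \<Longrightarrow> g \<cdot> hadd C f f' = hadd C (g \<cdot> f) (g \<cdot> f')"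
    and compo_scale_left: "\<lbrakk>f \<in> homset C x y; g \<in> homset C y z\<rbrakk>
          \<Longrightarrow> hscale C c g \<cdot> f = hscale C c (g \<cdot> f)"
    and compo_scale_right: "\<lbrakk>f \<in> homset C x y; g \<in> homset C y z\<rbrakk>
          \<Longrightarrow> g \<cdot> hscale C c f = hscale C c (g \<cdot> f)"


section \<open>Abelian categories\<close>

definition is_mono :: "('o, 'm) lmcat \<Rightarrow> 'm \<Rightarrow> bool" where
  "is_mono C f \<longleftrightarrow> f \<in> arrs C \<and>
     (\<forall>w. \<forall>g \<in> homset C w (src C f). \<forall>h \<in> homset C w (src C f).
        f \<cdot>\<^bsub>C\<^esub> g = f \<cdot>\<^bsub>C\<^esub> h \<longrightarrow> g = h)"

definition is_epi :: "('o, 'm) lmcat \<Rightarrow> 'm \<Rightarrow> bool" where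
  "is_epi C f \<longleftrightarrow> f \<in> arrs C \<and>
     (\<forall>z. \<forall>g \<in> homset C (tgt C f) z. \<forall>h \<in> homset C (tgt C f) z.
        g \<cdot>\<^bsub>C\<^esub> f = h \<cdot>\<^bsub>C\<^esub> f \<longrightarrow> g = h)"

definition is_iso :: "('o, 'm) lmcat \<Rightarrow> 'm \<Rightarrow> bool" where
  "is_iso C f \<longleftrightarrow> f \<in> arrs C \<and>
     (\<exists>g \<in> homset C (tgt C f) (src C f).
        g \<cdot>\<^bsub>C\<^esub> f = iden C (src C f) \<and> f \<cdot>\<^bsub>C\<^esub> g = iden C (tgt C f))"

definition isomorphic :: "('o, 'm) lmcat \<Rightarrow> 'o \<Rightarrow> 'o \<Rightarrow> bool" where
  "isomorphic C x y \<longleftrightarrow> (\<exists>f \<in> homset C x y. is_iso C f)"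

definition is_kernel :: "('o, 'm) lmcat \<Rightarrow> 'm \<Rightarrow> 'm \<Rightarrow> bool" where
  "is_kernel C f k \<longleftrightarrow> f \<in> arrs C \<and> k \<in> arrs C \<and> tgt C k = src C f \<and>
     f \<cdot>\<^bsub>C\<^esub> k = hzero C (src C k) (tgt C f) \<and>
     (\<forall>w. \<forall>h \<in> homset C w (src C f). f \<cdot>\<^bsub>C\<^esub> h = hzero C w (tgt C f) \<longrightarrow>
        (\<exists>!u. u \<in> homset C w (src C k) \<and> k \<cdot>\<^bsub>C\<^esub> u = h))"

definition is_cokernel :: "('o, 'm) lmcat \<Rightarrow> 'm \<Rightarrow> 'm \<Rightarrow> bool" where
  "is_cokernel C f q \<longleftrightarrow> f \<in> arrs C \<and> q \<in> arrs C \<and> src C q = tgt C f \<and>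
     q \<cdot>\<^bsub>C\<^esub> f = hzero C (src C f) (tgt C q) \<and>
     (\<forall>z. \<forall>h \<in> homset C (tgt C f) z. h \<cdot>\<^bsub>C\<^esub> f = hzero C (src C f) z \<longrightarrow>
        (\<exists>!u. u \<in> homset C (tgt C q) z \<and> u \<cdot>\<^bsub>C\<^esub> q = h))"

text \<open>\<open>x\<close> is the direct sum (biproduct) of \<open>s 0, \<dots>, s (n - 1)\<close>; for \<open>n = 0\<close> this says that
  \<open>x\<close> is a zero object.\<close>

definition is_direct_sum ::
  "('o, 'm) lmcat \<Rightarrow> nat \<Rightarrow> (nat \<Rightarrow> 'o) \<Rightarrow> 'o \<Rightarrow> (nat \<Rightarrow> 'm) \<Rightarrow> (nat \<Rightarrow> 'm) \<Rightarrow> bool" where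
  "is_direct_sum C n s x inc prj \<longleftrightarrow> x \<in> obs C \<and>
     (\<forall>k<n. inc k \<in> homset C (s k) x \<and> prj k \<in> homset C x (s k)) \<and>
     (\<forall>k<n. \<forall>l<n. prj l \<cdot>\<^bsub>C\<^esub> inc k = (if k = l then iden C (s k) else hzero C (s k) (s l))) \<and>
     iden C x = finsum (hom_space C x x) (\<lambda>k. inc k \<cdot>\<^bsub>C\<^esub> prj k) {..<n}"

locale abelian_category = linear_category +
  assumes direct_sums: "(\<And>k. k < n \<Longrightarrow> s k \<in> obs C) \<Longrightarrow> \<exists>x inc prj. is_direct_sum C n s x inc prj"
    and kernels: "f \<in> arrs C \<Longrightarrow> \<exists>k. is_kernel C f k"
    and cokernels: "f \<in> arrs C \<Longrightarrow> \<exists>q. is_cokernel C f q"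
    and mono_normal: "is_mono C k \<Longrightarrow> \<exists>f. is_kernel C f k"
    and epi_normal: "is_epi C q \<Longrightarrow> \<exists>f. is_cokernel C f q"

definition is_simple :: "('o, 'm) lmcat \<Rightarrow> 'o \<Rightarrow> bool" where
  "is_simple C x \<longleftrightarrow> x \<in> obs C \<and> iden C x \<noteq> hzero C x x \<and>
     (\<forall>j. is_mono C j \<and> tgt C j = x \<longrightarrow> j = hzero C (src C j) x \<or> is_iso C j)"

text \<open>Semisimple objects are direct sums of simple objects; finite length means that the number of
  summands is finite.\<close>

definition semisimple_finite_length :: "('o, 'm) lmcat \<Rightarrow> 'o \<Rightarrow> bool" where
  "semisimple_finite_length C x \<longleftrightarrow>
     (\<exists>n s inc prj. (\<forall>k<n. is_simple C (s k)) \<and> is_direct_sum C n s x inc prj)"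

definition simple_reps :: "('o, 'm) lmcat \<Rightarrow> 'o set \<Rightarrow> bool" where
  "simple_reps C R \<longleftrightarrow> (\<forall>S\<in>R. is_simple C S) \<and>
     (\<forall>S. is_simple C S \<longrightarrow> (\<exists>!T. T \<in> R \<and> isomorphic C S T))"

definition is_pullback :: "('o, 'm) lmcat \<Rightarrow> 'm \<Rightarrow> 'm \<Rightarrow> 'm \<Rightarrow> 'm \<Rightarrow> bool" where
  "is_pullback C i j u v \<longleftrightarrow>
     i \<in> arrs C \<and> j \<in> arrs C \<and> u \<in> arrs C \<and> v \<in> arrs C \<and>
     src C u = src C v \<and> tgt C u = src C i \<and> tgt C v = src C j \<and> tgt C i = tgt C j \<and>
     i \<cdot>\<^bsub>C\<^esub> u = j \<cdot>\<^bsub>C\<^esub> v \<and>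
     (\<forall>w. \<forall>s \<in> homset C w (src C i). \<forall>t \<in> homset C w (src C j). i \<cdot>\<^bsub>C\<^esub> s = j \<cdot>\<^bsub>C\<^esub> t \<longrightarrow>
        (\<exists>!h. h \<in> homset C w (src C u) \<and> u \<cdot>\<^bsub>C\<^esub> h = s \<and> v \<cdot>\<^bsub>C\<^esub> h = t))"

text \<open>\<open>k\<close> is the inclusion into the common target of the intersection of the subobjects
  represented by \<open>i\<close> and \<open>j\<close>.\<close>

definition is_intersection :: "('o, 'm) lmcat \<Rightarrow> 'm \<Rightarrow> 'm \<Rightarrow> 'm \<Rightarrow> bool" where
  "is_intersection C i j k \<longleftrightarrow> (\<exists>u v. is_pullback C i j u v \<and> k = i \<cdot>\<^bsub>C\<^esub> u)"


section \<open>Strict monoidal categories and duals\<close>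

locale strict_monoidal_category = lm_category +
  assumes tunit_closed: "tunit C \<in> obs C"
    and tobj_closed: "\<lbrakk>x \<in> obs C; y \<in> obs C\<rbrakk> \<Longrightarrow> x \<otimes>\<^sub>o y \<in> obs C"
    and tobj_assoc: "\<lbrakk>x \<in> obs C; y \<in> obs C; z \<in> obs C\<rbrakk>
          \<Longrightarrow> (x \<otimes>\<^sub>o y) \<otimes>\<^sub>o z = x \<otimes>\<^sub>o (y \<otimes>\<^sub>o z)"
    and tobj_unit_left: "x \<in> obs C \<Longrightarrow> tunit C \<otimes>\<^sub>o x = x"
    and tobj_unit_right: "x \<in> obs C \<Longrightarrow> x \<otimes>\<^sub>o tunit C = x"
    and tarr_closed: "\<lbrakk>f \<in> homset C x y; g \<in> homset C x' y'\<rbrakk>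
          \<Longrightarrow> f \<otimes>\<^sub>a g \<in> homset C (x \<otimes>\<^sub>o x') (y \<otimes>\<^sub>o y')"
    and tarr_assoc: "\<lbrakk>f \<in> arrs C; g \<in> arrs C; h \<in> arrs C\<rbrakk>
          \<Longrightarrow> (f \<otimes>\<^sub>a g) \<otimes>\<^sub>a h = f \<otimes>\<^sub>a (g \<otimes>\<^sub>a h)"
    and tarr_unit_left: "f \<in> arrs C \<Longrightarrow> iden C (tunit C) \<otimes>\<^sub>a f = f"
    and tarr_unit_right: "f \<in> arrs C \<Longrightarrow> f \<otimes>\<^sub>a iden C (tunit C) = f"
    and tarr_iden: "\<lbrakk>x \<in> obs C; y \<in> obs C\<rbrakk> \<Longrightarrow> iden C x \<otimes>\<^sub>a iden C y = iden C (x \<otimes>\<^sub>o y)"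
    and interchange: "\<lbrakk>f \<in> homset C x y; g \<in> homset C y z; f' \<in> homset C x' y'; g' \<in> homset C y' z'\<rbrakk>
          \<Longrightarrow> (g \<cdot> f) \<otimes>\<^sub>a (g' \<cdot> f') = (g \<otimes>\<^sub>a g') \<cdot> (f \<otimes>\<^sub>a f')"

text \<open>Data \<open>(X\<^sup>*, ev, coev)\<close> of a left dual.\<close>

record ('o, 'm) dual =
  dobj :: "'o"
  dev :: "'m"
  dcoev :: "'m"

definition left_dual :: "('o, 'm) lmcat \<Rightarrow> 'o \<Rightarrow> ('o, 'm) dual \<Rightarrow> bool" where
  "left_dual C x D \<longleftrightarrow> x \<in> obs C \<and> dobj D \<in> obs C \<and>
     dev D \<in> homset C (dobj D \<otimes>\<^sub>o\<^bsub>C\<^esub> x) (tunit C) \<and>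
     dcoev D \<in> homset C (tunit C) (x \<otimes>\<^sub>o\<^bsub>C\<^esub> dobj D) \<and>
     (iden C x \<otimes>\<^sub>a\<^bsub>C\<^esub> dev D) \<cdot>\<^bsub>C\<^esub> (dcoev D \<otimes>\<^sub>a\<^bsub>C\<^esub> iden C x) = iden C x \<and>
     (dev D \<otimes>\<^sub>a\<^bsub>C\<^esub> iden C (dobj D)) \<cdot>\<^bsub>C\<^esub> (iden C (dobj D) \<otimes>\<^sub>a\<^bsub>C\<^esub> dcoev D) = iden C (dobj D)"

text \<open>The dual \<open>f\<^sup>* : Y\<^sup>* \<rightarrow> X\<^sup>*\<close> of \<open>f : X \<rightarrow> Y\<close> with respect to the left duals \<open>DX\<close> of \<open>X\<close>
  and \<open>DY\<close> of \<open>Y\<close>.\<close>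

definition dual_arr :: "('o, 'm) lmcat \<Rightarrow> ('o, 'm) dual \<Rightarrow> ('o, 'm) dual \<Rightarrow> 'm \<Rightarrow> 'm" where
  "dual_arr C DX DY f =
     (dev DY \<otimes>\<^sub>a\<^bsub>C\<^esub> iden C (dobj DX)) \<cdot>\<^bsub>C\<^esub>
     (iden C (dobj DY) \<otimes>\<^sub>a\<^bsub>C\<^esub> f \<otimes>\<^sub>a\<^bsub>C\<^esub> iden C (dobj DX)) \<cdot>\<^bsub>C\<^esub>
     (iden C (dobj DY) \<otimes>\<^sub>a\<^bsub>C\<^esub> dcoev DX)"

text \<open>A right dual of \<open>x\<close> is an object of which \<open>x\<close> is a left dual.\<close>

locale rigid_monoidal_category = strict_monoidal_category +
  assumes left_duals: "x \<in> obs C \<Longrightarrow> \<exists>D. left_dual C x D"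
    and right_duals: "x \<in> obs C \<Longrightarrow> \<exists>y D. left_dual C y D \<and> dobj D = x"

text \<open>In a \<open>\<complex>\<close>-linear monoidal category the tensor product is bilinear on arrows.\<close>

locale linear_abelian_rigid_category = abelian_category + rigid_monoidal_category +
  assumes tarr_add_left: "\<lbrakk>f \<in> homset C x y; f' \<in> homset C x y; g \<in> arrs C\<rbrakk>
          \<Longrightarrow> hadd C f f' \<otimes>\<^sub>a g = hadd C (f \<otimes>\<^sub>a g) (f' \<otimes>\<^sub>a g)"
    and tarr_add_right: "\<lbrakk>f \<in> arrs C; g \<in> homset C x y; g' \<in> homset C x y\<rbrakk>
          \<Longrightarrow> f \<otimes>\<^sub>a hadd C g g' = hadd C (f \<otimes>\<^sub>a g) (f \<otimes>\<^sub>a g')"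
    and tarr_scale_left: "\<lbrakk>f \<in> arrs C; g \<in> arrs C\<rbrakk>
          \<Longrightarrow> hscale C c f \<otimes>\<^sub>a g = hscale C c (f \<otimes>\<^sub>a g)"
    and tarr_scale_right: "\<lbrakk>f \<in> arrs C; g \<in> arrs C\<rbrakk>
          \<Longrightarrow> f \<otimes>\<^sub>a hscale C c g = hscale C c (f \<otimes>\<^sub>a g)"


section \<open>Frobenius algebras and Frobenius subalgebras\<close>

record ('o, 'm) frob =
  fobj :: "'o"
  fmul :: "'m"
  fcomul :: "'m"
  funit :: "'m"
  fcounit :: "'m"

definition unital_algebra :: "('o, 'm) lmcat \<Rightarrow> 'o \<Rightarrow> 'm \<Rightarrow> 'm \<Rightarrow> bool" where
  "unital_algebra C x m e \<longleftrightarrow> x \<in> obs C \<and>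
     m \<in> homset C (x \<otimes>\<^sub>o\<^bsub>C\<^esub> x) x \<and> e \<in> homset C (tunit C) x \<and>
     m \<cdot>\<^bsub>C\<^esub> (m \<otimes>\<^sub>a\<^bsub>C\<^esub> iden C x) = m \<cdot>\<^bsub>C\<^esub> (iden C x \<otimes>\<^sub>a\<^bsub>C\<^esub> m) \<and>
     m \<cdot>\<^bsub>C\<^esub> (e \<otimes>\<^sub>a\<^bsub>C\<^esub> iden C x) = iden C x \<and>
     m \<cdot>\<^bsub>C\<^esub> (iden C x \<otimes>\<^sub>a\<^bsub>C\<^esub> e) = iden C x"

definition counital_coalgebra :: "('o, 'm) lmcat \<Rightarrow> 'o \<Rightarrow> 'm \<Rightarrow> 'm \<Rightarrow> bool" where
  "counital_coalgebra C x d eps \<longleftrightarrow> x \<in> obs C \<and>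
     d \<in> homset C x (x \<otimes>\<^sub>o\<^bsub>C\<^esub> x) \<and> eps \<in> homset C x (tunit C) \<and>
     (d \<otimes>\<^sub>a\<^bsub>C\<^esub> iden C x) \<cdot>\<^bsub>C\<^esub> d = (iden C x \<otimes>\<^sub>a\<^bsub>C\<^esub> d) \<cdot>\<^bsub>C\<^esub> d \<and>
     (eps \<otimes>\<^sub>a\<^bsub>C\<^esub> iden C x) \<cdot>\<^bsub>C\<^esub> d = iden C x \<and>
     (iden C x \<otimes>\<^sub>a\<^bsub>C\<^esub> eps) \<cdot>\<^bsub>C\<^esub> d = iden C x"

definition frobenius_algebra :: "('o, 'm) lmcat \<Rightarrow> ('o, 'm) frob \<Rightarrow> bool" where
  "frobenius_algebra C X \<longleftrightarrow>
     unital_algebra C (fobj X) (fmul X) (funit X) \<and>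
     counital_coalgebra C (fobj X) (fcomul X) (fcounit X) \<and>
     (iden C (fobj X) \<otimes>\<^sub>a\<^bsub>C\<^esub> fmul X) \<cdot>\<^bsub>C\<^esub> (fcomul X \<otimes>\<^sub>a\<^bsub>C\<^esub> iden C (fobj X)) = fcomul X \<cdot>\<^bsub>C\<^esub> fmul X \<and>
     fcomul X \<cdot>\<^bsub>C\<^esub> fmul X = (fmul X \<otimes>\<^sub>a\<^bsub>C\<^esub> iden C (fobj X)) \<cdot>\<^bsub>C\<^esub> (iden C (fobj X) \<otimes>\<^sub>a\<^bsub>C\<^esub> fcomul X)"

definition frob_dual :: "('o, 'm) lmcat \<Rightarrow> ('o, 'm) frob \<Rightarrow> ('o, 'm) dual" where
  "frob_dual C X = \<lparr>dobj = fobj X, dev = fcounit X \<cdot>\<^bsub>C\<^esub> fmul X, dcoev = fcomul X \<cdot>\<^bsub>C\<^esub> funit X\<rparr>"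

text \<open>For an arrow between Frobenius algebras \<open>A\<close> and \<open>X\<close>, both selfdual, the dual goes from \<open>X\<close>
  to \<open>A\<close>.\<close>

definition frob_dual_arr ::
  "('o, 'm) lmcat \<Rightarrow> ('o, 'm) frob \<Rightarrow> ('o, 'm) frob \<Rightarrow> 'm \<Rightarrow> 'm" where
  "frob_dual_arr C A X f = dual_arr C (frob_dual C A) (frob_dual C X) f"

text \<open>A Frobenius subalgebra is recorded together with its inclusion, as a pair \<open>(A, i)\<close>.\<close>

type_synonym ('o, 'm) subfrob = "('o, 'm) frob \<times> 'm"

definition frobenius_subalgebra ::
  "('o, 'm) lmcat \<Rightarrow> ('o, 'm) frob \<Rightarrow> ('o, 'm) subfrob \<Rightarrow> bool" where
  "frobenius_subalgebra C X = (\<lambda>(A, i).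
     frobenius_algebra C A \<and> i \<in> homset C (fobj A) (fobj X) \<and> is_mono C i \<and>
     i \<cdot>\<^bsub>C\<^esub> fmul A = fmul X \<cdot>\<^bsub>C\<^esub> (i \<otimes>\<^sub>a\<^bsub>C\<^esub> i) \<and> i \<cdot>\<^bsub>C\<^esub> funit A = funit X \<and>
     frob_dual_arr C X A (frob_dual_arr C A X i) = i \<and>
     frob_dual_arr C A X i \<cdot>\<^bsub>C\<^esub> i = iden C (fobj A))"

definition sub_idem :: "('o, 'm) lmcat \<Rightarrow> ('o, 'm) frob \<Rightarrow> ('o, 'm) subfrob \<Rightarrow> 'm" where
  "sub_idem C X = (\<lambda>(A, i). i \<cdot>\<^bsub>C\<^esub> frob_dual_arr C A X i)"

definition sub_class ::
  "('o, 'm) lmcat \<Rightarrow> ('o, 'm) frob \<Rightarrow> ('o, 'm) subfrob \<Rightarrow> ('o, 'm) subfrob set" where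
  "sub_class C X p = {q. frobenius_subalgebra C X q \<and> sub_idem C X q = sub_idem C X p}"

definition frobenius_subalgebra_poset ::
  "('o, 'm) lmcat \<Rightarrow> ('o, 'm) frob \<Rightarrow> ('o, 'm) subfrob set gorder" where
  "frobenius_subalgebra_poset C X =
     \<lparr>carrier = {sub_class C X p | p. frobenius_subalgebra C X p},
      eq = (=),
      le = (\<lambda>P Q. \<exists>p\<in>P. \<exists>q\<in>Q.
              sub_idem C X p \<cdot>\<^bsub>C\<^esub> sub_idem C X q = sub_idem C X p \<and>
              sub_idem C X p = sub_idem C X q \<cdot>\<^bsub>C\<^esub> sub_idem C X p)\<rparr>"


section \<open>Bases and rigid invariance\<close>

definition is_vs_basis :: "(complex, 'm) module \<Rightarrow> 'm set \<Rightarrow> bool" where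
  "is_vs_basis V Bs \<longleftrightarrow> Bs \<subseteq> carrier V \<and>
     (\<forall>v\<in>carrier V. \<exists>!c. finite {b. c b \<noteq> 0} \<and> {b. c b \<noteq> 0} \<subseteq> Bs \<and>
        v = finsum V (\<lambda>b. c b \<odot>\<^bsub>V\<^esub> b) {b. c b \<noteq> 0})"

definition coords :: "(complex, 'm) module \<Rightarrow> 'm set \<Rightarrow> 'm \<Rightarrow> 'm \<Rightarrow> complex" where
  "coords V Bs v = (THE c. finite {b. c b \<noteq> 0} \<and> {b. c b \<noteq> 0} \<subseteq> Bs \<and>
        v = finsum V (\<lambda>b. c b \<odot>\<^bsub>V\<^esub> b) {b. c b \<noteq> 0})"

text \<open>The Hermitian form, conjugate-linear in the second argument, for which the basis \<open>Bs\<close> is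
  orthonormal.\<close>

definition herm :: "(complex, 'm) module \<Rightarrow> 'm set \<Rightarrow> 'm \<Rightarrow> 'm \<Rightarrow> complex" where
  "herm V Bs u v =
     (\<Sum>b | coords V Bs u b \<noteq> 0. coords V Bs u b * cnj (coords V Bs v b))"

text \<open>A basis of the object \<open>x\<close>: representatives \<open>R\<close> of the isomorphism classes of simple objects
  and, for each \<open>S \<in> R\<close>, a basis \<open>B S\<close> of \<open>Hom(x, S)\<close>.\<close>

definition object_basis :: "('o, 'm) lmcat \<Rightarrow> 'o \<Rightarrow> 'o set \<Rightarrow> ('o \<Rightarrow> 'm set) \<Rightarrow> bool" where
  "object_basis C x R B \<longleftrightarrow> simple_reps C R \<and> (\<forall>S\<in>R. is_vs_basis (hom_space C x S) (B S))"

text \<open>\<open>kappa' C Dx DS f g\<close> is \<open>\<kappa>'(f, g)\<close> for \<open>f : x \<rightarrow> S\<close> and \<open>g : x\<^sup>* \<rightarrow> S\<^sup>*\<close>, where \<open>Dx\<close> and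
  \<open>DS\<close> are the chosen left duals of \<open>x\<close> and \<open>S\<close>. It is well defined for simple \<open>S\<close> with
  \<open>End(S) = \<complex>\<close>: then \<open>Hom(\<one>, S \<otimes> S\<^sup>*)\<close>, isomorphic to \<open>End(S)\<close>, is spanned by the nonzero arrow
  \<open>coev\<close> of \<open>S\<close>.\<close>

definition kappa' ::
  "('o, 'm) lmcat \<Rightarrow> ('o, 'm) dual \<Rightarrow> ('o, 'm) dual \<Rightarrow> 'm \<Rightarrow> 'm \<Rightarrow> complex" where
  "kappa' C Dx DS f g = (THE c. (f \<otimes>\<^sub>a\<^bsub>C\<^esub> g) \<cdot>\<^bsub>C\<^esub> dcoev Dx = hscale C c (dcoev DS))"

definition M' :: "('o, 'm) lmcat \<Rightarrow> ('o \<Rightarrow> 'm set) \<Rightarrow> 'o \<Rightarrow> ('o, 'm) dual \<Rightarrow> 'o \<Rightarrow> ('o, 'm) dual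
    \<Rightarrow> 'm \<Rightarrow> 'm" where
  "M' C B x Dx S DS g = (THE h. h \<in> homset C x S \<and>
     (\<forall>f \<in> homset C x S. herm (hom_space C x S) (B S) f h = kappa' C Dx DS f g))"

text \<open>Rigid invariance of the split subobject \<open>(a, i, p)\<close> of \<open>x\<close>, where \<open>Da\<close> and \<open>Dx\<close> are the
  chosen left duals of \<open>a\<close> and \<open>x\<close>. The quantification over all left duals \<open>DS\<close> of \<open>S\<close> avoids
  a choice: replacing \<open>S\<^sup>*\<close> by an isomorphic dual does not change the image of \<open>M'\<close>.\<close>

definition rigid_invariant ::
  "('o, 'm) lmcat \<Rightarrow> 'o set \<Rightarrow> ('o \<Rightarrow> 'm set) \<Rightarrow> 'o \<Rightarrow> ('o, 'm) dual
     \<Rightarrow> 'o \<Rightarrow> ('o, 'm) dual \<Rightarrow> 'm \<Rightarrow> 'm \<Rightarrow> bool" where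
  "rigid_invariant C R B x Dx a Da i p \<longleftrightarrow>
     i \<in> homset C a x \<and> p \<in> homset C x a \<and> p \<cdot>\<^bsub>C\<^esub> i = iden C a \<and>
     (\<forall>S\<in>R. \<forall>DS. left_dual C S DS \<longrightarrow>
        M' C B x Dx S DS ` ((\<lambda>g. g \<cdot>\<^bsub>C\<^esub> dual_arr C Da Dx i) ` homset C (dobj Da) (dobj DS))
          = (\<lambda>f. f \<cdot>\<^bsub>C\<^esub> p) ` homset C a S)"

definition frobenius_basis_subalgebra ::
  "('o, 'm) lmcat \<Rightarrow> ('o, 'm) frob \<Rightarrow> 'o set \<Rightarrow> ('o \<Rightarrow> 'm set) \<Rightarrow> ('o, 'm) subfrob \<Rightarrow> bool" where
  "frobenius_basis_subalgebra C X R B = (\<lambda>(A, i).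
     frobenius_subalgebra C X (A, i) \<and>
     rigid_invariant C R B (fobj X) (frob_dual C X) (fobj A) (frob_dual C A)
       i (frob_dual_arr C A X i))"

definition frobenius_basis_subalgebra_poset ::
  "('o, 'm) lmcat \<Rightarrow> ('o, 'm) frob \<Rightarrow> 'o set \<Rightarrow> ('o \<Rightarrow> 'm set) \<Rightarrow> ('o, 'm) subfrob set gorder" where
  "frobenius_basis_subalgebra_poset C X R B =
     (frobenius_subalgebra_poset C X)
       \<lparr>carrier := {sub_class C X p | p. frobenius_basis_subalgebra C X R B p}\<rparr>"

end

theory Submission
  imports Defs
begin

text \<open>Up to equivalence a Frobenius subalgebra \<open>(A, i)\<close> of \<open>X\<close> is the idempotent \<open>b = i \<cdot> i\<^sup>*\<close>. The
  idempotents that arise are those that are symmetric for the selfduality of \<open>X\<close>, fix the unit and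
  have an image closed under multiplication (\<open>idem_of_subalgebra\<close>, \<open>subalgebra_of_idem\<close>). Symmetry
  gives \<open>\<kappa>'(f \<cdot> b, g) = \<kappa>'(f, g \<cdot> b)\<close>, so \<open>M'\<close> turns right multiplication by \<open>b\<close> on \<open>Hom(X, S\<^sup>*)\<close> into
  the adjoint of right multiplication by \<open>b\<close> on \<open>Hom(X, S)\<close>. Since \<open>M'\<close> is onto, rigid invariance says
  that this adjoint has the same image as right multiplication by \<open>b\<close> itself; for an idempotent this
  means that right multiplication by \<open>b\<close> is an orthogonal projection of each \<open>Hom(X, S)\<close>
  (\<open>rigid_iff_selfadjoint\<close>). The poset is thereby a set of orthogonal projections in the
  finite-dimensional algebra \<open>End(X)\<close>, with \<open>a \<le> b\<close> iff \<open>b \<cdot> a = a\<close>.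

  Meets (\<open>basis_idem_meet\<close>). For two such projections \<open>a\<close> and \<open>b\<close> put \<open>N = (1 - a) + (1 - b)\<close>. By
  positivity \<open>z \<cdot> N = 0\<close> forces \<open>z \<cdot> a = z = z \<cdot> b\<close>, and \<open>z \<cdot> N \<cdot> N = 0\<close> forces \<open>z \<cdot> N = 0\<close>. As \<open>End(X)\<close> has
  finite dimension, some power \<open>N\<^sup>j\<close> lies in the span of the higher ones, so \<open>N\<^sup>j = t \<cdot> N\<^sup>j\<^sup>+\<^sup>1\<close> for a
  polynomial \<open>t\<close> in \<open>N\<close>, and \<open>q = 1 - t \<cdot> N\<close> satisfies \<open>q \<cdot> N = 0\<close>: it is the orthogonal projection onto
  the common fixed space of \<open>a\<close> and \<open>b\<close>. As a polynomial in \<open>N\<close> it inherits the symmetry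
  for the selfduality, and as it fixes every arrow into \<open>X\<close> fixed by both \<open>a\<close> and \<open>b\<close>, it fixes
  the unit and the products of arrows in its image. So \<open>q\<close> belongs to a Frobenius subalgebra again.

  Joins (\<open>basis_idem_join\<close>). The upper bounds of two projections contain \<open>1\<close> and are closed under
  these meets, and a strictly decreasing sequence of idempotents would be linearly independent; hence
  there is a minimal upper bound, which is then the least one.

  Intersections (\<open>intersection_is_meet\<close>). The inclusion \<open>k\<close> of the pullback is fixed by \<open>a\<close> and \<open>b\<close>,
  hence by \<open>q\<close>, while \<open>q\<close> factors through the pullback as \<open>q = k \<cdot> g\<close>. As \<open>k\<close> is mono, \<open>g \<cdot> k = 1\<close>, so \<open>k\<close>
  is the inclusion of a subalgebra with idempotent \<open>q\<close>.\<close>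

section \<open>Calculus in strict monoidal categories\<close>

context lm_category
begin

text \<open>Typing conditions are phrased with \<open>arrs\<close>, \<open>src\<close> and \<open>tgt\<close> wherever arrows are to be computed with:
  the simplifier then discharges them, also across the strict associativity and unit laws for objects.\<close>
lemma in_hom_iff: "f \<in> homset C x y \<longleftrightarrow> f \<in> arrs C \<and> src C f = x \<and> tgt C f = y"
  by (simp add: homset_def)

lemma iden_simps [simp]:
  assumes "x \<in> obs C"
  shows "iden C x \<in> arrs C" "src C (iden C x) = x" "tgt C (iden C x) = x"
  using iden_closed[OF assms] by (auto simp: in_hom_iff)

lemma compo_simps [simp]:
  assumes "f \<in> arrs C" "g \<in> arrs C" "tgt C f = src C g"
  shows "g \<cdot> f \<in> arrs C" "src C (g \<cdot> f) = src C f" "tgt C (g \<cdot> f) = tgt C g"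
  using compo_closed[of f "src C f" "tgt C f" g "tgt C g"] assms by (auto simp: in_hom_iff)

lemma iden_compo [simp]: "f \<in> arrs C \<Longrightarrow> tgt C f = y \<Longrightarrow> iden C y \<cdot> f = f"
  by (rule iden_left) (auto simp: in_hom_iff)

lemma compo_iden [simp]: "f \<in> arrs C \<Longrightarrow> src C f = x \<Longrightarrow> f \<cdot> iden C x = f"
  by (rule iden_right) (auto simp: in_hom_iff)

lemma compo_right_nested [simp]:
  "\<lbrakk>f \<in> arrs C; g \<in> arrs C; h \<in> arrs C; tgt C f = src C g; tgt C g = src C h\<rbrakk>
    \<Longrightarrow> (h \<cdot> g) \<cdot> f = h \<cdot> g \<cdot> f"
  by (rule compo_assoc) (auto simp: in_hom_iff)

declare src_closed [simp] tgt_closed [simp]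

text \<open>Composites are kept right-nested, so an equation \<open>g \<cdot> f = k\<close> is also needed in the form that applies
  inside a longer composite.\<close>
lemma compo_eq_assoc:
  "\<lbrakk>g \<cdot> f = k; f \<in> arrs C; g \<in> arrs C; tgt C f = src C g; h \<in> arrs C; tgt C h = src C f\<rbrakk>
    \<Longrightarrow> g \<cdot> f \<cdot> h = k \<cdot> h"
  using compo_right_nested[of h f g] by simp

lemma split_mono:
  assumes "k \<in> homset C a x" "h \<in> homset C x a" "h \<cdot> k = iden C a"
  shows "is_mono C k"
  unfolding is_mono_def
proof (intro conjI allI ballI impI)
  show "k \<in> arrs C" using assms by (simp add: in_hom_iff)
  fix w u v assume uv: "u \<in> homset C w (src C k)" "v \<in> homset C w (src C k)" and eq: "k \<cdot> u = k \<cdot> v"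
  have *: "h \<cdot> k \<cdot> t = t" if "t \<in> homset C w (src C k)" for t
    using compo_assoc[OF that, of k x h a] iden_left[OF that] assms by (simp add: in_hom_iff)
  have "u = h \<cdot> k \<cdot> u" using *[OF uv(1)] by (rule sym)
  also have "\<dots> = v" unfolding eq by (rule *[OF uv(2)])
  finally show "u = v" .
qed

end

context strict_monoidal_category
begin

lemma obs_simps [simp]: "tunit C \<in> obs C" "\<lbrakk>x \<in> obs C; y \<in> obs C\<rbrakk> \<Longrightarrow> x \<otimes>\<^sub>o y \<in> obs C"
  by (simp_all add: tunit_closed tobj_closed)

declare tobj_assoc [simp] tobj_unit_left [simp] tobj_unit_right [simp]
  tarr_assoc [simp] tarr_unit_left [simp] tarr_unit_right [simp] tarr_iden [simp]

lemma tarr_iden_assoc [simp]: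
  "\<lbrakk>x \<in> obs C; y \<in> obs C; f \<in> arrs C\<rbrakk> \<Longrightarrow> iden C x \<otimes>\<^sub>a iden C y \<otimes>\<^sub>a f = iden C (x \<otimes>\<^sub>o y) \<otimes>\<^sub>a f"
  by (subst tarr_assoc[symmetric]) simp_all

lemma tarr_simps [simp]:
  assumes "f \<in> arrs C" "g \<in> arrs C"
  shows "f \<otimes>\<^sub>a g \<in> arrs C" "src C (f \<otimes>\<^sub>a g) = src C f \<otimes>\<^sub>o src C g"
    "tgt C (f \<otimes>\<^sub>a g) = tgt C f \<otimes>\<^sub>o tgt C g"
  using tarr_closed[of f "src C f" "tgt C f" g "src C g" "tgt C g"] assms by (auto simp: in_hom_iff)

lemma tarr_exchange:
  "\<lbrakk>f \<in> arrs C; g \<in> arrs C; f' \<in> arrs C; g' \<in> arrs C; src C g = tgt C f; src C g' = tgt C f'\<rbrakk>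
    \<Longrightarrow> (g \<otimes>\<^sub>a g') \<cdot> (f \<otimes>\<^sub>a f') = (g \<cdot> f) \<otimes>\<^sub>a (g' \<cdot> f')"
  by (rule interchange[symmetric]) (auto simp: in_hom_iff)

lemma tarr_exchange_assoc:
  "\<lbrakk>f \<in> arrs C; g \<in> arrs C; f' \<in> arrs C; g' \<in> arrs C; src C g = tgt C f; src C g' = tgt C f';
    h \<in> arrs C; tgt C h = src C f \<otimes>\<^sub>o src C f'\<rbrakk>
    \<Longrightarrow> (g \<otimes>\<^sub>a g') \<cdot> (f \<otimes>\<^sub>a f') \<cdot> h = ((g \<cdot> f) \<otimes>\<^sub>a (g' \<cdot> f')) \<cdot> h"
  by (rule compo_eq_assoc) (simp_all add: tarr_exchange)

text \<open>Arrows on different tensor factors slide past each other by passing through \<open>f \<otimes> g\<close>, which is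
  rewritten here from either order.\<close>
lemma tarr_left_first:
  "\<lbrakk>f \<in> arrs C; g \<in> arrs C; tgt C f = y; src C g = x\<rbrakk>
    \<Longrightarrow> (iden C y \<otimes>\<^sub>a g) \<cdot> (f \<otimes>\<^sub>a iden C x) = f \<otimes>\<^sub>a g"
  by (subst tarr_exchange) auto

lemma tarr_right_first:
  "\<lbrakk>f \<in> arrs C; g \<in> arrs C; src C f = x; tgt C g = y\<rbrakk>
    \<Longrightarrow> (f \<otimes>\<^sub>a iden C y) \<cdot> (iden C x \<otimes>\<^sub>a g) = f \<otimes>\<^sub>a g"
  by (subst tarr_exchange) auto

lemma whisker_left:
  "\<lbrakk>f \<in> arrs C; g \<in> arrs C; src C g = tgt C f; x \<in> obs C\<rbrakk>
    \<Longrightarrow> iden C x \<otimes>\<^sub>a (g \<cdot> f) = (iden C x \<otimes>\<^sub>a g) \<cdot> (iden C x \<otimes>\<^sub>a f)"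
  by (subst tarr_exchange) auto

lemma whisker_right:
  "\<lbrakk>f \<in> arrs C; g \<in> arrs C; src C g = tgt C f; x \<in> obs C\<rbrakk>
    \<Longrightarrow> (g \<cdot> f) \<otimes>\<^sub>a iden C x = (g \<otimes>\<^sub>a iden C x) \<cdot> (f \<otimes>\<^sub>a iden C x)"
  by (subst tarr_exchange) auto

lemma whisker_eq_right:
  "\<lbrakk>g \<cdot> f = k; f \<in> arrs C; g \<in> arrs C; src C g = tgt C f; x \<in> obs C\<rbrakk>
    \<Longrightarrow> (g \<otimes>\<^sub>a iden C x) \<cdot> (f \<otimes>\<^sub>a iden C x) = k \<otimes>\<^sub>a iden C x"
  using whisker_right[of f g x] by simp

lemma whisker_eq_left:
  "\<lbrakk>g \<cdot> f = k; f \<in> arrs C; g \<in> arrs C; src C g = tgt C f; x \<in> obs C\<rbrakk>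
    \<Longrightarrow> (iden C x \<otimes>\<^sub>a g) \<cdot> (iden C x \<otimes>\<^sub>a f) = iden C x \<otimes>\<^sub>a k"
  using whisker_left[of f g x] by simp

text \<open>An arrow out of or into the unit object leaves no identity factor behind when another arrow slides
  past it.\<close>
lemma from_unit_left:
  "\<lbrakk>c \<in> homset C (tunit C) y; g \<in> homset C a b\<rbrakk> \<Longrightarrow> (c \<otimes>\<^sub>a iden C b) \<cdot> g = c \<otimes>\<^sub>a g"
  using tarr_right_first[of c g "tunit C" b] by (auto simp: in_hom_iff)

lemma from_unit_right:
  "\<lbrakk>c \<in> homset C (tunit C) y; g \<in> homset C a b\<rbrakk> \<Longrightarrow> (iden C b \<otimes>\<^sub>a c) \<cdot> g = g \<otimes>\<^sub>a c"
  using tarr_left_first[of g c b "tunit C"] by (auto simp: in_hom_iff)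

lemma to_unit_left:
  "\<lbrakk>e \<in> homset C y (tunit C); g \<in> homset C a b\<rbrakk> \<Longrightarrow> g \<cdot> (e \<otimes>\<^sub>a iden C a) = e \<otimes>\<^sub>a g"
  using tarr_left_first[of e g "tunit C" a] by (auto simp: in_hom_iff)

lemma to_unit_right:
  "\<lbrakk>e \<in> homset C y (tunit C); g \<in> homset C a b\<rbrakk> \<Longrightarrow> g \<cdot> (iden C a \<otimes>\<^sub>a e) = g \<otimes>\<^sub>a e"
  using tarr_right_first[of g e a "tunit C"] by (auto simp: in_hom_iff)

section \<open>Duals of arrows\<close>

lemma left_dual_simps:
  assumes "left_dual C x D"
  shows "x \<in> obs C" "dobj D \<in> obs C"
    "dev D \<in> arrs C" "src C (dev D) = dobj D \<otimes>\<^sub>o x" "tgt C (dev D) = tunit C"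
    "dcoev D \<in> arrs C" "src C (dcoev D) = tunit C" "tgt C (dcoev D) = x \<otimes>\<^sub>o dobj D"
    "(iden C x \<otimes>\<^sub>a dev D) \<cdot> (dcoev D \<otimes>\<^sub>a iden C x) = iden C x"
    "(dev D \<otimes>\<^sub>a iden C (dobj D)) \<cdot> (iden C (dobj D) \<otimes>\<^sub>a dcoev D) = iden C (dobj D)"
  using assms by (auto simp: left_dual_def in_hom_iff)

lemma dual_arr_hom:
  assumes "left_dual C x Dx" "left_dual C y Dy" "f \<in> homset C x y"
  shows "dual_arr C Dx Dy f \<in> homset C (dobj Dy) (dobj Dx)"
  using left_dual_simps[OF assms(1)] left_dual_simps[OF assms(2)] assms(3)
  by (auto simp: in_hom_iff dual_arr_def)

text \<open>Sliding \<open>f\<close> through the coevaluation. Together with the uniqueness below, this characterises the dual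
  of \<open>f\<close> by one equation between arrows out of the unit, so duals can be computed without their
  defining formula.\<close>
lemma dual_arr_coev:
  assumes "left_dual C x Dx" "left_dual C y Dy" "f \<in> homset C x y"
  shows "(iden C y \<otimes>\<^sub>a dual_arr C Dx Dy f) \<cdot> dcoev Dy = (f \<otimes>\<^sub>a iden C (dobj Dx)) \<cdot> dcoev Dx"
proof -
  note X = left_dual_simps[OF assms(1)] and Y = left_dual_simps[OF assms(2)]
  have f: "f \<in> arrs C" "src C f = x" "tgt C f = y" using assms(3) by (auto simp: in_hom_iff)
  let ?F = "(f \<otimes>\<^sub>a iden C (dobj Dx)) \<cdot> dcoev Dx"
  let ?e = "dev Dy" and ?s = "dobj Dy" and ?t = "dobj Dx"
  have "(iden C y \<otimes>\<^sub>a dual_arr C Dx Dy f) \<cdot> dcoev Dy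
      = (iden C y \<otimes>\<^sub>a ?e \<otimes>\<^sub>a iden C ?t) \<cdot> (iden C (y \<otimes>\<^sub>o ?s) \<otimes>\<^sub>a ?F) \<cdot> dcoev Dy"
    using X Y f by (simp add: dual_arr_def whisker_left flip: tarr_iden del: tarr_iden_assoc)
  also have "(iden C (y \<otimes>\<^sub>o ?s) \<otimes>\<^sub>a ?F) \<cdot> dcoev Dy = dcoev Dy \<otimes>\<^sub>a ?F"
    using from_unit_right[of ?F "y \<otimes>\<^sub>o ?t" "dcoev Dy" "tunit C" "y \<otimes>\<^sub>o ?s"] X Y f
    by (simp add: in_hom_iff)
  also have "\<dots> = (dcoev Dy \<otimes>\<^sub>a iden C (y \<otimes>\<^sub>o ?t)) \<cdot> ?F"
    using from_unit_left[of "dcoev Dy" "y \<otimes>\<^sub>o ?s" ?F "tunit C" "y \<otimes>\<^sub>o ?t"] X Y f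
    by (simp add: in_hom_iff)
  also have "(iden C y \<otimes>\<^sub>a ?e \<otimes>\<^sub>a iden C ?t) \<cdot> \<dots> = ?F"
  proof -
    have "(iden C y \<otimes>\<^sub>a ?e \<otimes>\<^sub>a iden C ?t) \<cdot> (dcoev Dy \<otimes>\<^sub>a iden C (y \<otimes>\<^sub>o ?t)) = iden C (y \<otimes>\<^sub>o ?t)"
      using whisker_eq_right[OF Y(9), of ?t] X Y f by simp
    from compo_eq_assoc[OF this, of ?F] show ?thesis using X Y f by simp
  qed
  finally show ?thesis .
qed

lemma dual_arr_unique:
  assumes "left_dual C x Dx" "left_dual C y Dy" "f \<in> homset C x y"
    and g: "g \<in> homset C (dobj Dy) (dobj Dx)"
    and eq: "(iden C y \<otimes>\<^sub>a g) \<cdot> dcoev Dy = (f \<otimes>\<^sub>a iden C (dobj Dx)) \<cdot> dcoev Dx"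
  shows "dual_arr C Dx Dy f = g"
proof -
  note X = left_dual_simps[OF assms(1)] and Y = left_dual_simps[OF assms(2)]
  have f: "f \<in> arrs C" "src C f = x" "tgt C f = y"
    and g: "g \<in> arrs C" "src C g = dobj Dy" "tgt C g = dobj Dx"
    using assms(3) g by (auto simp: in_hom_iff)
  let ?e = "dev Dy" and ?s = "dobj Dy" and ?t = "dobj Dx"
  have "dual_arr C Dx Dy f = (?e \<otimes>\<^sub>a iden C ?t) \<cdot> (iden C ?s \<otimes>\<^sub>a ((f \<otimes>\<^sub>a iden C ?t) \<cdot> dcoev Dx))"
    using X Y f by (simp add: dual_arr_def whisker_left)
  also have "\<dots> = (?e \<otimes>\<^sub>a iden C ?t) \<cdot> (iden C (?s \<otimes>\<^sub>o y) \<otimes>\<^sub>a g) \<cdot> (iden C ?s \<otimes>\<^sub>a dcoev Dy)"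
    using X Y f g by (simp add: eq[symmetric] whisker_left flip: tarr_iden del: tarr_iden_assoc)
  also have "\<dots> = (?e \<otimes>\<^sub>a g) \<cdot> (iden C ?s \<otimes>\<^sub>a dcoev Dy)"
    using X Y f g compo_eq_assoc[OF tarr_right_first[of ?e g "?s \<otimes>\<^sub>o y" ?t]] by simp
  also have "?e \<otimes>\<^sub>a g = g \<cdot> (?e \<otimes>\<^sub>a iden C ?s)"
    using X Y f g to_unit_left[of ?e "?s \<otimes>\<^sub>o y" g ?s ?t] by (simp add: in_hom_iff)
  also have "\<dots> \<cdot> (iden C ?s \<otimes>\<^sub>a dcoev Dy) = g"
    using X Y f g by simp
  finally show ?thesis .
qed

end

section \<open>Frobenius algebras from nondegenerate pairings\<close>

context strict_monoidal_category
begin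

text \<open>By the Frobenius relations both zigzags become \<open>(id \<otimes> \<epsilon>) \<cdot> \<delta> \<cdot> m \<cdot> (e \<otimes> id)\<close> or its mirror image.\<close>
lemma frob_left_dual:
  assumes "frobenius_algebra C X"
  shows "left_dual C (fobj X) (frob_dual C X)"
proof -
  let ?a = "fobj X" and ?I = "iden C (fobj X)"
  have h: "?a \<in> obs C" "fmul X \<in> arrs C" "src C (fmul X) = ?a \<otimes>\<^sub>o ?a" "tgt C (fmul X) = ?a"
    "fcomul X \<in> arrs C" "src C (fcomul X) = ?a" "tgt C (fcomul X) = ?a \<otimes>\<^sub>o ?a"
    "funit X \<in> arrs C" "src C (funit X) = tunit C" "tgt C (funit X) = ?a"
    "fcounit X \<in> arrs C" "src C (fcounit X) = ?a" "tgt C (fcounit X) = tunit C"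
    and u: "fmul X \<cdot> (funit X \<otimes>\<^sub>a ?I) = ?I" "fmul X \<cdot> (?I \<otimes>\<^sub>a funit X) = ?I"
    and c: "(fcounit X \<otimes>\<^sub>a ?I) \<cdot> fcomul X = ?I" "(?I \<otimes>\<^sub>a fcounit X) \<cdot> fcomul X = ?I"
    and F: "(?I \<otimes>\<^sub>a fmul X) \<cdot> (fcomul X \<otimes>\<^sub>a ?I) = fcomul X \<cdot> fmul X"
      "(fmul X \<otimes>\<^sub>a ?I) \<cdot> (?I \<otimes>\<^sub>a fcomul X) = fcomul X \<cdot> fmul X"
    using assms
    by (auto simp: frobenius_algebra_def unital_algebra_def counital_coalgebra_def in_hom_iff)
  have "(?I \<otimes>\<^sub>a (fcounit X \<cdot> fmul X)) \<cdot> ((fcomul X \<cdot> funit X) \<otimes>\<^sub>a ?I) = ?I"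
    using h by (simp add: whisker_left whisker_right compo_eq_assoc[OF F(1)] u c)
  moreover have "((fcounit X \<cdot> fmul X) \<otimes>\<^sub>a ?I) \<cdot> (?I \<otimes>\<^sub>a (fcomul X \<cdot> funit X)) = ?I"
    using h by (simp add: whisker_left whisker_right compo_eq_assoc[OF F(2)] u c)
  ultimately show ?thesis using h by (simp add: left_dual_def frob_dual_def in_hom_iff)
qed

text \<open>The comultiplication \<open>d\<close> is obtained by opening a copairing \<open>c\<close> next to the multiplication. That \<open>c\<close>
  may be placed on either side (the equation \<open>d2\<close> in the proof) follows by inserting a zigzag and using
  that \<open>\<epsilon> \<cdot> m\<close> is an invariant pairing; with both forms of \<open>d\<close> at hand each Frobenius relation is associativity of
  \<open>m\<close>. This produces a Frobenius structure with a prescribed selfduality, so only the multiplication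
  and the pairing of a subalgebra have to be constructed.\<close>
lemma frobenius_of_copairing:
  assumes alg: "unital_algebra C a m e"
    and eps: "eps \<in> homset C a (tunit C)" and c: "c \<in> homset C (tunit C) (a \<otimes>\<^sub>o a)"
    and z1: "(iden C a \<otimes>\<^sub>a (eps \<cdot> m)) \<cdot> (c \<otimes>\<^sub>a iden C a) = iden C a"
    and z2: "((eps \<cdot> m) \<otimes>\<^sub>a iden C a) \<cdot> (iden C a \<otimes>\<^sub>a c) = iden C a"
  shows "\<exists>K. fobj K = a \<and> fmul K = m \<and> funit K = e \<and> frobenius_algebra C K \<and>
    frob_dual C K = \<lparr>dobj = a, dev = eps \<cdot> m, dcoev = c\<rparr>"
proof -
  let ?I = "iden C a" and ?I2 = "iden C (a \<otimes>\<^sub>o a)" and ?I3 = "iden C (a \<otimes>\<^sub>o a \<otimes>\<^sub>o a)"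
  have a: "a \<in> obs C" and m: "m \<in> arrs C" "src C m = a \<otimes>\<^sub>o a" "tgt C m = a"
    and e: "e \<in> arrs C" "src C e = tunit C" "tgt C e = a"
    and ass: "m \<cdot> (m \<otimes>\<^sub>a ?I) = m \<cdot> (?I \<otimes>\<^sub>a m)" and ul: "m \<cdot> (e \<otimes>\<^sub>a ?I) = ?I" and ur: "m \<cdot> (?I \<otimes>\<^sub>a e) = ?I"
    using alg by (auto simp: unital_algebra_def in_hom_iff)
  have mh: "m \<in> homset C (a \<otimes>\<^sub>o a) a" using m by (simp add: in_hom_iff)
  have ep: "eps \<in> arrs C" "src C eps = a" "tgt C eps = tunit C"
    and ch: "c \<in> arrs C" "src C c = tunit C" "tgt C c = a \<otimes>\<^sub>o a"
    using eps c by (auto simp: in_hom_iff)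
  note t [simp] = a m e ep ch
  define ev where "ev = eps \<cdot> m"
  have ev [simp]: "ev \<in> arrs C" "src C ev = a \<otimes>\<^sub>o a" "tgt C ev = tunit C" by (simp_all add: ev_def)
  define d where "d = (?I \<otimes>\<^sub>a m) \<cdot> (c \<otimes>\<^sub>a ?I)"
  have d [simp]: "d \<in> arrs C" "src C d = a" "tgt C d = a \<otimes>\<^sub>o a" by (simp_all add: d_def)
  note z1 = z1[folded ev_def] and z2 = z2[folded ev_def]
  \<comment> \<open>The pairing is invariant.\<close>
  have evass: "ev \<cdot> (m \<otimes>\<^sub>a ?I) = ev \<cdot> (?I \<otimes>\<^sub>a m)" by (simp add: ev_def ass)
  have d2: "d = (m \<otimes>\<^sub>a ?I) \<cdot> (?I \<otimes>\<^sub>a c)"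
  proof -
    have "d = (?I \<otimes>\<^sub>a ((ev \<otimes>\<^sub>a ?I) \<cdot> (?I \<otimes>\<^sub>a c))) \<cdot> d" by (simp add: z2)
    also have "\<dots> = (?I \<otimes>\<^sub>a ev \<otimes>\<^sub>a ?I) \<cdot> (?I2 \<otimes>\<^sub>a c) \<cdot> d"
      by (simp add: whisker_left)
    also have "(?I2 \<otimes>\<^sub>a c) \<cdot> d = (?I2 \<otimes>\<^sub>a c) \<cdot> (?I \<otimes>\<^sub>a m) \<cdot> (c \<otimes>\<^sub>a ?I)" by (simp add: d_def)
    also have "\<dots> = (?I \<otimes>\<^sub>a m \<otimes>\<^sub>a ?I2) \<cdot> (?I3 \<otimes>\<^sub>a c) \<cdot> (c \<otimes>\<^sub>a ?I)"
    proof -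
      have "(?I2 \<otimes>\<^sub>a c) \<cdot> (?I \<otimes>\<^sub>a m) = ?I \<otimes>\<^sub>a m \<otimes>\<^sub>a c"
        using tarr_left_first[of "?I \<otimes>\<^sub>a m" c "a \<otimes>\<^sub>o a" "tunit C"] by simp
      moreover have "(?I \<otimes>\<^sub>a m \<otimes>\<^sub>a ?I2) \<cdot> (?I3 \<otimes>\<^sub>a c) = ?I \<otimes>\<^sub>a m \<otimes>\<^sub>a c"
        using tarr_right_first[of "?I \<otimes>\<^sub>a m" c "a \<otimes>\<^sub>o a \<otimes>\<^sub>o a" "a \<otimes>\<^sub>o a"] by simp
      ultimately show ?thesis
        using compo_eq_assoc[of "?I2 \<otimes>\<^sub>a c" "?I \<otimes>\<^sub>a m" _ "c \<otimes>\<^sub>a ?I"]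
          compo_eq_assoc[of "?I \<otimes>\<^sub>a m \<otimes>\<^sub>a ?I2" "?I3 \<otimes>\<^sub>a c" _ "c \<otimes>\<^sub>a ?I"] by simp
    qed
    also have "(?I3 \<otimes>\<^sub>a c) \<cdot> (c \<otimes>\<^sub>a ?I) = c \<otimes>\<^sub>a ?I \<otimes>\<^sub>a c"
      using tarr_left_first[of "c \<otimes>\<^sub>a ?I" c "a \<otimes>\<^sub>o a \<otimes>\<^sub>o a" "tunit C"] by simp
    also have "\<dots> = (c \<otimes>\<^sub>a ?I3) \<cdot> (?I \<otimes>\<^sub>a c)"
      using tarr_right_first[of c "?I \<otimes>\<^sub>a c" "tunit C" "a \<otimes>\<^sub>o a \<otimes>\<^sub>o a"] by simp
    also have "(?I \<otimes>\<^sub>a ev \<otimes>\<^sub>a ?I) \<cdot> (?I \<otimes>\<^sub>a m \<otimes>\<^sub>a ?I2) \<cdot> \<dots>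
        = (?I \<otimes>\<^sub>a ev \<otimes>\<^sub>a ?I) \<cdot> (?I2 \<otimes>\<^sub>a m \<otimes>\<^sub>a ?I) \<cdot> (c \<otimes>\<^sub>a ?I3) \<cdot> (?I \<otimes>\<^sub>a c)"
    proof -
      let ?k = "?I \<otimes>\<^sub>a (ev \<cdot> (?I \<otimes>\<^sub>a m)) \<otimes>\<^sub>a ?I"
      have "(?I \<otimes>\<^sub>a ev \<otimes>\<^sub>a ?I) \<cdot> (?I \<otimes>\<^sub>a m \<otimes>\<^sub>a ?I2) = ?k"
        using whisker_eq_left[OF whisker_eq_right[OF evass, of a], of a] by simp
      moreover have "(?I \<otimes>\<^sub>a ev \<otimes>\<^sub>a ?I) \<cdot> (?I2 \<otimes>\<^sub>a m \<otimes>\<^sub>a ?I) = ?k"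
        by (simp add: whisker_left whisker_right)
      ultimately show ?thesis
        using compo_eq_assoc[of "?I \<otimes>\<^sub>a ev \<otimes>\<^sub>a ?I" "?I \<otimes>\<^sub>a m \<otimes>\<^sub>a ?I2" ?k "(c \<otimes>\<^sub>a ?I3) \<cdot> (?I \<otimes>\<^sub>a c)"]
          compo_eq_assoc[of "?I \<otimes>\<^sub>a ev \<otimes>\<^sub>a ?I" "?I2 \<otimes>\<^sub>a m \<otimes>\<^sub>a ?I" ?k "(c \<otimes>\<^sub>a ?I3) \<cdot> (?I \<otimes>\<^sub>a c)"] by simp
    qed
    also have "(?I2 \<otimes>\<^sub>a m \<otimes>\<^sub>a ?I) \<cdot> (c \<otimes>\<^sub>a ?I3) \<cdot> (?I \<otimes>\<^sub>a c) = (c \<otimes>\<^sub>a ?I2) \<cdot> (m \<otimes>\<^sub>a ?I) \<cdot> (?I \<otimes>\<^sub>a c)"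
    proof -
      have "(?I2 \<otimes>\<^sub>a m \<otimes>\<^sub>a ?I) \<cdot> (c \<otimes>\<^sub>a ?I3) = c \<otimes>\<^sub>a m \<otimes>\<^sub>a ?I"
        using tarr_left_first[of c "m \<otimes>\<^sub>a ?I" "a \<otimes>\<^sub>o a" "a \<otimes>\<^sub>o a \<otimes>\<^sub>o a"] by simp
      moreover have "(c \<otimes>\<^sub>a ?I2) \<cdot> (m \<otimes>\<^sub>a ?I) = c \<otimes>\<^sub>a m \<otimes>\<^sub>a ?I"
        using tarr_right_first[of c "m \<otimes>\<^sub>a ?I" "tunit C" "a \<otimes>\<^sub>o a"] by simp
      ultimately show ?thesis
        using compo_eq_assoc[of "?I2 \<otimes>\<^sub>a m \<otimes>\<^sub>a ?I" "c \<otimes>\<^sub>a ?I3" _ "?I \<otimes>\<^sub>a c"]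
          compo_eq_assoc[of "c \<otimes>\<^sub>a ?I2" "m \<otimes>\<^sub>a ?I" _ "?I \<otimes>\<^sub>a c"] by simp
    qed
    also have "(?I \<otimes>\<^sub>a ev \<otimes>\<^sub>a ?I) \<cdot> \<dots> = (m \<otimes>\<^sub>a ?I) \<cdot> (?I \<otimes>\<^sub>a c)"
    proof -
      have "(?I \<otimes>\<^sub>a ev \<otimes>\<^sub>a ?I) \<cdot> (c \<otimes>\<^sub>a ?I2) = ?I2"
        using whisker_eq_right[OF z1, of a] by simp
      from compo_eq_assoc[OF this, of "(m \<otimes>\<^sub>a ?I) \<cdot> (?I \<otimes>\<^sub>a c)"] show ?thesis by simp
    qed
    finally show ?thesis .
  qed
  have F1: "(?I \<otimes>\<^sub>a m) \<cdot> (d \<otimes>\<^sub>a ?I) = d \<cdot> m"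
  proof -
    have "(?I \<otimes>\<^sub>a m) \<cdot> (d \<otimes>\<^sub>a ?I) = (?I \<otimes>\<^sub>a m) \<cdot> (?I \<otimes>\<^sub>a m \<otimes>\<^sub>a ?I) \<cdot> (c \<otimes>\<^sub>a ?I2)"
      by (simp add: d_def whisker_right)
    also have "\<dots> = (?I \<otimes>\<^sub>a m) \<cdot> (?I2 \<otimes>\<^sub>a m) \<cdot> (c \<otimes>\<^sub>a ?I2)"
      using compo_eq_assoc[OF whisker_eq_left[OF ass, of a], of "c \<otimes>\<^sub>a ?I2"] by (simp add: whisker_left)
    also have "(?I2 \<otimes>\<^sub>a m) \<cdot> (c \<otimes>\<^sub>a ?I2) = (c \<otimes>\<^sub>a ?I) \<cdot> m"
      using tarr_left_first[of c m "a \<otimes>\<^sub>o a" "a \<otimes>\<^sub>o a"] from_unit_left[OF c mh] by simp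
    finally show ?thesis by (simp add: d_def)
  qed
  have F2: "(m \<otimes>\<^sub>a ?I) \<cdot> (?I \<otimes>\<^sub>a d) = d \<cdot> m"
  proof -
    have "(m \<otimes>\<^sub>a ?I) \<cdot> (?I \<otimes>\<^sub>a d) = (m \<otimes>\<^sub>a ?I) \<cdot> (?I \<otimes>\<^sub>a m \<otimes>\<^sub>a ?I) \<cdot> (?I2 \<otimes>\<^sub>a c)"
      by (simp add: d2 whisker_left)
    also have "\<dots> = (m \<otimes>\<^sub>a ?I) \<cdot> (m \<otimes>\<^sub>a ?I2) \<cdot> (?I2 \<otimes>\<^sub>a c)"
      using compo_eq_assoc[OF whisker_eq_right[OF ass, of a], of "?I2 \<otimes>\<^sub>a c"] by (simp add: whisker_right)
    also have "(m \<otimes>\<^sub>a ?I2) \<cdot> (?I2 \<otimes>\<^sub>a c) = (?I \<otimes>\<^sub>a c) \<cdot> m"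
      using tarr_right_first[of m c "a \<otimes>\<^sub>o a" "a \<otimes>\<^sub>o a"] from_unit_right[OF c mh] by simp
    finally show ?thesis by (simp add: d2)
  qed
  have cu1: "(eps \<otimes>\<^sub>a ?I) \<cdot> d = ?I"
    using z2 by (simp add: d2 ev_def whisker_right)
  have cu2: "(?I \<otimes>\<^sub>a eps) \<cdot> d = ?I"
    using z1 by (simp add: d_def ev_def whisker_left)
  have coass: "(d \<otimes>\<^sub>a ?I) \<cdot> d = (?I \<otimes>\<^sub>a d) \<cdot> d"
  proof -
    have "(d \<otimes>\<^sub>a ?I) \<cdot> d = (d \<otimes>\<^sub>a ?I) \<cdot> (m \<otimes>\<^sub>a ?I) \<cdot> (?I \<otimes>\<^sub>a c)" by (subst (2) d2) simp
    also have "\<dots> = (?I \<otimes>\<^sub>a m \<otimes>\<^sub>a ?I) \<cdot> (d \<otimes>\<^sub>a ?I2) \<cdot> (?I \<otimes>\<^sub>a c)"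
      using compo_eq_assoc[OF whisker_eq_right[OF F1, of a], of "?I \<otimes>\<^sub>a c"] by (simp add: whisker_right)
    also have "(d \<otimes>\<^sub>a ?I2) \<cdot> (?I \<otimes>\<^sub>a c) = (?I2 \<otimes>\<^sub>a c) \<cdot> d"
      using tarr_right_first[of d c a "a \<otimes>\<^sub>o a"] tarr_left_first[of d c "a \<otimes>\<^sub>o a" "tunit C"] by simp
    also have "(?I \<otimes>\<^sub>a m \<otimes>\<^sub>a ?I) \<cdot> (?I2 \<otimes>\<^sub>a c) \<cdot> d = (?I \<otimes>\<^sub>a d) \<cdot> d"
      using compo_eq_assoc[OF whisker_eq_left[OF d2[symmetric], of a], of d] by simp
    finally show ?thesis .
  qed
  have cv: "d \<cdot> e = c"
  proof -
    have "d \<cdot> e = (?I \<otimes>\<^sub>a m) \<cdot> (c \<otimes>\<^sub>a ?I) \<cdot> e" by (simp add: d_def)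
    also have "(c \<otimes>\<^sub>a ?I) \<cdot> e = (?I2 \<otimes>\<^sub>a e) \<cdot> c"
      using tarr_right_first[of c e "tunit C" a] tarr_left_first[of c e "a \<otimes>\<^sub>o a" "tunit C"] by simp
    also have "(?I \<otimes>\<^sub>a m) \<cdot> \<dots> = c"
      using compo_eq_assoc[OF whisker_eq_left[OF ur, of a], of c] by simp
    finally show ?thesis .
  qed
  let ?K = "\<lparr>fobj = a, fmul = m, fcomul = d, funit = e, fcounit = eps\<rparr>"
  have "frobenius_algebra C ?K"
    using alg eps coass cu1 cu2 F1 F2
    by (simp add: frobenius_algebra_def counital_coalgebra_def in_hom_iff)
  then show ?thesis
    by (intro exI[of _ ?K]) (simp add: frob_dual_def cv)
qed

end

section \<open>Frobenius subalgebras as idempotents\<close>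

context strict_monoidal_category
begin

text \<open>The last equation says that \<open>q\<^sup>* = q\<close>; stated with the coevaluation, it is visibly linear in \<open>q\<close> and
  compatible with composition of commuting arrows.\<close>
definition subalgebra_idem :: "('a, 'b) frob \<Rightarrow> 'b \<Rightarrow> bool" where
  "subalgebra_idem X q \<longleftrightarrow> q \<in> homset C (fobj X) (fobj X) \<and> q \<cdot> q = q \<and>
     q \<cdot> funit X = funit X \<and> q \<cdot> fmul X \<cdot> (q \<otimes>\<^sub>a q) = fmul X \<cdot> (q \<otimes>\<^sub>a q) \<and>
     (q \<otimes>\<^sub>a iden C (fobj X)) \<cdot> dcoev (frob_dual C X)
       = (iden C (fobj X) \<otimes>\<^sub>a q) \<cdot> dcoev (frob_dual C X)"

lemma frobenius_simps:
  assumes "frobenius_algebra C X"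
  shows "fobj X \<in> obs C" "fmul X \<in> arrs C" "src C (fmul X) = fobj X \<otimes>\<^sub>o fobj X" "tgt C (fmul X) = fobj X"
    "funit X \<in> arrs C" "src C (funit X) = tunit C" "tgt C (funit X) = fobj X"
    "fcounit X \<in> arrs C" "src C (fcounit X) = fobj X" "tgt C (fcounit X) = tunit C"
    "fmul X \<cdot> (funit X \<otimes>\<^sub>a iden C (fobj X)) = iden C (fobj X)"
    "fmul X \<cdot> (iden C (fobj X) \<otimes>\<^sub>a funit X) = iden C (fobj X)"
    "fmul X \<cdot> (fmul X \<otimes>\<^sub>a iden C (fobj X)) = fmul X \<cdot> (iden C (fobj X) \<otimes>\<^sub>a fmul X)"
    "dobj (frob_dual C X) = fobj X" "dev (frob_dual C X) = fcounit X \<cdot> fmul X"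
  using assms
  by (auto simp: frobenius_algebra_def unital_algebra_def counital_coalgebra_def in_hom_iff frob_dual_def)

text \<open>Multiplication, unit, counit and copairing of \<open>X\<close> are compressed to the image \<open>a\<close> of \<open>q = k \<cdot> h\<close>.
  Closure of the image makes \<open>k\<close> multiplicative. The copairing \<open>(h \<otimes> h) \<cdot> c\<close> still satisfies the zigzag
  identities because, by symmetry of \<open>q\<close>, applying \<open>q\<close> to one leg of \<open>c\<close> is absorbed when \<open>h\<close> is
  applied to the other (\<open>cq1\<close>, \<open>cq2\<close>); the same two equations show that \<open>k\<close> and \<open>h\<close> are dual to each
  other.\<close>
lemma subalgebra_of_idem:
  assumes X: "frobenius_algebra C X" and q: "subalgebra_idem X q"
    and k: "k \<in> homset C a (fobj X)" and h: "h \<in> homset C (fobj X) a"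
    and hk: "h \<cdot> k = iden C a" and kh: "k \<cdot> h = q"
  shows "\<exists>K. fobj K = a \<and> frobenius_subalgebra C X (K, k) \<and> frob_dual_arr C K X k = h"
proof -
  let ?x = "fobj X" and ?m = "fmul X" and ?I = "iden C (fobj X)" and ?J = "iden C a"
  define c where "c = dcoev (frob_dual C X)"
  define ev where "ev = fcounit X \<cdot> fmul X"
  note LD = frob_left_dual[OF X]
  note Xs [simp] = frobenius_simps(1-12)[OF X]
  note ass = frobenius_simps(13)[OF X]
  have [simp]: "c \<in> arrs C" "src C c = tunit C" "tgt C c = ?x \<otimes>\<^sub>o ?x"
    and zig1: "(?I \<otimes>\<^sub>a ev) \<cdot> (c \<otimes>\<^sub>a ?I) = ?I" and zig2: "(ev \<otimes>\<^sub>a ?I) \<cdot> (?I \<otimes>\<^sub>a c) = ?I"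
    using left_dual_simps[OF LD] by (simp_all add: c_def ev_def frobenius_simps[OF X])
  have [simp]: "ev \<in> arrs C" "src C ev = ?x \<otimes>\<^sub>o ?x" "tgt C ev = tunit C" by (simp_all add: ev_def)
  have [simp]: "k \<in> arrs C" "src C k = a" "tgt C k = ?x" "h \<in> arrs C" "src C h = ?x" "tgt C h = a"
    "q \<in> arrs C" "src C q = ?x" "tgt C q = ?x"
    using k h q by (auto simp: in_hom_iff subalgebra_idem_def)
  have a [simp]: "a \<in> obs C" using src_closed[of k] by simp
  have qe: "q \<cdot> funit X = funit X" and qm: "q \<cdot> ?m \<cdot> (q \<otimes>\<^sub>a q) = ?m \<cdot> (q \<otimes>\<^sub>a q)"
    and sym: "(q \<otimes>\<^sub>a ?I) \<cdot> c = (?I \<otimes>\<^sub>a q) \<cdot> c"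
    using q by (auto simp: subalgebra_idem_def c_def)
  have hq: "h \<cdot> q = h" unfolding kh[symmetric] using compo_eq_assoc[OF hk, of h] by simp
  have qk: "q \<cdot> k = k" unfolding kh[symmetric] using hk by simp
  have cq1: "(h \<otimes>\<^sub>a q) \<cdot> c = (h \<otimes>\<^sub>a ?I) \<cdot> c"
  proof -
    have "(h \<otimes>\<^sub>a q) \<cdot> c = (h \<otimes>\<^sub>a ?I) \<cdot> (?I \<otimes>\<^sub>a q) \<cdot> c"
      using compo_eq_assoc[OF tarr_right_first[of h q ?x ?x], of c] by simp
    also have "\<dots> = ((h \<cdot> q) \<otimes>\<^sub>a ?I) \<cdot> c" by (simp add: sym[symmetric] tarr_exchange_assoc)
    finally show ?thesis by (simp add: hq)
  qed
  have cq2: "(q \<otimes>\<^sub>a h) \<cdot> c = (?I \<otimes>\<^sub>a h) \<cdot> c"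
  proof -
    have "(q \<otimes>\<^sub>a h) \<cdot> c = (?I \<otimes>\<^sub>a h) \<cdot> (q \<otimes>\<^sub>a ?I) \<cdot> c"
      using compo_eq_assoc[OF tarr_left_first[of q h ?x ?x], of c] by simp
    also have "\<dots> = (?I \<otimes>\<^sub>a (h \<cdot> q)) \<cdot> c" by (simp add: sym tarr_exchange_assoc)
    finally show ?thesis by (simp add: hq)
  qed
  define mA where "mA = h \<cdot> ?m \<cdot> (k \<otimes>\<^sub>a k)"
  define eA where "eA = h \<cdot> funit X"
  define cA where "cA = (h \<otimes>\<^sub>a h) \<cdot> c"
  have [simp]: "mA \<in> arrs C" "src C mA = a \<otimes>\<^sub>o a" "tgt C mA = a"
    "eA \<in> arrs C" "src C eA = tunit C" "tgt C eA = a"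
    "cA \<in> arrs C" "src C cA = tunit C" "tgt C cA = a \<otimes>\<^sub>o a"
    by (simp_all add: mA_def eA_def cA_def)
  have km: "k \<cdot> mA = ?m \<cdot> (k \<otimes>\<^sub>a k)"
  proof -
    have "k \<cdot> mA = (q \<cdot> ?m \<cdot> (q \<otimes>\<^sub>a q)) \<cdot> (k \<otimes>\<^sub>a k)"
      by (simp add: mA_def tarr_exchange qk compo_eq_assoc[OF kh])
    also have "\<dots> = ?m \<cdot> (k \<otimes>\<^sub>a k)" unfolding qm by (simp add: tarr_exchange qk)
    finally show ?thesis .
  qed
  have ke: "k \<cdot> eA = funit X" by (simp add: eA_def compo_eq_assoc[OF kh] qe)
  have mono: "f = g" if "k \<cdot> f = k \<cdot> g" "f \<in> arrs C" "g \<in> arrs C" "tgt C f = a" "tgt C g = a" for f g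
  proof -
    have "h \<cdot> k \<cdot> t = t" if "t \<in> arrs C" "tgt C t = a" for t
      using that by (simp add: compo_eq_assoc[OF hk])
    from this[of f] this[of g] show ?thesis using that by argo
  qed
  have "unital_algebra C a mA eA"
    unfolding unital_algebra_def
  proof (intro conjI)
    show "mA \<cdot> (mA \<otimes>\<^sub>a ?J) = mA \<cdot> (?J \<otimes>\<^sub>a mA)"
    proof (rule mono)
      have "k \<cdot> mA \<cdot> (mA \<otimes>\<^sub>a ?J) = ?m \<cdot> ((?m \<cdot> (k \<otimes>\<^sub>a k)) \<otimes>\<^sub>a k)"
        by (simp add: compo_eq_assoc[OF km] tarr_exchange km)
      also have "\<dots> = (?m \<cdot> (?m \<otimes>\<^sub>a ?I)) \<cdot> (k \<otimes>\<^sub>a k \<otimes>\<^sub>a k)"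
        using tarr_exchange[of "k \<otimes>\<^sub>a k" ?m k ?I] by simp
      also have "\<dots> = ?m \<cdot> (k \<otimes>\<^sub>a (?m \<cdot> (k \<otimes>\<^sub>a k)))"
        unfolding ass by (simp add: tarr_exchange)
      also have "\<dots> = k \<cdot> mA \<cdot> (?J \<otimes>\<^sub>a mA)"
        by (simp add: compo_eq_assoc[OF km] tarr_exchange km)
      finally show "k \<cdot> mA \<cdot> (mA \<otimes>\<^sub>a ?J) = k \<cdot> mA \<cdot> (?J \<otimes>\<^sub>a mA)" .
    qed simp_all
    show "mA \<cdot> (eA \<otimes>\<^sub>a ?J) = ?J"
    proof (rule mono)
      have "k \<cdot> mA \<cdot> (eA \<otimes>\<^sub>a ?J) = ?m \<cdot> (funit X \<otimes>\<^sub>a k)"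
        by (simp add: compo_eq_assoc[OF km] tarr_exchange ke)
      also have "\<dots> = k"
        using from_unit_left[of "funit X" ?x k a ?x] compo_eq_assoc[OF Xs(11), of k]
        by (simp add: in_hom_iff)
      finally show "k \<cdot> mA \<cdot> (eA \<otimes>\<^sub>a ?J) = k \<cdot> ?J" by simp
    qed simp_all
    show "mA \<cdot> (?J \<otimes>\<^sub>a eA) = ?J"
    proof (rule mono)
      have "k \<cdot> mA \<cdot> (?J \<otimes>\<^sub>a eA) = ?m \<cdot> (k \<otimes>\<^sub>a funit X)"
        by (simp add: compo_eq_assoc[OF km] tarr_exchange ke)
      also have "\<dots> = k"
        using from_unit_right[of "funit X" ?x k a ?x] compo_eq_assoc[OF Xs(12), of k]
        by (simp add: in_hom_iff)
      finally show "k \<cdot> mA \<cdot> (?J \<otimes>\<^sub>a eA) = k \<cdot> ?J" by simp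
    qed simp_all
  qed (simp_all add: in_hom_iff)
  moreover have evA: "(fcounit X \<cdot> k) \<cdot> mA = ev \<cdot> (k \<otimes>\<^sub>a k)"
    by (simp add: km ev_def)
  have "(?J \<otimes>\<^sub>a ((fcounit X \<cdot> k) \<cdot> mA)) \<cdot> (cA \<otimes>\<^sub>a ?J) = ?J"
  proof -
    have "(?J \<otimes>\<^sub>a (ev \<cdot> (k \<otimes>\<^sub>a k))) \<cdot> (cA \<otimes>\<^sub>a ?J) = (?J \<otimes>\<^sub>a ev) \<cdot> (((?J \<otimes>\<^sub>a k) \<otimes>\<^sub>a k) \<cdot> (cA \<otimes>\<^sub>a ?J))"
      by (simp add: whisker_left)
    also have "((?J \<otimes>\<^sub>a k) \<otimes>\<^sub>a k) \<cdot> (cA \<otimes>\<^sub>a ?J) = ((h \<otimes>\<^sub>a ?I) \<cdot> c) \<otimes>\<^sub>a (?I \<cdot> k)"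
      by (subst tarr_exchange) (simp_all add: cA_def tarr_exchange_assoc kh cq1)
    also have "\<dots> = (h \<otimes>\<^sub>a iden C (?x \<otimes>\<^sub>o ?x)) \<cdot> (c \<otimes>\<^sub>a k)"
      using tarr_exchange[of c "h \<otimes>\<^sub>a ?I" k ?I] by simp
    also have "c \<otimes>\<^sub>a k = (c \<otimes>\<^sub>a ?I) \<cdot> k"
      using from_unit_left[of c "?x \<otimes>\<^sub>o ?x" k a ?x] by (simp add: in_hom_iff)
    also have "(?J \<otimes>\<^sub>a ev) \<cdot> (h \<otimes>\<^sub>a iden C (?x \<otimes>\<^sub>o ?x)) \<cdot> (c \<otimes>\<^sub>a ?I) \<cdot> k
        = (h \<cdot> (?I \<otimes>\<^sub>a ev)) \<cdot> (c \<otimes>\<^sub>a ?I) \<cdot> k"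
      using tarr_left_first[of h ev a "?x \<otimes>\<^sub>o ?x"] to_unit_right[of ev "?x \<otimes>\<^sub>o ?x" h ?x a]
      by (subst compo_eq_assoc[of "?J \<otimes>\<^sub>a ev" _ "h \<otimes>\<^sub>a ev"]) (simp_all add: in_hom_iff)
    also have "\<dots> = ?J" by (simp add: compo_eq_assoc[OF zig1] hk)
    finally show ?thesis by (simp add: evA)
  qed
  moreover have "(((fcounit X \<cdot> k) \<cdot> mA) \<otimes>\<^sub>a ?J) \<cdot> (?J \<otimes>\<^sub>a cA) = ?J"
  proof -
    have "((ev \<cdot> (k \<otimes>\<^sub>a k)) \<otimes>\<^sub>a ?J) \<cdot> (?J \<otimes>\<^sub>a cA) = (ev \<otimes>\<^sub>a ?J) \<cdot> ((k \<otimes>\<^sub>a (k \<otimes>\<^sub>a ?J)) \<cdot> (?J \<otimes>\<^sub>a cA))"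
      by (simp add: whisker_right)
    also have "(k \<otimes>\<^sub>a (k \<otimes>\<^sub>a ?J)) \<cdot> (?J \<otimes>\<^sub>a cA) = (?I \<cdot> k) \<otimes>\<^sub>a ((?I \<otimes>\<^sub>a h) \<cdot> c)"
      by (subst tarr_exchange) (simp_all add: cA_def tarr_exchange_assoc kh cq2)
    also have "\<dots> = (iden C (?x \<otimes>\<^sub>o ?x) \<otimes>\<^sub>a h) \<cdot> (k \<otimes>\<^sub>a c)"
      using tarr_exchange[of k ?I c "?I \<otimes>\<^sub>a h"] by simp
    also have "k \<otimes>\<^sub>a c = (?I \<otimes>\<^sub>a c) \<cdot> k"
      using from_unit_right[of c "?x \<otimes>\<^sub>o ?x" k a ?x] by (simp add: in_hom_iff)
    also have "(ev \<otimes>\<^sub>a ?J) \<cdot> (iden C (?x \<otimes>\<^sub>o ?x) \<otimes>\<^sub>a h) \<cdot> (?I \<otimes>\<^sub>a c) \<cdot> k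
        = (h \<cdot> (ev \<otimes>\<^sub>a ?I)) \<cdot> (?I \<otimes>\<^sub>a c) \<cdot> k"
      using tarr_right_first[of ev h "?x \<otimes>\<^sub>o ?x" a] to_unit_left[of ev "?x \<otimes>\<^sub>o ?x" h ?x a]
      by (subst compo_eq_assoc[of "ev \<otimes>\<^sub>a ?J" _ "ev \<otimes>\<^sub>a h"]) (simp_all add: in_hom_iff)
    also have "\<dots> = ?J" by (simp add: compo_eq_assoc[OF zig2] hk)
    finally show ?thesis by (simp add: evA)
  qed
  ultimately obtain K where K: "fobj K = a" "fmul K = mA" "funit K = eA" "frobenius_algebra C K"
    and D: "frob_dual C K = \<lparr>dobj = a, dev = (fcounit X \<cdot> k) \<cdot> mA, dcoev = cA\<rparr>"
    using frobenius_of_copairing[of a mA eA "fcounit X \<cdot> k" cA] by (auto simp: in_hom_iff)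
  note LK = frob_left_dual[OF K(4)]
  have cs: "dcoev (frob_dual C X) = c" by (simp add: c_def)
  have d1: "frob_dual_arr C K X k = h"
    unfolding frob_dual_arr_def
    using k h by (intro dual_arr_unique[OF LK LD])
      (simp_all add: K D cs frobenius_simps[OF X] tarr_exchange_assoc kh cq2 cA_def)
  have d2: "frob_dual_arr C X K h = k"
    unfolding frob_dual_arr_def
    using k h by (intro dual_arr_unique[OF LD LK])
      (simp_all add: K D cs frobenius_simps[OF X] tarr_exchange_assoc kh cq1 cA_def)
  have "frobenius_subalgebra C X (K, k)"
    using split_mono[OF k h hk] k by (simp add: frobenius_subalgebra_def K km ke d1 d2 hk)
  with K d1 show ?thesis by blast
qed

text \<open>Both sides of the symmetry equation equal \<open>(i \<otimes> i) \<cdot> coev\<close> of \<open>A\<close>; this uses \<open>i\<^sup>*\<^sup>* = i\<close>.\<close>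
lemma idem_of_subalgebra:
  assumes X: "frobenius_algebra C X" and "frobenius_subalgebra C X (A, i)"
  shows "subalgebra_idem X (sub_idem C X (A, i))"
proof -
  let ?x = "fobj X" and ?a = "fobj A" and ?m = "fmul X" and ?I = "iden C (fobj X)"
  define p where "p = frob_dual_arr C A X i"
  have A: "frobenius_algebra C A" and ih: "i \<in> homset C ?a ?x"
    and im: "i \<cdot> fmul A = ?m \<cdot> (i \<otimes>\<^sub>a i)" and ie: "i \<cdot> funit A = funit X"
    and dd: "frob_dual_arr C X A p = i" and pi: "p \<cdot> i = iden C ?a"
    using assms(2) by (auto simp: frobenius_subalgebra_def p_def)
  note LX = frob_left_dual[OF X] and LA = frob_left_dual[OF A]
  have ph: "p \<in> homset C ?x ?a"
    using dual_arr_hom[OF LA LX ih] by (simp add: p_def frob_dual_arr_def frobenius_simps[OF A] frobenius_simps[OF X])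
  note Xs [simp] = frobenius_simps(1-10)[OF X] frobenius_simps(1-10)[OF A]
  have [simp]: "i \<in> arrs C" "src C i = ?a" "tgt C i = ?x" "p \<in> arrs C" "src C p = ?x" "tgt C p = ?a"
    using ih ph by (auto simp: in_hom_iff)
  define c where "c = dcoev (frob_dual C X)"
  define cA where "cA = dcoev (frob_dual C A)"
  have [simp]: "c \<in> arrs C" "src C c = tunit C" "tgt C c = ?x \<otimes>\<^sub>o ?x"
     "cA \<in> arrs C" "src C cA = tunit C" "tgt C cA = ?a \<otimes>\<^sub>o ?a"
    using left_dual_simps[OF LX] left_dual_simps[OF LA]
    by (simp_all add: c_def cA_def frobenius_simps[OF X] frobenius_simps[OF A])
  define q where "q = i \<cdot> p"
  have [simp]: "q \<in> arrs C" "src C q = ?x" "tgt C q = ?x" by (simp_all add: q_def)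
  have ci: "(?I \<otimes>\<^sub>a p) \<cdot> c = (i \<otimes>\<^sub>a iden C ?a) \<cdot> cA"
    using dual_arr_coev[OF LA LX ih]
    by (simp add: p_def frob_dual_arr_def c_def cA_def frobenius_simps[OF A])
  have cp: "(iden C ?a \<otimes>\<^sub>a i) \<cdot> cA = (p \<otimes>\<^sub>a ?I) \<cdot> c"
    using dual_arr_coev[OF LX LA ph] dd
    by (simp add: frob_dual_arr_def c_def cA_def frobenius_simps[OF X])
  have "(q \<otimes>\<^sub>a ?I) \<cdot> c = (i \<otimes>\<^sub>a ?I) \<cdot> (p \<otimes>\<^sub>a ?I) \<cdot> c"
    by (simp add: q_def tarr_exchange_assoc)
  also have "\<dots> = (i \<otimes>\<^sub>a i) \<cdot> cA" by (simp add: cp[symmetric] tarr_exchange_assoc)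
  also have "\<dots> = (?I \<otimes>\<^sub>a i) \<cdot> (?I \<otimes>\<^sub>a p) \<cdot> c" by (simp add: ci tarr_exchange_assoc)
  also have "\<dots> = (?I \<otimes>\<^sub>a q) \<cdot> c" by (simp add: q_def tarr_exchange_assoc)
  finally have sym: "(q \<otimes>\<^sub>a ?I) \<cdot> c = (?I \<otimes>\<^sub>a q) \<cdot> c" .
  have qi: "q \<cdot> i = i" by (simp add: q_def pi)
  have "q \<cdot> q = (q \<cdot> i) \<cdot> p" by (simp add: q_def)
  then have qq: "q \<cdot> q = q" unfolding qi by (simp add: q_def)
  have qe: "q \<cdot> funit X = funit X" by (simp add: ie[symmetric] compo_eq_assoc[OF qi])
  have "?m \<cdot> (q \<otimes>\<^sub>a q) = (?m \<cdot> (i \<otimes>\<^sub>a i)) \<cdot> (p \<otimes>\<^sub>a p)" by (simp add: q_def tarr_exchange)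
  also have "\<dots> = i \<cdot> fmul A \<cdot> (p \<otimes>\<^sub>a p)" unfolding im[symmetric] by simp
  finally have "q \<cdot> ?m \<cdot> (q \<otimes>\<^sub>a q) = ?m \<cdot> (q \<otimes>\<^sub>a q)" by (simp add: compo_eq_assoc[OF qi])
  then have "subalgebra_idem X q"
    using qq qe sym by (simp add: subalgebra_idem_def in_hom_iff c_def)
  then show ?thesis by (simp add: sub_idem_def q_def p_def)
qed

end

section \<open>Finite-dimensional complex spaces with an orthonormal basis\<close>

locale complex_module = module complex_ring V for V :: "(complex, 'v) module" (structure)
begin

lemma scale_closed [simp]: "v \<in> carrier V \<Longrightarrow> c \<odot> v \<in> carrier V"
  using smult_closed[of c v] by (simp add: complex_ring_def)

lemma scale_add_left: "v \<in> carrier V \<Longrightarrow> (c + d) \<odot> v = c \<odot> v \<oplus> d \<odot> v"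
  using smult_l_distr[of c d v] by (simp add: complex_ring_def)

lemma scale_add_right:
  "\<lbrakk>v \<in> carrier V; w \<in> carrier V\<rbrakk> \<Longrightarrow> c \<odot> (v \<oplus> w) = c \<odot> v \<oplus> c \<odot> w"
  using smult_r_distr[of c v w] by (simp add: complex_ring_def)

lemma scale_scale: "v \<in> carrier V \<Longrightarrow> c \<odot> (d \<odot> v) = (c * d) \<odot> v"
  using smult_assoc1[of c d v] by (simp add: complex_ring_def)

lemma scale_one [simp]: "v \<in> carrier V \<Longrightarrow> 1 \<odot> v = v"
  using smult_one[of v] by (simp add: complex_ring_def)

lemma scale_zero [simp]: "v \<in> carrier V \<Longrightarrow> 0 \<odot> v = \<zero>"
  using smult_l_null[of v] by (simp add: complex_ring_def)

lemma scale_zero_vec [simp]: "c \<odot> \<zero> = \<zero>"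
  using smult_r_null[of c] by (simp add: complex_ring_def)

lemma add_minus_scale: "v \<in> carrier V \<Longrightarrow> v \<oplus> (-1) \<odot> v = \<zero>"
  using scale_add_left[of v 1 "-1"] by simp

lemma diff_eq_zero:
  assumes "v \<in> carrier V" "w \<in> carrier V" "v \<oplus> (-1) \<odot> w = \<zero>"
  shows "v = w"
proof -
  have "w \<oplus> (v \<oplus> (-1) \<odot> w) = v \<oplus> (w \<oplus> (-1) \<odot> w)" using assms(1,2) by (simp add: a_lcomm)
  then show ?thesis using assms by (simp add: add_minus_scale)
qed

lemma add_swap:
  "\<lbrakk>p \<in> carrier V; q \<in> carrier V; r \<in> carrier V; t \<in> carrier V\<rbrakk>
    \<Longrightarrow> (p \<oplus> q) \<oplus> (r \<oplus> t) = (p \<oplus> r) \<oplus> (q \<oplus> t)"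
  by (simp add: a_assoc a_lcomm)

inductive_set cspan :: "'v set \<Rightarrow> 'v set" for A where
  zero: "\<zero> \<in> cspan A"
| add_scale: "\<lbrakk>a \<in> A; v \<in> cspan A\<rbrakk> \<Longrightarrow> c \<odot> a \<oplus> v \<in> cspan A"

lemma cspan_carrier:
  assumes "A \<subseteq> carrier V" "v \<in> cspan A"
  shows "v \<in> carrier V"
  using assms(2) by induction (use assms(1) in auto)

lemma cspan_add:
  assumes A: "A \<subseteq> carrier V" and "v \<in> cspan A" and w: "w \<in> cspan A"
  shows "v \<oplus> w \<in> cspan A"
  using assms(2)
proof induction
  case zero
  then show ?case using w cspan_carrier[OF A w] by simp
next
  case (add_scale a v c)
  then have "c \<odot> a \<oplus> v \<oplus> w = c \<odot> a \<oplus> (v \<oplus> w)"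
    using A cspan_carrier[OF A] w by (intro a_assoc) auto
  then show ?case using add_scale cspan.add_scale by simp
qed

lemma cspan_scale:
  assumes A: "A \<subseteq> carrier V" and "v \<in> cspan A"
  shows "d \<odot> v \<in> cspan A"
  using assms(2)
proof induction
  case zero
  then show ?case by (simp add: cspan.zero)
next
  case (add_scale a v c)
  then have "d \<odot> (c \<odot> a \<oplus> v) = (d * c) \<odot> a \<oplus> d \<odot> v"
    using A cspan_carrier[OF A] by (auto simp: scale_add_right scale_scale)
  then show ?case using add_scale cspan.add_scale by simp
qed

lemma cspan_base: "A \<subseteq> carrier V \<Longrightarrow> a \<in> A \<Longrightarrow> a \<in> cspan A"
  using cspan.add_scale[OF _ cspan.zero, of a A 1] by auto

lemma cspan_subset:
  assumes A: "A \<subseteq> carrier V" and B: "B \<subseteq> cspan A"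
  shows "cspan B \<subseteq> cspan A"
proof
  fix v assume "v \<in> cspan B"
  then show "v \<in> cspan A"
    by induction (use A B in \<open>auto intro!: cspan.zero cspan_add cspan_scale\<close>)
qed

lemma cspan_mono: "\<lbrakk>A \<subseteq> carrier V; B \<subseteq> A\<rbrakk> \<Longrightarrow> cspan B \<subseteq> cspan A"
  by (rule cspan_subset) (auto intro: cspan_base)

lemma cspan_insert:
  assumes A: "A \<subseteq> carrier V" and v: "v \<in> carrier V" and "u \<in> cspan (insert v A)"
  shows "\<exists>c w. w \<in> cspan A \<and> u = c \<odot> v \<oplus> w"
  using assms(3)
proof induction
  case zero
  show ?case using v by (intro exI[of _ 0] exI[of _ \<zero>]) (simp add: cspan.zero)
next
  case (add_scale a u d)
  then obtain c w where w: "w \<in> cspan A" "u = c \<odot> v \<oplus> w" by blast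
  note wc = cspan_carrier[OF A w(1)]
  show ?case
  proof (cases "a = v")
    case True
    then have "d \<odot> a \<oplus> u = (d + c) \<odot> v \<oplus> w" using v wc w by (simp add: scale_add_left a_assoc)
    then show ?thesis using w by blast
  next
    case False
    then have a: "a \<in> A" using add_scale by simp
    then have "d \<odot> a \<oplus> u = c \<odot> v \<oplus> (d \<odot> a \<oplus> w)" using v wc w A by (auto simp: a_lcomm)
    moreover have "d \<odot> a \<oplus> w \<in> cspan A" using a w by (simp add: cspan.add_scale)
    ultimately show ?thesis by blast
  qed
qed

lemma cspan_empty: "v \<in> cspan {} \<Longrightarrow> v = \<zero>"
  by (induction rule: cspan.induct) auto

definition fin_dim :: bool where
  "fin_dim \<longleftrightarrow> (\<exists>F. finite F \<and> F \<subseteq> carrier V \<and> carrier V \<subseteq> cspan F)"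

text \<open>Finite dimensionality in the form in which it is used below: in every sequence some term depends
  linearly on later terms. In the induction step the coefficient at the new generator is eliminated
  from each term with the help of a later term in which it does not vanish, if there are such terms
  arbitrarily late; otherwise a tail of the sequence lies in the smaller span.\<close>
lemma finite_span_sequence:
  assumes "finite F" "F \<subseteq> carrier V" "\<And>n::nat. a n \<in> cspan F"
  shows "\<exists>j. a j \<in> cspan (a ` {j<..})"
  using assms
proof (induction F arbitrary: a rule: finite_induct)
  case empty
  then have "a 0 = \<zero>" using cspan_empty by blast
  then show ?case using cspan.zero by metis
next
  case (insert v F)
  have F: "F \<subseteq> carrier V" and v: "v \<in> carrier V" using insert.prems by auto
  have ac: "a n \<in> carrier V" for n using insert.prems cspan_carrier by blast
  have "\<forall>n. \<exists>c w. w \<in> cspan F \<and> a n = c \<odot> v \<oplus> w"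
    using cspan_insert[OF F v] insert.prems(2) by blast
  then obtain c w where w: "\<And>n. w n \<in> cspan F" and aw: "\<And>n. a n = c n \<odot> v \<oplus> w n" by metis
  have wc: "w n \<in> carrier V" for n using cspan_carrier[OF F w] .
  show ?case
  proof (cases "\<exists>m. \<forall>k\<ge>m. c k = 0")
    case True
    then obtain m where m: "\<And>k. k \<ge> m \<Longrightarrow> c k = 0" by blast
    have "a (m + n) \<in> cspan F" for n using aw[of "m + n"] w[of "m + n"] m[of "m + n"] v wc by simp
    then obtain j where j: "a (m + j) \<in> cspan ((\<lambda>n. a (m + n)) ` {j<..})"
      using insert.IH[OF F, of "\<lambda>n. a (m + n)"] by blast
    have "(\<lambda>n. a (m + n)) ` {j<..} \<subseteq> a ` {m + j<..}" by auto
    then have "a (m + j) \<in> cspan (a ` {m + j<..})"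
      using j cspan_mono[of "a ` {m + j<..}"] ac by blast
    then show ?thesis by blast
  next
    case False
    then have "\<forall>n. \<exists>k>n. c k \<noteq> 0" by (metis Suc_le_lessD)
    then obtain s where s: "\<And>n. s n > n" "\<And>n. c (s n) \<noteq> 0" by metis
    \<comment> \<open>The coefficient of \<open>v\<close> cancels, so the IH applies to \<open>b\<close>.\<close>
    define b where "b n = a n \<oplus> (- (c n / c (s n))) \<odot> a (s n)" for n
    have "b n \<in> cspan F" for n
    proof -
      let ?d = "- (c n / c (s n))"
      have "b n = (c n \<odot> v \<oplus> w n) \<oplus> ((?d * c (s n)) \<odot> v \<oplus> ?d \<odot> w (s n))"
        using v wc by (simp add: b_def aw[of n] aw[of "s n"] scale_add_right scale_scale)
      also have "\<dots> = (c n + ?d * c (s n)) \<odot> v \<oplus> (w n \<oplus> ?d \<odot> w (s n))"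
        using v wc by (simp only: scale_add_left add_swap scale_closed)
      also have "\<dots> = w n \<oplus> ?d \<odot> w (s n)" using v wc s by simp
      finally show ?thesis using w F by (auto intro: cspan_add cspan_scale)
    qed
    then obtain j where j: "b j \<in> cspan (b ` {j<..})"
      using insert.IH[OF F, of b] by blast
    let ?A = "a ` {j<..}"
    have A: "?A \<subseteq> carrier V" using ac by auto
    have as: "a k \<in> cspan ?A" if "k > j" for k using that cspan_base[OF A] by blast
    have "s k > j" if "k > j" for k using less_trans[OF that s(1)] .
    then have "b ` {j<..} \<subseteq> cspan ?A"
      using as by (auto simp: b_def intro!: cspan_add[OF A] cspan_scale[OF A])
    then have "b j \<in> cspan ?A" using j cspan_subset[OF A] by blast
    then have "b j \<oplus> (c j / c (s j)) \<odot> a (s j) \<in> cspan ?A"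
      using as s(1) by (auto intro!: cspan_add[OF A] cspan_scale[OF A])
    moreover have "b j \<oplus> (c j / c (s j)) \<odot> a (s j) = a j"
      using ac scale_add_left[of "a (s j)" "- (c j / c (s j))" "c j / c (s j)"]
      by (simp add: b_def a_assoc)
    ultimately show ?thesis by auto
  qed
qed

lemma fin_dim_sequence:
  assumes "fin_dim" "\<And>n::nat. a n \<in> carrier V"
  shows "\<exists>j. a j \<in> cspan (a ` {j<..})"
proof -
  obtain F where F: "finite F" "F \<subseteq> carrier V" "carrier V \<subseteq> cspan F"
    using assms(1) unfolding fin_dim_def by blast
  show ?thesis using F(3) assms(2) by (intro finite_span_sequence[OF F(1,2)]) blast
qed

lemma cspan_combination:
  assumes "S \<subseteq> carrier V" "v \<in> cspan S"
  shows "\<exists>c. finite {b. c b \<noteq> 0} \<and> {b. c b \<noteq> 0} \<subseteq> S \<and>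
    v = finsum V (\<lambda>b. c b \<odot> b) {b. c b \<noteq> 0}"
  using assms(2)
proof induction
  case zero
  show ?case by (intro exI[of _ "\<lambda>_. 0"]) simp
next
  case (add_scale a v d)
  then obtain c where fin: "finite {b. c b \<noteq> 0}" and sub: "{b. c b \<noteq> 0} \<subseteq> S"
    and v: "v = finsum V (\<lambda>b. c b \<odot> b) {b. c b \<noteq> 0}" by blast
  let ?c = "c(a := c a + d)" and ?T = "{b. c b \<noteq> 0} - {a}"
  have T: "finite ?T" "?T \<subseteq> carrier V" "a \<notin> ?T" "a \<in> carrier V"
    using fin sub assms(1) add_scale.hyps by auto
  have ext: "finsum V (\<lambda>b. f b \<odot> b) {b. f b \<noteq> 0} = finsum V (\<lambda>b. f b \<odot> b) (insert a ?T)"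
    if "{b. f b \<noteq> 0} \<subseteq> insert a ?T" for f
    using T that by (intro add.finprod_mono_neutral_cong_left) auto
  have "finsum V (\<lambda>b. ?c b \<odot> b) {b. ?c b \<noteq> 0} = finsum V (\<lambda>b. ?c b \<odot> b) (insert a ?T)"
    by (rule ext) auto
  also have "\<dots> = (c a + d) \<odot> a \<oplus> finsum V (\<lambda>b. ?c b \<odot> b) ?T"
    using T by (subst finsum_insert) (auto simp del: fun_upd_apply, simp)
  also have "finsum V (\<lambda>b. ?c b \<odot> b) ?T = finsum V (\<lambda>b. c b \<odot> b) ?T"
    using T by (intro finsum_cong') auto
  also have "(c a + d) \<odot> a \<oplus> \<dots> = d \<odot> a \<oplus> (c a \<odot> a \<oplus> \<dots>)"
  proof -
    have "finsum V (\<lambda>b. c b \<odot> b) ?T \<in> carrier V" using T by (intro finsum_closed) auto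
    then show ?thesis
      using T(4) scale_add_left[OF T(4), of d "c a"] by (simp add: add.commute[of "c a"] a_assoc)
  qed
  also have "c a \<odot> a \<oplus> finsum V (\<lambda>b. c b \<odot> b) ?T = finsum V (\<lambda>b. c b \<odot> b) (insert a ?T)"
    using T by (subst finsum_insert) auto
  also have "\<dots> = v" unfolding v by (rule ext[symmetric]) auto
  finally have "d \<odot> a \<oplus> v = finsum V (\<lambda>b. ?c b \<odot> b) {b. ?c b \<noteq> 0}" ..
  moreover have "finite {b. ?c b \<noteq> 0}" using T by (rule_tac finite_subset[of _ "insert a ?T"]) auto
  moreover have "{b. ?c b \<noteq> 0} \<subseteq> S" using sub add_scale.hyps by auto
  ultimately show ?case by blast
qed

end

locale fin_dim_basis = complex_module V for V :: "(complex, 'v) module" (structure) +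
  fixes Bs :: "'v set"
  assumes basis: "is_vs_basis V Bs" and fin_dim: "fin_dim"
begin

lemma basis_carrier: "Bs \<subseteq> carrier V"
  using basis by (simp add: is_vs_basis_def)

lemma finite_basis: "finite Bs"
proof (rule ccontr)
  assume "infinite Bs"
  then obtain b :: "nat \<Rightarrow> 'v" where b: "inj b" "range b \<subseteq> Bs"
    using infinite_countable_subset by blast
  then obtain j where j: "b j \<in> cspan (b ` {j<..})"
    using fin_dim_sequence[OF fin_dim, of b] basis_carrier by blast
  have "b ` {j<..} \<subseteq> carrier V" using b basis_carrier by blast
  from cspan_combination[OF this j] obtain c where
    c: "finite {x. c x \<noteq> 0}" "{x. c x \<noteq> 0} \<subseteq> b ` {j<..}"
      "b j = finsum V (\<lambda>x. c x \<odot> x) {x. c x \<noteq> 0}" by blast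
  have bj: "b j \<in> carrier V" "b j \<in> Bs" using b basis_carrier by auto
  let ?d = "\<lambda>x. if x = b j then 1 else 0 :: complex"
  let ?P = "\<lambda>c. finite {x. c x \<noteq> 0} \<and> {x. c x \<noteq> 0} \<subseteq> Bs \<and>
      b j = finsum V (\<lambda>x. c x \<odot> x) {x. c x \<noteq> 0}"
  have ex: "\<exists>!c. ?P c" using basis bj(1) by (simp add: is_vs_basis_def)
  have "?P ?d" using bj by simp
  moreover have "?P c" using c b by auto
  ultimately have "?d = c" by (rule trans[OF the1_equality[OF ex, symmetric] the1_equality[OF ex]])
  then have "b j \<in> {x. c x \<noteq> 0}" by (auto dest!: fun_cong[of _ _ "b j"])
  then show False using c(2) b(1) by (auto dest: injD)
qed

text \<open>Combinations are indexed by the whole finite basis, so that sums need not follow changing supports.\<close>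
definition comb :: "('v \<Rightarrow> complex) \<Rightarrow> 'v" where
  "comb c = finsum V (\<lambda>b. c b \<odot> b) Bs"

lemma comb_support: "{b. c b \<noteq> 0} \<subseteq> Bs \<Longrightarrow> finsum V (\<lambda>b. c b \<odot> b) {b. c b \<noteq> 0} = comb c"
  unfolding comb_def using finite_basis basis_carrier
  by (intro add.finprod_mono_neutral_cong_left) auto

lemma comb_carrier [simp]: "comb c \<in> carrier V"
  unfolding comb_def using basis_carrier by (intro finsum_closed) auto

lemma coords_props:
  assumes "v \<in> carrier V"
  shows "{b. coords V Bs v b \<noteq> 0} \<subseteq> Bs" "comb (coords V Bs v) = v"
proof -
  let ?P = "\<lambda>c. finite {b. c b \<noteq> 0} \<and> {b. c b \<noteq> 0} \<subseteq> Bs \<and>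
        v = finsum V (\<lambda>b. c b \<odot> b) {b. c b \<noteq> 0}"
  have "\<exists>!c. ?P c" using basis assms by (simp add: is_vs_basis_def)
  then have "?P (coords V Bs v)" unfolding coords_def by (rule theI')
  then show "{b. coords V Bs v b \<noteq> 0} \<subseteq> Bs" "comb (coords V Bs v) = v"
    using comb_support by auto
qed

lemma coords_outside: "v \<in> carrier V \<Longrightarrow> b \<notin> Bs \<Longrightarrow> coords V Bs v b = 0"
  using coords_props(1) by blast

lemma coords_unique:
  assumes "{b. c b \<noteq> 0} \<subseteq> Bs"
  shows "coords V Bs (comb c) = c"
proof -
  let ?P = "\<lambda>d. finite {b. d b \<noteq> 0} \<and> {b. d b \<noteq> 0} \<subseteq> Bs \<and>
        comb c = finsum V (\<lambda>b. d b \<odot> b) {b. d b \<noteq> 0}"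
  have "\<exists>!d. ?P d" using basis by (simp add: is_vs_basis_def)
  moreover have "?P c" using assms comb_support[OF assms] finite_subset[OF assms finite_basis] by simp
  ultimately show ?thesis unfolding coords_def by (rule the1_equality[of ?P])
qed

lemma comb_add: "comb c \<oplus> comb d = comb (\<lambda>b. c b + d b)"
proof -
  have "comb c \<oplus> comb d = finsum V (\<lambda>b. c b \<odot> b \<oplus> d b \<odot> b) Bs"
    unfolding comb_def using basis_carrier by (intro finsum_addf[symmetric]) auto
  also have "\<dots> = comb (\<lambda>b. c b + d b)"
    unfolding comb_def using basis_carrier by (intro finsum_cong') (auto simp: scale_add_left)
  finally show ?thesis .
qed

lemma comb_induct:
  assumes "P \<zero>" "\<And>b v. \<lbrakk>b \<in> Bs; v \<in> carrier V; P v\<rbrakk> \<Longrightarrow> P (c b \<odot> b \<oplus> v)"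
  shows "P (comb c)"
proof -
  have "finsum V (\<lambda>b. c b \<odot> b) F \<in> carrier V \<and> P (finsum V (\<lambda>b. c b \<odot> b) F)" if "finite F" "F \<subseteq> Bs" for F
    using that
  proof (induction F)
    case empty
    then show ?case using assms by simp
  next
    case (insert b F)
    then show ?case using basis_carrier assms(2) by (subst (1 2) finsum_insert) auto
  qed
  then show ?thesis unfolding comb_def using finite_basis by blast
qed

lemma scale_comb: "k \<odot> comb c = comb (\<lambda>b. k * c b)"
proof -
  have "k \<odot> finsum V (\<lambda>b. c b \<odot> b) F = finsum V (\<lambda>b. (k * c b) \<odot> b) F" if "finite F" "F \<subseteq> Bs" for F
    using that
  proof (induction F)
    case empty
    then show ?case by simp
  next
    case (insert b F)
    then have "finsum V (\<lambda>b. c b \<odot> b) F \<in> carrier V"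
      using basis_carrier by (intro finsum_closed) auto
    with insert show ?case using basis_carrier
      by (subst (1 2) finsum_insert) (auto simp: scale_add_right scale_scale)
  qed
  then show ?thesis unfolding comb_def using finite_basis by blast
qed

lemma coords_add:
  assumes "u \<in> carrier V" "v \<in> carrier V"
  shows "coords V Bs (u \<oplus> v) = (\<lambda>b. coords V Bs u b + coords V Bs v b)"
proof -
  let ?c = "\<lambda>b. coords V Bs u b + coords V Bs v b"
  have "u \<oplus> v = comb ?c" using coords_props(2)[OF assms(1)] coords_props(2)[OF assms(2)] comb_add by metis
  moreover have "{b. ?c b \<noteq> 0} \<subseteq> Bs" using coords_outside[OF assms(1)] coords_outside[OF assms(2)] by force
  ultimately show ?thesis using coords_unique by simp
qed

lemma coords_scale:
  assumes "u \<in> carrier V"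
  shows "coords V Bs (k \<odot> u) = (\<lambda>b. k * coords V Bs u b)"
proof -
  let ?c = "\<lambda>b. k * coords V Bs u b"
  have "k \<odot> u = comb ?c" using coords_props(2)[OF assms] scale_comb by metis
  moreover have "{b. ?c b \<noteq> 0} \<subseteq> Bs" using coords_props(1)[OF assms] by auto
  ultimately show ?thesis using coords_unique by simp
qed

lemma herm_sum:
  assumes "u \<in> carrier V"
  shows "herm V Bs u v = (\<Sum>b\<in>Bs. coords V Bs u b * cnj (coords V Bs v b))"
  unfolding herm_def using coords_props(1)[OF assms] finite_basis
  by (intro sum.mono_neutral_left) auto

lemma herm_add_left:
  "\<lbrakk>u \<in> carrier V; v \<in> carrier V\<rbrakk> \<Longrightarrow> herm V Bs (u \<oplus> v) w = herm V Bs u w + herm V Bs v w"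
  by (simp add: herm_sum coords_add sum.distrib algebra_simps)

lemma herm_scale_left:
  "u \<in> carrier V \<Longrightarrow> herm V Bs (k \<odot> u) w = k * herm V Bs u w"
  by (simp add: herm_sum coords_scale sum_distrib_left mult.assoc)

lemma herm_cnj:
  "\<lbrakk>u \<in> carrier V; v \<in> carrier V\<rbrakk> \<Longrightarrow> cnj (herm V Bs v u) = herm V Bs u v"
  by (simp add: herm_sum mult.commute)

lemma herm_add_right:
  "\<lbrakk>u \<in> carrier V; v \<in> carrier V; w \<in> carrier V\<rbrakk>
    \<Longrightarrow> herm V Bs u (v \<oplus> w) = herm V Bs u v + herm V Bs u w"
  by (simp add: herm_sum coords_add sum.distrib algebra_simps)

lemma herm_scale_right:
  "\<lbrakk>u \<in> carrier V; v \<in> carrier V\<rbrakk> \<Longrightarrow> herm V Bs u (k \<odot> v) = cnj k * herm V Bs u v"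
  by (simp add: herm_sum coords_scale sum_distrib_left mult_ac)

lemma herm_self:
  "u \<in> carrier V \<Longrightarrow> herm V Bs u u = complex_of_real (\<Sum>b\<in>Bs. (cmod (coords V Bs u b))\<^sup>2)"
  by (simp add: herm_sum flip: complex_norm_square)

lemma herm_nonneg: "u \<in> carrier V \<Longrightarrow> Re (herm V Bs u u) \<ge> 0"
  by (simp add: herm_self sum_nonneg)

lemma herm_zero_left [simp]: "herm V Bs \<zero> w = 0"
  using herm_scale_left[of \<zero> 0 w] by simp

lemma herm_definite:
  assumes u: "u \<in> carrier V" and z: "Re (herm V Bs u u) = 0"
  shows "u = \<zero>"
proof -
  have "(\<Sum>b\<in>Bs. (cmod (coords V Bs u b))\<^sup>2) = 0" using z by (simp add: herm_self[OF u])
  then have "\<forall>b\<in>Bs. coords V Bs u b = 0" using finite_basis by (simp add: sum_nonneg_eq_0_iff)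
  then have "coords V Bs u = (\<lambda>_. 0)" using coords_props(1)[OF u] by auto
  then have "u = comb (\<lambda>_. 0)" using coords_props(2)[OF u] by simp
  also have "\<dots> = 0 \<odot> comb (\<lambda>_. 0)" by (simp add: scale_comb)
  finally show ?thesis by simp
qed

lemma herm_eqI:
  assumes v: "v \<in> carrier V" and w: "w \<in> carrier V"
    and eq: "\<And>u. u \<in> carrier V \<Longrightarrow> herm V Bs u v = herm V Bs u w"
  shows "v = w"
proof -
  let ?d = "v \<oplus> (-1) \<odot> w"
  have "herm V Bs ?d ?d = herm V Bs ?d v - herm V Bs ?d w"
    using v w by (simp add: herm_add_right herm_scale_right)
  then have "?d = \<zero>" using eq[of ?d] v w by (intro herm_definite) simp_all
  then show ?thesis using diff_eq_zero v w by blast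
qed

text \<open>The representing vector has the coordinates \<open>cnj (L b)\<close>.\<close>
lemma riesz:
  assumes add: "\<And>u v. \<lbrakk>u \<in> carrier V; v \<in> carrier V\<rbrakk> \<Longrightarrow> L (u \<oplus> v) = L u + L v"
    and scale: "\<And>k u. u \<in> carrier V \<Longrightarrow> L (k \<odot> u) = k * L u"
  shows "\<exists>h\<in>carrier V. \<forall>u\<in>carrier V. herm V Bs u h = L u"
proof -
  define c where "c b = (if b \<in> Bs then cnj (L b) else 0)" for b
  let ?h = "comb c"
  have ch: "coords V Bs ?h = c" by (rule coords_unique) (auto simp: c_def)
  have sup: "coords V Bs b = (\<lambda>x. if x = b then 1 else 0)" if "b \<in> Bs" for b
  proof -
    let ?d = "\<lambda>x. if x = b then 1 else 0 :: complex"
    have "{x. ?d x \<noteq> 0} = {b}" by auto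
    then have "comb ?d = b" using that basis_carrier comb_support[of ?d] by auto
    then show ?thesis using coords_unique[of ?d] that by auto
  qed
  have hb: "herm V Bs b ?h = L b" if "b \<in> Bs" for b
  proof -
    have "herm V Bs b ?h = (\<Sum>x\<in>Bs. if x = b then cnj (c b) else 0)"
      using that basis_carrier by (subst herm_sum) (auto simp: sup ch intro!: sum.cong)
    then show ?thesis using that finite_basis by (simp add: c_def)
  qed
  have L0: "L \<zero> = 0" using scale[of \<zero> 0] by simp
  have "herm V Bs (comb d) ?h = L (comb d)" for d
    by (rule comb_induct) (use basis_carrier in \<open>auto simp: L0 herm_add_left herm_scale_left add scale hb\<close>)
  then have "herm V Bs u ?h = L u" if "u \<in> carrier V" for u using coords_props(2)[OF that] by metis
  then show ?thesis by (intro bexI[of _ ?h]) auto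
qed

end

section \<open>Linear categories and direct sums\<close>

lemma hom_space_simps [simp]:
  "carrier (hom_space C x y) = homset C x y" "zero (hom_space C x y) = hzero C x y"
  "add (hom_space C x y) f g = hadd C f g" "smult (hom_space C x y) c f = hscale C c f"
  by (simp_all add: hom_space_def)

context linear_category
begin

lemma complex_module_hom: "\<lbrakk>x \<in> obs C; y \<in> obs C\<rbrakk> \<Longrightarrow> complex_module (hom_space C x y)"
  using hom_module by (simp add: complex_module_def)

lemma hom_obs: "f \<in> homset C x y \<Longrightarrow> x \<in> obs C \<and> y \<in> obs C"
  using src_closed[of f] tgt_closed[of f] by (auto simp: in_hom_iff)

lemma hadd_hom: "\<lbrakk>f \<in> homset C x y; g \<in> homset C x y\<rbrakk> \<Longrightarrow> hadd C f g \<in> homset C x y"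
proof -
  assume h: "f \<in> homset C x y" "g \<in> homset C x y"
  interpret complex_module "hom_space C x y" using hom_obs[OF h(1)] complex_module_hom by blast
  show ?thesis using a_closed[of f g] h by simp
qed

lemma hscale_hom: "f \<in> homset C x y \<Longrightarrow> hscale C c f \<in> homset C x y"
proof -
  assume h: "f \<in> homset C x y"
  interpret complex_module "hom_space C x y" using hom_obs[OF h(1)] complex_module_hom by blast
  show ?thesis using scale_closed[of f c] h by simp
qed

lemma hzero_hom: "\<lbrakk>x \<in> obs C; y \<in> obs C\<rbrakk> \<Longrightarrow> hzero C x y \<in> homset C x y"
proof -
  assume h: "x \<in> obs C" "y \<in> obs C"
  interpret complex_module "hom_space C x y" using h complex_module_hom by blast
  show ?thesis using zero_closed by simp
qed

lemma hadd_simps [simp]: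
  assumes "f \<in> arrs C" "g \<in> arrs C" "src C g = src C f" "tgt C g = tgt C f"
  shows "hadd C f g \<in> arrs C" "src C (hadd C f g) = src C f" "tgt C (hadd C f g) = tgt C f"
  using hadd_hom[of f "src C f" "tgt C f" g] assms by (auto simp: in_hom_iff)

lemma hscale_simps [simp]:
  assumes "f \<in> arrs C"
  shows "hscale C c f \<in> arrs C" "src C (hscale C c f) = src C f" "tgt C (hscale C c f) = tgt C f"
  using hscale_hom[of f "src C f" "tgt C f" c] assms by (auto simp: in_hom_iff)

lemma hzero_simps [simp]:
  assumes "x \<in> obs C" "y \<in> obs C"
  shows "hzero C x y \<in> arrs C" "src C (hzero C x y) = x" "tgt C (hzero C x y) = y"
  using hzero_hom[OF assms] by (auto simp: in_hom_iff)

lemma hscale_zero: "f \<in> homset C x y \<Longrightarrow> hscale C 0 f = hzero C x y"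
proof -
  assume h: "f \<in> homset C x y"
  interpret complex_module "hom_space C x y" using hom_obs[OF h(1)] complex_module_hom by blast
  show ?thesis using scale_zero[of f] h by simp
qed

lemma hscale_one: "f \<in> arrs C \<Longrightarrow> hscale C 1 f = f"
proof -
  assume h: "f \<in> arrs C"
  interpret complex_module "hom_space C (src C f) (tgt C f)" using complex_module_hom h by simp
  show ?thesis using scale_one[of f] h by (simp add: in_hom_iff)
qed

lemma hscale_hscale: "f \<in> arrs C \<Longrightarrow> hscale C c (hscale C d f) = hscale C (c * d) f"
proof -
  assume h: "f \<in> arrs C"
  interpret complex_module "hom_space C (src C f) (tgt C f)" using complex_module_hom h by simp
  show ?thesis using scale_scale[of f c d] h by (simp add: in_hom_iff)
qed

lemma hscale_add: "f \<in> arrs C \<Longrightarrow> hscale C (c + d) f = hadd C (hscale C c f) (hscale C d f)"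
proof -
  assume h: "f \<in> arrs C"
  interpret complex_module "hom_space C (src C f) (tgt C f)" using complex_module_hom h by simp
  show ?thesis using scale_add_left[of f c d] h by (simp add: in_hom_iff)
qed

lemma hadd_zero: "f \<in> homset C x y \<Longrightarrow> hadd C f (hzero C x y) = f"
proof -
  assume h: "f \<in> homset C x y"
  interpret complex_module "hom_space C x y" using hom_obs[OF h(1)] complex_module_hom by blast
  show ?thesis using r_zero[of f] h by simp
qed

lemma hdiff_self: "f \<in> homset C x y \<Longrightarrow> hadd C f (hscale C (-1) f) = hzero C x y"
proof -
  assume h: "f \<in> homset C x y"
  interpret complex_module "hom_space C x y" using hom_obs[OF h(1)] complex_module_hom by blast
  show ?thesis using add_minus_scale[of f] h by simp
qed

lemma hdiff_eq_zero:
  "\<lbrakk>f \<in> homset C x y; g \<in> homset C x y; hadd C f (hscale C (-1) g) = hzero C x y\<rbrakk> \<Longrightarrow> f = g"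
proof -
  assume h: "f \<in> homset C x y" "g \<in> homset C x y" "hadd C f (hscale C (-1) g) = hzero C x y"
  interpret complex_module "hom_space C x y" using hom_obs[OF h(1)] complex_module_hom by blast
  show ?thesis using diff_eq_zero[of f g] h by simp
qed

lemma compo_hadd_left:
  "\<lbrakk>f \<in> arrs C; g \<in> arrs C; h \<in> arrs C; src C h = src C g; tgt C h = tgt C g; src C g = tgt C f\<rbrakk>
    \<Longrightarrow> hadd C g h \<cdot> f = hadd C (g \<cdot> f) (h \<cdot> f)"
  by (rule compo_add_left) (auto simp: in_hom_iff)

lemma compo_hadd_right:
  "\<lbrakk>f \<in> arrs C; g \<in> arrs C; h \<in> arrs C; src C h = src C g; tgt C h = tgt C g; src C f = tgt C g\<rbrakk>
    \<Longrightarrow> f \<cdot> hadd C g h = hadd C (f \<cdot> g) (f \<cdot> h)"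
  by (rule compo_add_right) (auto simp: in_hom_iff)

lemma compo_hscale_left:
  "\<lbrakk>f \<in> arrs C; g \<in> arrs C; src C g = tgt C f\<rbrakk> \<Longrightarrow> hscale C c g \<cdot> f = hscale C c (g \<cdot> f)"
  by (rule compo_scale_left) (auto simp: in_hom_iff)

lemma compo_hscale_right:
  "\<lbrakk>f \<in> arrs C; g \<in> arrs C; src C g = tgt C f\<rbrakk> \<Longrightarrow> g \<cdot> hscale C c f = hscale C c (g \<cdot> f)"
  by (rule compo_scale_right) (auto simp: in_hom_iff)

lemmas compo_linear = compo_hadd_left compo_hadd_right compo_hscale_left compo_hscale_right

lemma compo_hzero_right: "\<lbrakk>g \<in> homset C y z; x \<in> obs C\<rbrakk> \<Longrightarrow> g \<cdot> hzero C x y = hzero C x z"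
proof -
  assume h: "g \<in> homset C y z" "x \<in> obs C"
  have z: "hzero C x y \<in> homset C x y" using h hom_obs hzero_hom by blast
  have "g \<cdot> hscale C 0 (hzero C x y) = hscale C 0 (g \<cdot> hzero C x y)"
    using h z by (simp add: compo_scale_right)
  then show ?thesis using hscale_zero[OF z] hscale_zero[OF compo_closed[OF z h(1)]] by simp
qed

lemma compo_hzero_left: "\<lbrakk>f \<in> homset C x y; z \<in> obs C\<rbrakk> \<Longrightarrow> hzero C y z \<cdot> f = hzero C x z"
proof -
  assume h: "f \<in> homset C x y" "z \<in> obs C"
  have z: "hzero C y z \<in> homset C y z" using h hom_obs hzero_hom by blast
  have "hscale C 0 (hzero C y z) \<cdot> f = hscale C 0 (hzero C y z \<cdot> f)"
    using h z by (simp add: compo_scale_left)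
  then show ?thesis using hscale_zero[OF z] hscale_zero[OF compo_closed[OF h(1) z]] by simp
qed

lemma hscale_cancel:
  assumes f: "f \<in> homset C x y" "f \<noteq> hzero C x y" and eq: "hscale C c f = hscale C d f"
  shows "c = d"
proof (rule ccontr)
  assume ne: "c \<noteq> d"
  have fa: "f \<in> arrs C" using f by (simp add: in_hom_iff)
  have "hscale C (c - d) f = hadd C (hscale C c f) (hscale C (-1) (hscale C d f))"
    using hscale_add[OF fa, of c "- d"] fa by (simp add: hscale_hscale)
  also have "\<dots> = hzero C x y" unfolding eq by (rule hdiff_self[OF hscale_hom[OF f(1)]])
  finally have z: "hscale C (c - d) f = hzero C x y" .
  have "f = hscale C (1 / (c - d)) (hscale C (c - d) f)"
    using ne fa by (simp add: hscale_hscale hscale_one)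
  also have "\<dots> = hscale C (1 / (c - d)) (hscale C 0 f)"
    unfolding z hscale_zero[OF f(1)] ..
  also have "\<dots> = hscale C 0 f" using fa by (subst hscale_hscale) simp_all
  also have "\<dots> = hzero C x y" by (rule hscale_zero[OF f(1)])
  finally show False using f(2) by simp
qed

text \<open>Properties of the identity of a direct sum are proved summand by summand; this replaces all explicit
  sums over the decomposition.\<close>
lemma direct_sum_induct:
  assumes ds: "is_direct_sum C n s x inc prj"
    and zero: "Q (hzero C x x)"
    and add: "\<And>u v. \<lbrakk>u \<in> homset C x x; v \<in> homset C x x; Q u; Q v\<rbrakk> \<Longrightarrow> Q (hadd C u v)"
    and summand: "\<And>k. k < n \<Longrightarrow> Q (inc k \<cdot> prj k)"
  shows "Q (iden C x)"
proof -
  have x: "x \<in> obs C" and ip: "\<And>k. k < n \<Longrightarrow> inc k \<in> homset C (s k) x \<and> prj k \<in> homset C x (s k)"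
    and id: "iden C x = finsum (hom_space C x x) (\<lambda>k. inc k \<cdot> prj k) {..<n}"
    using ds by (auto simp: is_direct_sum_def)
  interpret V: complex_module "hom_space C x x" by (rule complex_module_hom[OF x x])
  have mem: "inc k \<cdot> prj k \<in> homset C x x" if "k < n" for k
    using ip[OF that] compo_closed by blast
  have "finsum (hom_space C x x) (\<lambda>k. inc k \<cdot> prj k) K \<in> homset C x x \<and>
      Q (finsum (hom_space C x x) (\<lambda>k. inc k \<cdot> prj k) K)" if "finite K" "K \<subseteq> {..<n}" for K
    using that
  proof (induction K)
    case empty
    then show ?case using zero x hzero_hom by simp
  next
    case (insert k K)
    have "finsum (hom_space C x x) (\<lambda>k. inc k \<cdot> prj k) (insert k K)
        = hadd C (inc k \<cdot> prj k) (finsum (hom_space C x x) (\<lambda>k. inc k \<cdot> prj k) K)"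
      by (subst V.finsum_insert) (use insert.hyps insert.prems mem in auto)
    then show ?case using insert mem summand add hadd_hom by auto
  qed
  then show ?thesis unfolding id by blast
qed

end

section \<open>Simple objects and semisimple objects of finite length\<close>

context abelian_category
begin

text \<open>Schur's argument: the kernel of a nonzero \<open>f\<close> is zero because \<open>S\<close> is simple, so \<open>f\<close> is mono, and a
  nonzero mono into the simple \<open>T\<close> is invertible.\<close>
lemma nonzero_simple_iso:
  assumes S: "is_simple C S" and T: "is_simple C T" and f: "f \<in> homset C S T" "f \<noteq> hzero C S T"
  shows "is_iso C f"
proof -
  have fa [simp]: "f \<in> arrs C" "src C f = S" "tgt C f = T" using f by (auto simp: in_hom_iff)
  have SC: "S \<in> obs C" "T \<in> obs C" using S T by (auto simp: is_simple_def)
  obtain k where k: "is_kernel C f k" using kernels[OF fa(1)] by blast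
  then have ka: "k \<in> arrs C" "tgt C k = S" and fk: "f \<cdot> k = hzero C (src C k) T"
    and univ: "\<And>w h. \<lbrakk>h \<in> homset C w S; f \<cdot> h = hzero C w T\<rbrakk>
      \<Longrightarrow> \<exists>!u. u \<in> homset C w (src C k) \<and> k \<cdot> u = h"
    by (auto simp: is_kernel_def)
  have kh: "k \<in> homset C (src C k) S" using ka by (simp add: in_hom_iff)
  have "is_mono C k" unfolding is_mono_def
  proof (intro conjI allI ballI impI)
    show "k \<in> arrs C" by fact
    fix w g h assume g: "g \<in> homset C w (src C k)" and h: "h \<in> homset C w (src C k)" and eq: "k \<cdot> g = k \<cdot> h"
    have "f \<cdot> k \<cdot> g = hzero C w T"
      using compo_assoc[OF g kh f(1)] compo_hzero_left[OF g SC(2)] fk by simp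
    from univ[OF compo_closed[OF g kh] this] show "g = h" using g h eq by auto
  qed
  then consider "k = hzero C (src C k) S" | "is_iso C k" using S ka by (auto simp: is_simple_def)
  then have k0: "k = hzero C (src C k) S"
  proof cases
    case 2
    then obtain g where g: "g \<in> homset C S (src C k)" "k \<cdot> g = iden C S"
      using ka by (auto simp: is_iso_def)
    have "f = (f \<cdot> k) \<cdot> g" using compo_assoc[OF g(1) kh f(1)] g(2) by simp
    also have "\<dots> = hzero C S T" unfolding fk by (rule compo_hzero_left[OF g(1) SC(2)])
    finally show ?thesis using f(2) by simp
  qed
  have "is_mono C f" unfolding is_mono_def
  proof (intro conjI allI ballI impI)
    fix w g h assume "g \<in> homset C w (src C f)" "h \<in> homset C w (src C f)" and eq: "f \<cdot> g = f \<cdot> h"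
    then have g: "g \<in> homset C w S" and h: "h \<in> homset C w S" by simp_all
    let ?d = "hadd C g (hscale C (-1) h)"
    have d: "?d \<in> homset C w S" using g h hadd_hom hscale_hom by blast
    have "f \<cdot> ?d = hadd C (f \<cdot> g) (hscale C (-1) (f \<cdot> g))"
      using g h f eq by (simp add: in_hom_iff compo_linear)
    also have "\<dots> = hzero C w T" by (rule hdiff_self[OF compo_closed[OF g f(1)]])
    finally obtain u where u: "u \<in> homset C w (src C k)" "k \<cdot> u = ?d"
      using univ[OF d] by blast
    have "?d = hzero C (src C k) S \<cdot> u" using u(2) k0 by simp
    also have "\<dots> = hzero C w S" by (rule compo_hzero_left[OF u(1) SC(1)])
    finally show "g = h" by (rule hdiff_eq_zero[OF g h])
  qed simp
  then show ?thesis using T f fa by (auto simp: is_simple_def)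
qed

end

locale semisimple_object = abelian_category +
  fixes x
  assumes schur: "is_simple C S \<Longrightarrow> homset C S S = range (\<lambda>c. hscale C c (iden C S))"
    and semisimple: "semisimple_finite_length C x"
begin

lemma semisimple_sum: "\<exists>n s inc prj. (\<forall>k<n. is_simple C (s k)) \<and> is_direct_sum C n s x inc prj"
  using semisimple by (simp add: semisimple_finite_length_def)

lemma x_obs [simp]: "x \<in> obs C"
  using semisimple_sum by (auto simp: is_direct_sum_def)

lemma semisimple_induct:
  assumes zero: "Q (hzero C x x)"
    and add: "\<And>u v. \<lbrakk>u \<in> homset C x x; v \<in> homset C x x; Q u; Q v\<rbrakk> \<Longrightarrow> Q (hadd C u v)"
    and summand: "\<And>S i p. \<lbrakk>is_simple C S; i \<in> homset C S x; p \<in> homset C x S\<rbrakk> \<Longrightarrow> Q (i \<cdot> p)"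
  shows "Q (iden C x)"
proof -
  obtain n s inc prj where s: "\<forall>k<n. is_simple C (s k)" and ds: "is_direct_sum C n s x inc prj"
    using semisimple_sum by blast
  show ?thesis
    by (rule direct_sum_induct[OF ds zero add summand]) (use s ds in \<open>auto simp: is_direct_sum_def\<close>)
qed

lemma simple_hom_multiple:
  assumes S: "is_simple C S" and T: "is_simple C T"
    and t: "t \<in> homset C S T" "t \<noteq> hzero C S T" and f: "f \<in> homset C S T"
  shows "\<exists>c. f = hscale C c t"
proof -
  obtain u where u: "u \<in> homset C T S" "t \<cdot> u = iden C T"
    using nonzero_simple_iso[OF S T t] t(1) by (auto simp: is_iso_def in_hom_iff)
  obtain v where v: "v \<in> homset C T S" "v \<cdot> t = iden C S"
    using nonzero_simple_iso[OF S T t] t(1) by (auto simp: is_iso_def in_hom_iff)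
  obtain c where c: "v \<cdot> f = hscale C c (iden C S)"
    using schur[OF S] compo_closed[OF f v(1)] by auto
  have "v = v \<cdot> t \<cdot> u" using v u by (auto simp: in_hom_iff)
  also have "\<dots> = u" using compo_assoc[OF u(1) t(1) v(1)] v(2) iden_left[OF u(1)] by simp
  finally have uv: "v = u" .
  have "f = (t \<cdot> u) \<cdot> f" using u f by (simp add: in_hom_iff)
  also have "\<dots> = t \<cdot> v \<cdot> f" unfolding uv by (rule compo_assoc[OF f u(1) t(1)])
  also have "\<dots> = hscale C c t" unfolding c
    using t hom_obs[OF t(1)] by (simp add: in_hom_iff compo_hscale_right)
  finally show ?thesis by blast
qed

lemma fin_dim_hom_simple:
  assumes S: "is_simple C S"
  shows "complex_module.fin_dim (hom_space C x S)"
proof -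
  have SC: "S \<in> obs C" using S by (simp add: is_simple_def)
  interpret V: complex_module "hom_space C x S" by (rule complex_module_hom[OF x_obs SC])
  define Q where "Q u \<longleftrightarrow> (\<exists>F. finite F \<and> F \<subseteq> homset C x S \<and> (\<forall>f\<in>homset C x S. f \<cdot> u \<in> V.cspan F))" for u
  have "Q (iden C x)"
  proof (rule semisimple_induct)
    have "f \<cdot> hzero C x x \<in> V.cspan {}" if "f \<in> homset C x S" for f
      using compo_hzero_right[OF that x_obs] V.cspan.zero by simp
    then show "Q (hzero C x x)" unfolding Q_def by (intro exI[of _ "{}"]) simp
  next
    fix u v assume u: "u \<in> homset C x x" and v: "v \<in> homset C x x" and "Q u" "Q v"
    then obtain F G where F: "finite F" "F \<subseteq> homset C x S" "\<And>f. f\<in>homset C x S \<Longrightarrow> f \<cdot> u \<in> V.cspan F"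
      and G: "finite G" "G \<subseteq> homset C x S" "\<And>f. f\<in>homset C x S \<Longrightarrow> f \<cdot> v \<in> V.cspan G"
      unfolding Q_def by blast
    have FG: "F \<union> G \<subseteq> carrier (hom_space C x S)" using F G by simp
    have "f \<cdot> hadd C u v \<in> V.cspan (F \<union> G)" if f: "f \<in> homset C x S" for f
    proof -
      have "f \<cdot> u \<in> V.cspan (F \<union> G)" "f \<cdot> v \<in> V.cspan (F \<union> G)"
        using F(3)[OF f] G(3)[OF f] V.cspan_mono[OF FG, of F] V.cspan_mono[OF FG, of G] by auto
      then show ?thesis using V.cspan_add[OF FG] compo_add_right[OF u v f] by simp
    qed
    then show "Q (hadd C u v)" unfolding Q_def using F G by (intro exI[of _ "F \<union> G"]) simp
  next
    fix T i p assume T: "is_simple C T" and i: "i \<in> homset C T x" and p: "p \<in> homset C x T"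
    show "Q (i \<cdot> p)"
    proof (cases "\<forall>t\<in>homset C T S. t = hzero C T S")
      case True
      have "f \<cdot> i \<cdot> p \<in> V.cspan {}" if f: "f \<in> homset C x S" for f
      proof -
        have "f \<cdot> i = hzero C T S" using True compo_closed[OF i f] by blast
        then have "f \<cdot> i \<cdot> p = hzero C x S"
          using compo_assoc[OF p i f] compo_hzero_left[OF p SC] by simp
        then show ?thesis using V.cspan.zero by simp
      qed
      then show ?thesis unfolding Q_def by (intro exI[of _ "{}"]) simp
    next
      case False
      then obtain t where t: "t \<in> homset C T S" "t \<noteq> hzero C T S" by blast
      have tp: "t \<cdot> p \<in> homset C x S" using compo_closed[OF p t(1)] .
      have "f \<cdot> i \<cdot> p \<in> V.cspan {t \<cdot> p}" if f: "f \<in> homset C x S" for f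
      proof -
        obtain c where c: "f \<cdot> i = hscale C c t"
          using simple_hom_multiple[OF T S t compo_closed[OF i f]] by blast
        have "f \<cdot> i \<cdot> p = hscale C c (t \<cdot> p)"
          using compo_assoc[OF p i f] compo_scale_left[OF p t(1)] c by simp
        then show ?thesis
          using V.cspan_scale[OF _ V.cspan_base[of "{t \<cdot> p}" "t \<cdot> p"], of c] tp by simp
      qed
      then show ?thesis unfolding Q_def using tp by (intro exI[of _ "{t \<cdot> p}"]) simp
    qed
  qed
  then obtain F where F: "finite F" "F \<subseteq> homset C x S" "\<forall>f\<in>homset C x S. f \<cdot> iden C x \<in> V.cspan F"
    unfolding Q_def by blast
  have "homset C x S \<subseteq> V.cspan F" using F(3) iden_right by auto
  then show ?thesis unfolding V.fin_dim_def using F by (intro exI[of _ F]) simp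
qed

lemma fin_dim_end: "complex_module.fin_dim (hom_space C x x)"
proof -
  interpret E: complex_module "hom_space C x x" by (rule complex_module_hom[OF x_obs x_obs])
  define Q where "Q u \<longleftrightarrow> (\<exists>F. finite F \<and> F \<subseteq> homset C x x \<and> (\<forall>f\<in>homset C x x. u \<cdot> f \<in> E.cspan F))" for u
  have "Q (iden C x)"
  proof (rule semisimple_induct)
    have "hzero C x x \<cdot> f \<in> E.cspan {}" if "f \<in> homset C x x" for f
      using compo_hzero_left[OF that x_obs] E.cspan.zero by simp
    then show "Q (hzero C x x)" unfolding Q_def by (intro exI[of _ "{}"]) simp
  next
    fix u v assume u: "u \<in> homset C x x" and v: "v \<in> homset C x x" and "Q u" "Q v"
    then obtain F G where F: "finite F" "F \<subseteq> homset C x x" "\<And>f. f\<in>homset C x x \<Longrightarrow> u \<cdot> f \<in> E.cspan F"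
      and G: "finite G" "G \<subseteq> homset C x x" "\<And>f. f\<in>homset C x x \<Longrightarrow> v \<cdot> f \<in> E.cspan G"
      unfolding Q_def by blast
    have FG: "F \<union> G \<subseteq> carrier (hom_space C x x)" using F G by simp
    have "hadd C u v \<cdot> f \<in> E.cspan (F \<union> G)" if f: "f \<in> homset C x x" for f
    proof -
      have "u \<cdot> f \<in> E.cspan (F \<union> G)" "v \<cdot> f \<in> E.cspan (F \<union> G)"
        using F(3)[OF f] G(3)[OF f] E.cspan_mono[OF FG, of F] E.cspan_mono[OF FG, of G] by auto
      then show ?thesis using E.cspan_add[OF FG] compo_add_left[OF f u v] by simp
    qed
    then show "Q (hadd C u v)" unfolding Q_def using F G by (intro exI[of _ "F \<union> G"]) simp
  next
    fix T i p assume T: "is_simple C T" and i: "i \<in> homset C T x" and p: "p \<in> homset C x T"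
    have TC: "T \<in> obs C" using T by (simp add: is_simple_def)
    interpret V: complex_module "hom_space C x T" by (rule complex_module_hom[OF x_obs TC])
    obtain F where F: "finite F" "F \<subseteq> homset C x T" "homset C x T \<subseteq> V.cspan F"
      using fin_dim_hom_simple[OF T] unfolding V.fin_dim_def by auto
    let ?G = "(\<lambda>f. i \<cdot> f) ` F"
    have G: "?G \<subseteq> homset C x x" using F(2) compo_closed[OF _ i] by auto
    have img: "i \<cdot> f \<in> E.cspan ?G" if "f \<in> V.cspan F" for f
      using that
    proof induction
      case zero
      then show ?case using compo_hzero_right[OF i x_obs] E.cspan.zero[of ?G] by simp
    next
      case (add_scale a v c)
      have a: "a \<in> homset C x T" using add_scale F by auto
      have v: "v \<in> homset C x T" using V.cspan_carrier[of F v] F add_scale by simp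
      have "i \<cdot> hadd C (hscale C c a) v = hadd C (hscale C c (i \<cdot> a)) (i \<cdot> v)"
        using i a v by (simp add: in_hom_iff compo_linear)
      then show ?case
        using E.cspan.add_scale[of "i \<cdot> a" ?G "i \<cdot> v" c] add_scale by simp
    qed
    have "(i \<cdot> p) \<cdot> f \<in> E.cspan ?G" if f: "f \<in> homset C x x" for f
      using compo_assoc[OF f p i] img compo_closed[OF f p] F(3) by auto
    then show "Q (i \<cdot> p)" unfolding Q_def using F G by (intro exI[of _ ?G]) simp
  qed
  then obtain F where F: "finite F" "F \<subseteq> homset C x x" "\<forall>f\<in>homset C x x. iden C x \<cdot> f \<in> E.cspan F"
    unfolding Q_def by blast
  have "homset C x x \<subseteq> E.cspan F" using F(3) iden_left by auto
  then show ?thesis unfolding E.fin_dim_def using F by (intro exI[of _ F]) simp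
qed

text \<open>The arrows to the representatives in \<open>R\<close> separate arrows into \<open>x\<close>, since every simple summand of \<open>x\<close> is
  isomorphic to such a representative.\<close>
lemma hom_simple_faithful:
  assumes R: "simple_reps C R" and u: "u \<in> homset C w x" and v: "v \<in> homset C w x"
    and eq: "\<And>S f. \<lbrakk>S \<in> R; f \<in> homset C x S\<rbrakk> \<Longrightarrow> f \<cdot> u = f \<cdot> v"
  shows "u = v"
proof -
  define Q where "Q z \<longleftrightarrow> z \<cdot> u = z \<cdot> v" for z
  have "Q (iden C x)"
  proof (rule semisimple_induct)
    show "Q (hzero C x x)" unfolding Q_def
      using compo_hzero_left[OF u x_obs] compo_hzero_left[OF v x_obs] by simp
  next
    fix y z assume "y \<in> homset C x x" "z \<in> homset C x x" "Q y" "Q z"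
    then show "Q (hadd C y z)" unfolding Q_def using compo_add_left[OF u] compo_add_left[OF v] by simp
  next
    fix S i p assume S: "is_simple C S" and i: "i \<in> homset C S x" and p: "p \<in> homset C x S"
    obtain T t where T: "T \<in> R" and t: "t \<in> homset C S T" "is_iso C t"
      using R S unfolding simple_reps_def isomorphic_def by blast
    then obtain t' where t': "t' \<in> homset C T S" "t' \<cdot> t = iden C S"
      by (auto simp: is_iso_def in_hom_iff)
    have inv: "t' \<cdot> (t \<cdot> p) \<cdot> z = p \<cdot> z" if z: "z \<in> homset C w x" for z
    proof -
      have "t' \<cdot> (t \<cdot> p) \<cdot> z = (t' \<cdot> t) \<cdot> p \<cdot> z"
        using z p t(1) t'(1) by (simp add: in_hom_iff)
      then show ?thesis unfolding t'(2) using z p by (simp add: in_hom_iff)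
    qed
    have "p \<cdot> u = p \<cdot> v"
      using eq[OF T compo_closed[OF p t(1)]] inv[OF u] inv[OF v] by simp
    then show "Q (i \<cdot> p)" unfolding Q_def
      using compo_assoc[OF u p i] compo_assoc[OF v p i] by simp
  qed
  then show ?thesis unfolding Q_def using iden_left u v by simp
qed

text \<open>The pairing \<open>Hom(x, S) \<times> Hom(S, x) \<rightarrow> End(S) = \<complex>\<close> is perfect. On a summand isomorphic to \<open>S\<close> the
  representing arrow is a multiple of the inverse isomorphism, on every other summand it is zero.\<close>
lemma functional_represented:
  assumes S: "is_simple C S"
    and add: "\<And>f g. \<lbrakk>f \<in> homset C x S; g \<in> homset C x S\<rbrakk> \<Longrightarrow> L (hadd C f g) = L f + L g"
    and scale: "\<And>c f. f \<in> homset C x S \<Longrightarrow> L (hscale C c f) = c * L f"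
  shows "\<exists>g\<in>homset C S x. \<forall>f\<in>homset C x S. f \<cdot> g = hscale C (L f) (iden C S)"
proof -
  have SC [simp]: "S \<in> obs C" using S by (simp add: is_simple_def)
  have L0: "L (hzero C x S) = 0"
    using scale[OF hzero_hom[OF x_obs SC], of 0] hscale_zero[OF hzero_hom[OF x_obs SC]] by simp
  have s0: "hscale C 0 (iden C S) = hzero C S S" using hscale_zero iden_closed[OF SC] by blast
  define Q where "Q u \<longleftrightarrow> (\<exists>g\<in>homset C S x. \<forall>f\<in>homset C x S. f \<cdot> g = hscale C (L (f \<cdot> u)) (iden C S))" for u
  have "Q (iden C x)"
  proof (rule semisimple_induct)
    show "Q (hzero C x x)" unfolding Q_def
      by (intro bexI[of _ "hzero C S x"]) (auto simp: compo_hzero_right L0 s0 intro: hzero_hom)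
  next
    fix u v assume u: "u \<in> homset C x x" and v: "v \<in> homset C x x" and "Q u" "Q v"
    then obtain g h where g: "g \<in> homset C S x" "\<And>f. f\<in>homset C x S \<Longrightarrow> f \<cdot> g = hscale C (L (f \<cdot> u)) (iden C S)"
      and h: "h \<in> homset C S x" "\<And>f. f\<in>homset C x S \<Longrightarrow> f \<cdot> h = hscale C (L (f \<cdot> v)) (iden C S)"
      unfolding Q_def by blast
    have "f \<cdot> hadd C g h = hscale C (L (f \<cdot> hadd C u v)) (iden C S)" if f: "f \<in> homset C x S" for f
      using compo_add_right[OF g(1) h(1) f] compo_add_right[OF u v f] g(2)[OF f] h(2)[OF f]
        add[OF compo_closed[OF u f] compo_closed[OF v f]] by (simp add: hscale_add)
    then show "Q (hadd C u v)" unfolding Q_def using hadd_hom[OF g(1) h(1)] by blast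
  next
    fix T i p assume T: "is_simple C T" and i: "i \<in> homset C T x" and p: "p \<in> homset C x T"
    show "Q (i \<cdot> p)"
    proof (cases "\<forall>t\<in>homset C T S. t = hzero C T S")
      case True
      have "f \<cdot> hzero C S x = hscale C (L (f \<cdot> i \<cdot> p)) (iden C S)" if f: "f \<in> homset C x S" for f
      proof -
        have "f \<cdot> i = hzero C T S" using True compo_closed[OF i f] by blast
        then have "f \<cdot> i \<cdot> p = hzero C x S"
          using compo_assoc[OF p i f] compo_hzero_left[OF p SC] by simp
        then show ?thesis using compo_hzero_right[OF f SC] by (simp add: L0 s0)
      qed
      then show ?thesis unfolding Q_def using hzero_hom[OF SC x_obs] by blast
    next
      case False
      then obtain t where t: "t \<in> homset C T S" "t \<noteq> hzero C T S" by blast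
      obtain t' where t': "t' \<in> homset C S T" "t \<cdot> t' = iden C S"
        using nonzero_simple_iso[OF T S t] t(1) by (auto simp: is_iso_def in_hom_iff)
      have tp: "t \<cdot> p \<in> homset C x S" using compo_closed[OF p t(1)] .
      let ?g = "hscale C (L (t \<cdot> p)) (i \<cdot> t')"
      have it: "i \<cdot> t' \<in> homset C S x" using compo_closed[OF t'(1) i] .
      have "f \<cdot> ?g = hscale C (L (f \<cdot> i \<cdot> p)) (iden C S)" if f: "f \<in> homset C x S" for f
      proof -
        obtain c where c: "f \<cdot> i = hscale C c t"
          using simple_hom_multiple[OF T S t compo_closed[OF i f]] by blast
        have "f \<cdot> i \<cdot> p = hscale C c (t \<cdot> p)"
          using compo_assoc[OF p i f] compo_scale_left[OF p t(1)] c by simp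
        then have L: "L (f \<cdot> i \<cdot> p) = c * L (t \<cdot> p)" using scale[OF tp] by simp
        have "f \<cdot> i \<cdot> t' = hscale C c (iden C S)"
          using compo_assoc[OF t'(1) i f] compo_scale_left[OF t'(1) t(1)] c t'(2) by simp
        then show ?thesis
          using compo_scale_right[OF it f] L by (simp add: hscale_hscale mult.commute)
      qed
      then show ?thesis unfolding Q_def using hscale_hom[OF it] by blast
    qed
  qed
  then show ?thesis unfolding Q_def using iden_right by simp
qed

end

section \<open>The scalars of the pairing on multiplicity spaces\<close>

locale semisimple_rigid = linear_abelian_rigid_category C + semisimple_object C x
  for C (structure) and x
begin

text \<open>Duality identifies \<open>Hom(\<one>, S \<otimes> S\<^sup>*)\<close> with \<open>End(S)\<close>, and \<open>coev\<close> corresponds to the identity.\<close>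
lemma coev_multiple:
  assumes S: "is_simple C S" and D: "left_dual C S D"
    and f: "f \<in> homset C (tunit C) (S \<otimes>\<^sub>o dobj D)"
  shows "\<exists>c. f = hscale C c (dcoev D)"
proof -
  note d [simp] = left_dual_simps(1-8)[OF D] and z = left_dual_simps(9,10)[OF D]
  have fa [simp]: "f \<in> arrs C" "src C f = tunit C" "tgt C f = S \<otimes>\<^sub>o dobj D"
    using f by (auto simp: in_hom_iff)
  let ?I = "iden C S" and ?J = "iden C (dobj D)" and ?c = "dcoev D" and ?e = "dev D"
  define s where "s = (?I \<otimes>\<^sub>a ?e) \<cdot> (f \<otimes>\<^sub>a ?I)"
  have sh [simp]: "s \<in> arrs C" "src C s = S" "tgt C s = S" by (simp_all add: s_def)
  have "(s \<otimes>\<^sub>a ?J) \<cdot> ?c = (?I \<otimes>\<^sub>a ?e \<otimes>\<^sub>a ?J) \<cdot> (f \<otimes>\<^sub>a iden C (S \<otimes>\<^sub>o dobj D)) \<cdot> ?c"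
    by (simp add: s_def whisker_right)
  also have "(f \<otimes>\<^sub>a iden C (S \<otimes>\<^sub>o dobj D)) \<cdot> ?c = (iden C (S \<otimes>\<^sub>o dobj D) \<otimes>\<^sub>a ?c) \<cdot> f"
    using tarr_right_first[of f ?c "tunit C" "S \<otimes>\<^sub>o dobj D"]
      tarr_left_first[of f ?c "S \<otimes>\<^sub>o dobj D" "tunit C"] by simp
  also have "(?I \<otimes>\<^sub>a ?e \<otimes>\<^sub>a ?J) \<cdot> \<dots> = f"
    using compo_eq_assoc[OF whisker_eq_left[OF z(2), of S], of f] by simp
  finally have "f = (s \<otimes>\<^sub>a ?J) \<cdot> ?c" ..
  moreover have "s \<in> homset C S S" by (simp add: in_hom_iff)
  then obtain c where "s = hscale C c ?I" unfolding schur[OF S] by blast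
  ultimately have "f = hscale C c ?c"
    by (simp add: tarr_scale_left compo_hscale_left)
  then show ?thesis ..
qed

lemma coev_scale_inj:
  assumes S: "is_simple C S" and D: "left_dual C S D"
    and eq: "hscale C c (dcoev D) = hscale C d (dcoev D)"
  shows "c = d"
proof (rule hscale_cancel[OF _ _ eq])
  note d [simp] = left_dual_simps(1-8)[OF D] and z = left_dual_simps(9)[OF D]
  show h: "dcoev D \<in> homset C (tunit C) (S \<otimes>\<^sub>o dobj D)" by (simp add: in_hom_iff)
  show "dcoev D \<noteq> hzero C (tunit C) (S \<otimes>\<^sub>o dobj D)"
  proof
    assume "dcoev D = hzero C (tunit C) (S \<otimes>\<^sub>o dobj D)"
    then have "dcoev D = hscale C 0 (dcoev D)" using hscale_zero[OF h] by simp
    then have "iden C S = (iden C S \<otimes>\<^sub>a dev D) \<cdot> (hscale C 0 (dcoev D) \<otimes>\<^sub>a iden C S)" using z by simp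
    also have "\<dots> = hscale C 0 (iden C S)"
      by (simp add: tarr_scale_left compo_hscale_right z)
    also have "\<dots> = hzero C S S" by (rule hscale_zero) (simp add: in_hom_iff)
    finally show False using S by (simp add: is_simple_def)
  qed
qed

lemma kappa_eqI:
  assumes S: "is_simple C S" and D: "left_dual C S D"
    and "(f \<otimes>\<^sub>a g) \<cdot> dcoev Dx = hscale C c (dcoev D)"
  shows "kappa' C Dx D f g = c"
  unfolding kappa'_def using assms(3) coev_scale_inj[OF S D] by (intro the_equality) auto

lemma kappa_eq:
  assumes S: "is_simple C S" and D: "left_dual C S D" and Dx: "left_dual C x Dx"
    and f: "f \<in> homset C x S" and g: "g \<in> homset C (dobj Dx) (dobj D)"
  shows "(f \<otimes>\<^sub>a g) \<cdot> dcoev Dx = hscale C (kappa' C Dx D f g) (dcoev D)"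
proof -
  have "(f \<otimes>\<^sub>a g) \<cdot> dcoev Dx \<in> homset C (tunit C) (S \<otimes>\<^sub>o dobj D)"
    using f g left_dual_simps[OF Dx] by (simp add: in_hom_iff)
  then obtain c where "(f \<otimes>\<^sub>a g) \<cdot> dcoev Dx = hscale C c (dcoev D)"
    using coev_multiple[OF S D] by blast
  then show ?thesis using kappa_eqI[OF S D] by simp
qed

lemma kappa_add:
  assumes S: "is_simple C S" and D: "left_dual C S D" and Dx: "left_dual C x Dx"
    and f: "f \<in> homset C x S" and f': "f' \<in> homset C x S" and g: "g \<in> homset C (dobj Dx) (dobj D)"
  shows "kappa' C Dx D (hadd C f f') g = kappa' C Dx D f g + kappa' C Dx D f' g"
proof (rule kappa_eqI[OF S D])
  have "(hadd C f f' \<otimes>\<^sub>a g) \<cdot> dcoev Dx = hadd C ((f \<otimes>\<^sub>a g) \<cdot> dcoev Dx) ((f' \<otimes>\<^sub>a g) \<cdot> dcoev Dx)"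
    using f f' g left_dual_simps[OF Dx] tarr_add_left[OF f f', of g]
    by (simp add: in_hom_iff compo_linear)
  then show "(hadd C f f' \<otimes>\<^sub>a g) \<cdot> dcoev Dx
      = hscale C (kappa' C Dx D f g + kappa' C Dx D f' g) (dcoev D)"
    using kappa_eq[OF S D Dx f g] kappa_eq[OF S D Dx f' g] left_dual_simps(6)[OF D]
    by (simp add: hscale_add)
qed

lemma kappa_scale:
  assumes S: "is_simple C S" and D: "left_dual C S D" and Dx: "left_dual C x Dx"
    and f: "f \<in> homset C x S" and g: "g \<in> homset C (dobj Dx) (dobj D)"
  shows "kappa' C Dx D (hscale C c f) g = c * kappa' C Dx D f g"
proof (rule kappa_eqI[OF S D])
  have "(hscale C c f \<otimes>\<^sub>a g) \<cdot> dcoev Dx = hscale C c ((f \<otimes>\<^sub>a g) \<cdot> dcoev Dx)"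
    using f g left_dual_simps[OF Dx]
    by (simp add: in_hom_iff compo_linear tarr_scale_left)
  then show "(hscale C c f \<otimes>\<^sub>a g) \<cdot> dcoev Dx = hscale C (c * kappa' C Dx D f g) (dcoev D)"
    using kappa_eq[OF S D Dx f g] left_dual_simps(6)[OF D]
    by (simp add: hscale_hscale)
qed

text \<open>For \<open>g = h\<^sup>*\<close> with \<open>h : S \<rightarrow> x\<close>, the scalar \<open>\<kappa>'(f, g)\<close> is the one by which \<open>f \<cdot> h\<close> acts on \<open>S\<close>, so the claim
  reduces to the perfect pairing of \<open>Hom(x, S)\<close> with \<open>Hom(S, x)\<close>.\<close>
lemma kappa_represents:
  assumes S: "is_simple C S" and D: "left_dual C S D" and Dx: "left_dual C x Dx"
    and add: "\<And>f g. \<lbrakk>f \<in> homset C x S; g \<in> homset C x S\<rbrakk> \<Longrightarrow> L (hadd C f g) = L f + L g"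
    and scale: "\<And>c f. f \<in> homset C x S \<Longrightarrow> L (hscale C c f) = c * L f"
  shows "\<exists>g\<in>homset C (dobj Dx) (dobj D). \<forall>f\<in>homset C x S. kappa' C Dx D f g = L f"
proof -
  obtain h where h: "h \<in> homset C S x" and hL: "\<And>f. f \<in> homset C x S \<Longrightarrow> f \<cdot> h = hscale C (L f) (iden C S)"
    using functional_represented[OF S, of L] add scale by blast
  note X = left_dual_simps[OF Dx] and Y = left_dual_simps[OF D]
  let ?g = "dual_arr C D Dx h"
  have g: "?g \<in> homset C (dobj Dx) (dobj D)" by (rule dual_arr_hom[OF D Dx h])
  have "kappa' C Dx D f ?g = L f" if f: "f \<in> homset C x S" for f
  proof (rule kappa_eqI[OF S D])
    have fa: "f \<in> arrs C" "src C f = x" "tgt C f = S" using f by (auto simp: in_hom_iff)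
    have ga: "?g \<in> arrs C" "src C ?g = dobj Dx" "tgt C ?g = dobj D" using g by (auto simp: in_hom_iff)
    have ha: "h \<in> arrs C" "src C h = S" "tgt C h = x" using h by (auto simp: in_hom_iff)
    have "(f \<otimes>\<^sub>a ?g) \<cdot> dcoev Dx = (f \<otimes>\<^sub>a iden C (dobj D)) \<cdot> (iden C x \<otimes>\<^sub>a ?g) \<cdot> dcoev Dx"
      using X Y fa ga by (simp add: tarr_exchange_assoc)
    also have "\<dots> = (f \<otimes>\<^sub>a iden C (dobj D)) \<cdot> (h \<otimes>\<^sub>a iden C (dobj D)) \<cdot> dcoev D"
      by (simp add: dual_arr_coev[OF D Dx h])
    also have "\<dots> = ((f \<cdot> h) \<otimes>\<^sub>a iden C (dobj D)) \<cdot> dcoev D"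
      using X Y fa ha by (simp add: tarr_exchange_assoc)
    also have "\<dots> = hscale C (L f) (dcoev D)"
      using Y by (simp add: hL[OF f] tarr_scale_left compo_hscale_left)
    finally show "(f \<otimes>\<^sub>a ?g) \<cdot> dcoev Dx = hscale C (L f) (dcoev D)" .
  qed
  then show ?thesis using g by blast
qed

end

section \<open>Rigid invariance as selfadjointness\<close>

locale frobenius_with_basis = semisimple_rigid C "fobj X" for C (structure) and X +
  fixes R B
  assumes frob: "frobenius_algebra C X" and basis: "object_basis C (fobj X) R B"
begin

abbreviation "x \<equiv> fobj X"
abbreviation "Dx \<equiv> frob_dual C X"
abbreviation "form S \<equiv> herm (hom_space C x S) (B S)"

lemma reps: "simple_reps C R" using basis by (simp add: object_basis_def)

lemma reps_simple: "S \<in> R \<Longrightarrow> is_simple C S" using reps by (simp add: simple_reps_def)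

lemma reps_obs: "S \<in> R \<Longrightarrow> S \<in> obs C" using reps_simple by (simp add: is_simple_def)

lemma hom_basis: "S \<in> R \<Longrightarrow> fin_dim_basis (hom_space C x S) (B S)"
  using basis fin_dim_hom_simple[OF reps_simple] complex_module_hom[OF x_obs reps_obs]
  by (simp add: fin_dim_basis_def fin_dim_basis_axioms_def object_basis_def)

lemma dual_x: "left_dual C x Dx" by (rule frob_left_dual[OF frob])

lemma dobj_x [simp]: "dobj Dx = x" by (simp add: frob_dual_def)

lemma M'_props:
  assumes S: "S \<in> R" and D: "left_dual C S D" and g: "g \<in> homset C x (dobj D)"
  shows "M' C B x Dx S D g \<in> homset C x S"
    "f \<in> homset C x S \<Longrightarrow> form S f (M' C B x Dx S D g) = kappa' C Dx D f g"
proof -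
  interpret V: fin_dim_basis "hom_space C x S" "B S" by (rule hom_basis[OF S])
  let ?P = "\<lambda>h. h \<in> homset C x S \<and> (\<forall>f\<in>homset C x S. form S f h = kappa' C Dx D f g)"
  have g': "g \<in> homset C (dobj Dx) (dobj D)" using g by simp
  have "\<exists>h\<in>homset C x S. \<forall>f\<in>homset C x S. form S f h = kappa' C Dx D f g"
    using V.riesz[of "\<lambda>f. kappa' C Dx D f g"]
      kappa_add[OF reps_simple[OF S] D dual_x _ _ g'] kappa_scale[OF reps_simple[OF S] D dual_x _ g']
    by simp
  then obtain h where h: "?P h" by blast
  have "?P (M' C B x Dx S D g)"
    unfolding M'_def
  proof (rule theI[of ?P h])
    show "?P h" by (rule h)
    fix h' assume "?P h'"
    then show "h' = h" using V.herm_eqI[of h' h] h by simp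
  qed
  then show "M' C B x Dx S D g \<in> homset C x S"
    "f \<in> homset C x S \<Longrightarrow> form S f (M' C B x Dx S D g) = kappa' C Dx D f g" by auto
qed

lemma M'_eqI:
  assumes S: "S \<in> R" and D: "left_dual C S D" and g: "g \<in> homset C x (dobj D)"
    and h: "h \<in> homset C x S" "\<And>f. f \<in> homset C x S \<Longrightarrow> form S f h = kappa' C Dx D f g"
  shows "M' C B x Dx S D g = h"
proof -
  interpret V: fin_dim_basis "hom_space C x S" "B S" by (rule hom_basis[OF S])
  show ?thesis using V.herm_eqI[of "M' C B x Dx S D g" h] M'_props[OF S D g] h by simp
qed

lemma M'_surj:
  assumes S: "S \<in> R" and D: "left_dual C S D" and h: "h \<in> homset C x S"
  shows "\<exists>g\<in>homset C x (dobj D). M' C B x Dx S D g = h"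
proof -
  interpret V: fin_dim_basis "hom_space C x S" "B S" by (rule hom_basis[OF S])
  have "\<exists>g\<in>homset C (dobj Dx) (dobj D). \<forall>f\<in>homset C x S. kappa' C Dx D f g = form S f h"
    using V.herm_add_left V.herm_scale_left by (intro kappa_represents[OF reps_simple[OF S] D dual_x]) simp_all
  then obtain g where g: "g \<in> homset C x (dobj D)" "\<forall>f\<in>homset C x S. kappa' C Dx D f g = form S f h"
    by auto
  have "M' C B x Dx S D g = h" by (rule M'_eqI[OF S D g(1) h]) (simp add: g(2))
  then show ?thesis using g(1) by blast
qed

text \<open>The operators are the right multiplications on the spaces \<open>Hom(X, S)\<close>, which separate the
  endomorphisms of \<open>X\<close>.\<close>
definition selfadjoint where
  "selfadjoint q \<longleftrightarrow> (\<forall>S\<in>R. \<forall>f\<in>homset C x S. \<forall>h\<in>homset C x S. form S (f \<cdot> q) h = form S f (h \<cdot> q))"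

lemma selfadjointD:
  "\<lbrakk>selfadjoint q; S \<in> R; f \<in> homset C x S; h \<in> homset C x S\<rbrakk> \<Longrightarrow> form S (f \<cdot> q) h = form S f (h \<cdot> q)"
  by (simp add: selfadjoint_def)

text \<open>This is where the selfduality of \<open>q\<close> meets the pairing: \<open>q\<close> moves from one leg of \<open>coev\<close> to the other.\<close>
lemma kappa_adjoint:
  assumes q: "q \<in> homset C x x" and sym: "(q \<otimes>\<^sub>a iden C x) \<cdot> dcoev Dx = (iden C x \<otimes>\<^sub>a q) \<cdot> dcoev Dx"
    and f: "f \<in> homset C x S" and g: "g \<in> homset C x d"
  shows "kappa' C Dx D (f \<cdot> q) g = kappa' C Dx D f (g \<cdot> q)"
proof -
  note X = left_dual_simps[OF dual_x]
  have a: "f \<in> arrs C" "src C f = x" "q \<in> arrs C" "src C q = x" "tgt C q = x" "g \<in> arrs C" "src C g = x"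
    using q f g by (auto simp: in_hom_iff)
  have "((f \<cdot> q) \<otimes>\<^sub>a g) \<cdot> dcoev Dx = (f \<otimes>\<^sub>a g) \<cdot> (q \<otimes>\<^sub>a iden C x) \<cdot> dcoev Dx"
    using a X by (simp add: tarr_exchange_assoc)
  also have "\<dots> = (f \<otimes>\<^sub>a (g \<cdot> q)) \<cdot> dcoev Dx"
    unfolding sym using a X by (simp add: tarr_exchange_assoc)
  finally show ?thesis by (simp add: kappa'_def)
qed

lemma image_split:
  assumes "i \<in> homset C a x" "p \<in> homset C x a" "p \<cdot> i = iden C a"
  shows "(\<lambda>g. g \<cdot> p) ` homset C a y = (\<lambda>g. g \<cdot> i \<cdot> p) ` homset C x y"
proof (intro equalityI subsetI)
  fix u assume "u \<in> (\<lambda>g. g \<cdot> p) ` homset C a y"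
  then obtain g where g: "g \<in> homset C a y" "u = g \<cdot> p" by blast
  have "(g \<cdot> p) \<cdot> i \<cdot> p = g \<cdot> (p \<cdot> i) \<cdot> p" using g assms(1,2) by (simp add: in_hom_iff)
  also have "\<dots> = g \<cdot> p" unfolding assms(3) using g assms(2) by (simp add: in_hom_iff)
  finally show "u \<in> (\<lambda>g. g \<cdot> i \<cdot> p) ` homset C x y"
    using g compo_closed[OF assms(2) g(1)] by force
next
  fix u assume "u \<in> (\<lambda>g. g \<cdot> i \<cdot> p) ` homset C x y"
  then obtain g where g: "g \<in> homset C x y" "u = g \<cdot> i \<cdot> p" by blast
  then have "u = (g \<cdot> i) \<cdot> p" using assms(1,2) by (simp add: in_hom_iff)
  then show "u \<in> (\<lambda>g. g \<cdot> p) ` homset C a y" using compo_closed[OF assms(1) g(1)] by blast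
qed

text \<open>If the images agree, every \<open>h \<cdot> q\<close> is some \<open>M' (g \<cdot> q)\<close>, and moving \<open>q\<close> across \<open>\<kappa>'\<close> shows that \<open>h \<cdot> q\<close> is
  orthogonal to \<open>f - f \<cdot> q\<close>; an idempotent whose image and kernel are orthogonal is selfadjoint.
  Conversely, for selfadjoint \<open>q\<close> the map \<open>M'\<close> commutes with right multiplication by \<open>q\<close>, and it is
  onto.\<close>
lemma rigid_iff_selfadjoint:
  assumes sub: "frobenius_subalgebra C X (A, i)"
  shows "frobenius_basis_subalgebra C X R B (A, i) \<longleftrightarrow> selfadjoint (sub_idem C X (A, i))"
proof -
  define p where "p = frob_dual_arr C A X i"
  define q where "q = i \<cdot> p"
  have A: "frobenius_algebra C A" and i: "i \<in> homset C (fobj A) x" and pi: "p \<cdot> i = iden C (fobj A)"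
    using sub by (auto simp: frobenius_subalgebra_def p_def)
  have p: "p \<in> homset C x (fobj A)"
    using dual_arr_hom[OF frob_left_dual[OF A] dual_x i] by (simp add: p_def frob_dual_arr_def frob_dual_def)
  have sq: "sub_idem C X (A, i) = q" by (simp add: sub_idem_def q_def p_def)
  have qh: "q \<in> homset C x x" and qq: "q \<cdot> q = q"
    and sym: "(q \<otimes>\<^sub>a iden C x) \<cdot> dcoev Dx = (iden C x \<otimes>\<^sub>a q) \<cdot> dcoev Dx"
    using idem_of_subalgebra[OF frob sub] unfolding sq subalgebra_idem_def by auto
  note img = image_split[OF i p pi, folded q_def]
  have "frobenius_basis_subalgebra C X R B (A, i) \<longleftrightarrow>
      (\<forall>S\<in>R. \<forall>D. left_dual C S D \<longrightarrow>
        M' C B x Dx S D ` ((\<lambda>g. g \<cdot> q) ` homset C x (dobj D)) = (\<lambda>f. f \<cdot> q) ` homset C x S)"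
    using sub i p pi
    by (simp add: frobenius_basis_subalgebra_def rigid_invariant_def frob_dual_arr_def[symmetric]
        p_def[symmetric] img frob_dual_def[of C A])
  also have "\<dots> \<longleftrightarrow> selfadjoint q"
  proof
    assume inv: "\<forall>S\<in>R. \<forall>D. left_dual C S D \<longrightarrow>
        M' C B x Dx S D ` ((\<lambda>g. g \<cdot> q) ` homset C x (dobj D)) = (\<lambda>f. f \<cdot> q) ` homset C x S"
    show "selfadjoint q"
      unfolding selfadjoint_def
    proof (intro ballI)
      fix S f h assume S: "S \<in> R" and f: "f \<in> homset C x S" and h: "h \<in> homset C x S"
      interpret V: fin_dim_basis "hom_space C x S" "B S" by (rule hom_basis[OF S])
      obtain D where D: "left_dual C S D" using left_duals[OF reps_obs[OF S]] by blast
      have orth: "form S f (h \<cdot> q) = form S (f \<cdot> q) (h \<cdot> q)" if f: "f \<in> homset C x S" and h: "h \<in> homset C x S" for f h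
      proof -
        obtain g where g: "g \<in> homset C x (dobj D)" "h \<cdot> q = M' C B x Dx S D (g \<cdot> q)"
          using inv S D h by blast
        have gq: "g \<cdot> q \<in> homset C x (dobj D)" using compo_closed[OF qh g(1)] .
        have fq: "f \<cdot> q \<in> homset C x S" using compo_closed[OF qh f] .
        have "form S f (h \<cdot> q) = kappa' C Dx D f (g \<cdot> q)"
          unfolding g(2) by (rule M'_props(2)[OF S D gq f])
        also have "\<dots> = kappa' C Dx D (f \<cdot> q) g" by (rule kappa_adjoint[OF qh sym f g(1), symmetric])
        also have "\<dots> = kappa' C Dx D ((f \<cdot> q) \<cdot> q) g" using compo_assoc[OF qh qh f] qq by simp
        also have "\<dots> = kappa' C Dx D (f \<cdot> q) (g \<cdot> q)" by (rule kappa_adjoint[OF qh sym fq g(1)])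
        also have "\<dots> = form S (f \<cdot> q) (h \<cdot> q)"
          unfolding g(2) by (rule M'_props(2)[OF S D gq fq, symmetric])
        finally show ?thesis .
      qed
      have fq: "f \<cdot> q \<in> homset C x S" and hq: "h \<cdot> q \<in> homset C x S"
        using compo_closed[OF qh] f h by auto
      have "form S (f \<cdot> q) h = cnj (form S h (f \<cdot> q))" using V.herm_cnj fq h by simp
      also have "\<dots> = cnj (form S (h \<cdot> q) (f \<cdot> q))" by (simp add: orth[OF h f])
      also have "\<dots> = form S (f \<cdot> q) (h \<cdot> q)" using V.herm_cnj fq hq by simp
      finally show "form S (f \<cdot> q) h = form S f (h \<cdot> q)" by (simp add: orth[OF f h])
    qed
  next
    assume sa: "selfadjoint q"
    show "\<forall>S\<in>R. \<forall>D. left_dual C S D \<longrightarrow>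
        M' C B x Dx S D ` ((\<lambda>g. g \<cdot> q) ` homset C x (dobj D)) = (\<lambda>f. f \<cdot> q) ` homset C x S"
    proof (intro ballI allI impI)
      fix S D assume S: "S \<in> R" and D: "left_dual C S D"
      have Mq: "M' C B x Dx S D (g \<cdot> q) = M' C B x Dx S D g \<cdot> q" if g: "g \<in> homset C x (dobj D)" for g
      proof (rule M'_eqI[OF S D])
        note M = M'_props[OF S D g]
        show "g \<cdot> q \<in> homset C x (dobj D)" by (rule compo_closed[OF qh g])
        show "M' C B x Dx S D g \<cdot> q \<in> homset C x S" by (rule compo_closed[OF qh M(1)])
        fix f assume f: "f \<in> homset C x S"
        have "form S f (M' C B x Dx S D g \<cdot> q) = form S (f \<cdot> q) (M' C B x Dx S D g)"
          by (rule selfadjointD[OF sa S f M(1), symmetric])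
        also have "\<dots> = kappa' C Dx D (f \<cdot> q) g" by (rule M(2)[OF compo_closed[OF qh f]])
        also have "\<dots> = kappa' C Dx D f (g \<cdot> q)" by (rule kappa_adjoint[OF qh sym f g])
        finally show "form S f (M' C B x Dx S D g \<cdot> q) = kappa' C Dx D f (g \<cdot> q)" .
      qed
      have im: "M' C B x Dx S D ` homset C x (dobj D) = homset C x S"
        using M'_props(1)[OF S D] M'_surj[OF S D] by blast
      have "M' C B x Dx S D ` ((\<lambda>g. g \<cdot> q) ` homset C x (dobj D))
          = (\<lambda>f. f \<cdot> q) ` (M' C B x Dx S D ` homset C x (dobj D))"
        using Mq by (simp add: image_image)
      then show "M' C B x Dx S D ` ((\<lambda>g. g \<cdot> q) ` homset C x (dobj D)) = (\<lambda>f. f \<cdot> q) ` homset C x S"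
        unfolding im .
    qed
  qed
  finally show ?thesis unfolding sq .
qed

end

section \<open>Selfadjoint endomorphisms and kernel projections\<close>

context frobenius_with_basis
begin

text \<open>Taking adjoints on both sides of \<open>a \<cdot> b = c\<close>.\<close>
lemma selfadjoint_commute:
  assumes a: "a \<in> homset C x x" "selfadjoint a" and b: "b \<in> homset C x x" "selfadjoint b"
    and c: "c \<in> homset C x x" "selfadjoint c" and ab: "a \<cdot> b = c"
  shows "b \<cdot> a = c"
proof (rule hom_simple_faithful[OF reps compo_closed[OF a(1) b(1)] c(1)])
  fix S f assume S: "S \<in> R" and f: "f \<in> homset C x S"
  interpret V: fin_dim_basis "hom_space C x S" "B S" by (rule hom_basis[OF S])
  have f': "f \<cdot> b \<in> homset C x S" "f \<cdot> c \<in> homset C x S" "f \<cdot> b \<cdot> a \<in> homset C x S"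
    using f a b c by (auto simp: in_hom_iff)
  show "f \<cdot> b \<cdot> a = f \<cdot> c"
  proof (rule V.herm_eqI)
    fix u assume "u \<in> carrier (hom_space C x S)"
    then have u: "u \<in> homset C x S" by simp
    then have u': "u \<cdot> a \<in> homset C x S" using compo_closed[OF a(1)] by blast
    have "form S u (f \<cdot> b \<cdot> a) = form S u ((f \<cdot> b) \<cdot> a)" using f a b by (simp add: in_hom_iff)
    also have "\<dots> = form S (u \<cdot> a) (f \<cdot> b)" by (rule selfadjointD[OF a(2) S u f'(1), symmetric])
    also have "\<dots> = form S ((u \<cdot> a) \<cdot> b) f" by (rule selfadjointD[OF b(2) S u' f, symmetric])
    also have "(u \<cdot> a) \<cdot> b = u \<cdot> c" using u a b by (simp add: in_hom_iff ab)
    also have "form S (u \<cdot> c) f = form S u (f \<cdot> c)" by (rule selfadjointD[OF c(2) S u f])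
    finally show "form S u (f \<cdot> b \<cdot> a) = form S u (f \<cdot> c)" .
  qed (use f' in \<open>simp_all only: hom_space_simps\<close>)
qed

lemma selfadjoint_iden: "selfadjoint (iden C x)"
  unfolding selfadjoint_def using iden_right by simp

definition one_minus where "one_minus a = hadd C (iden C x) (hscale C (-1) a)"

lemma one_minus_hom: "a \<in> homset C x x \<Longrightarrow> one_minus a \<in> homset C x x"
  unfolding one_minus_def using hadd_hom hscale_hom iden_closed[OF x_obs] by blast

lemma compo_one_minus:
  "\<lbrakk>a \<in> homset C x x; f \<in> homset C x y\<rbrakk> \<Longrightarrow> f \<cdot> one_minus a = hadd C f (hscale C (-1) (f \<cdot> a))"
  unfolding one_minus_def by (simp add: in_hom_iff compo_linear)

lemma one_minus_compo:
  "\<lbrakk>a \<in> homset C x x; f \<in> homset C y x\<rbrakk> \<Longrightarrow> one_minus a \<cdot> f = hadd C f (hscale C (-1) (a \<cdot> f))"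
  unfolding one_minus_def by (auto simp: in_hom_iff compo_linear)

lemma selfadjoint_add:
  assumes a: "a \<in> homset C x x" "selfadjoint a" and b: "b \<in> homset C x x" "selfadjoint b"
  shows "selfadjoint (hadd C a b)"
  unfolding selfadjoint_def
proof (intro ballI)
  fix S f h assume S: "S \<in> R" and f: "f \<in> homset C x S" and h: "h \<in> homset C x S"
  interpret V: fin_dim_basis "hom_space C x S" "B S" by (rule hom_basis[OF S])
  show "form S (f \<cdot> hadd C a b) h = form S f (h \<cdot> hadd C a b)"
    using V.herm_add_left[of "f \<cdot> a" "f \<cdot> b" h] V.herm_add_right[of f "h \<cdot> a" "h \<cdot> b"]
      selfadjointD[OF a(2) S f h] selfadjointD[OF b(2) S f h]
      compo_add_right[OF a(1) b(1) f] compo_add_right[OF a(1) b(1) h]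
      compo_closed[OF a(1) f] compo_closed[OF b(1) f] compo_closed[OF a(1) h] compo_closed[OF b(1) h] f h
    by simp
qed

lemma selfadjoint_one_minus:
  assumes a: "a \<in> homset C x x" "selfadjoint a"
  shows "selfadjoint (one_minus a)"
  unfolding one_minus_def
proof (rule selfadjoint_add)
  show "selfadjoint (hscale C (-1) a)"
    unfolding selfadjoint_def
  proof (intro ballI)
    fix S f h assume S: "S \<in> R" and f: "f \<in> homset C x S" and h: "h \<in> homset C x S"
    interpret V: fin_dim_basis "hom_space C x S" "B S" by (rule hom_basis[OF S])
    show "form S (f \<cdot> hscale C (-1) a) h = form S f (h \<cdot> hscale C (-1) a)"
      using V.herm_scale_left[of "f \<cdot> a" "-1" h] V.herm_scale_right[of f "h \<cdot> a" "-1"]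
        selfadjointD[OF a(2) S f h] compo_scale_right[OF a(1) f] compo_scale_right[OF a(1) h]
        compo_closed[OF a(1) f] compo_closed[OF a(1) h] f h
      by simp
  qed
qed (use a hscale_hom iden_closed[OF x_obs] selfadjoint_iden in auto)

text \<open>\<open>g \<cdot> (1 - a)\<close> is orthogonal to \<open>g \<cdot> a\<close>.\<close>
lemma form_one_minus:
  assumes a: "a \<in> homset C x x" "selfadjoint a" "a \<cdot> a = a" and S: "S \<in> R" and g: "g \<in> homset C x S"
  shows "form S (g \<cdot> one_minus a) g = form S (g \<cdot> one_minus a) (g \<cdot> one_minus a)"
proof -
  interpret V: fin_dim_basis "hom_space C x S" "B S" by (rule hom_basis[OF S])
  let ?d = "g \<cdot> one_minus a"
  have d: "?d \<in> homset C x S" by (rule compo_closed[OF one_minus_hom[OF a(1)] g])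
  have ga: "g \<cdot> a \<in> homset C x S" by (rule compo_closed[OF a(1) g])
  have "one_minus a \<cdot> a = hzero C x x"
    using one_minus_compo[OF a(1) a(1)] hdiff_self[OF a(1)] a(3) by simp
  then have "?d \<cdot> a = hzero C x S"
    using compo_assoc[OF a(1) one_minus_hom[OF a(1)] g] compo_hzero_right[OF g x_obs] by simp
  then have "form S ?d (g \<cdot> a) = 0"
    using selfadjointD[OF a(2) S d g] V.herm_zero_left[of g] by simp
  moreover have "form S ?d ?d = form S ?d g + cnj (-1) * form S ?d (g \<cdot> a)"
    using V.herm_add_right[of ?d g "hscale C (-1) (g \<cdot> a)"] V.herm_scale_right[of ?d "g \<cdot> a" "-1"]
      compo_one_minus[OF a(1) g] d ga g hscale_hom[OF ga] by simp
  ultimately show ?thesis by simp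
qed

text \<open>For \<open>g = f \<cdot> z\<close>, the value of \<open>N = (1 - a) + (1 - b)\<close> at \<open>(g, g)\<close> is the sum of the squared norms of
  \<open>g \<cdot> (1 - a)\<close> and \<open>g \<cdot> (1 - b)\<close>, so both vanish if \<open>g \<cdot> N = 0\<close>.\<close>
lemma kernel_of_complement_sum:
  assumes a: "a \<in> homset C x x" "selfadjoint a" "a \<cdot> a = a"
    and b: "b \<in> homset C x x" "selfadjoint b" "b \<cdot> b = b"
    and z: "z \<in> homset C x x" "z \<cdot> hadd C (one_minus a) (one_minus b) = hzero C x x"
  shows "z \<cdot> a = z"
proof (rule hom_simple_faithful[OF reps compo_closed[OF a(1) z(1)] z(1)])
  fix S f assume S: "S \<in> R" and f: "f \<in> homset C x S"
  interpret V: fin_dim_basis "hom_space C x S" "B S" by (rule hom_basis[OF S])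
  let ?g = "f \<cdot> z"
  have g: "?g \<in> homset C x S" by (rule compo_closed[OF z(1) f])
  note ca = one_minus_hom[OF a(1)] and cb = one_minus_hom[OF b(1)]
  have da: "?g \<cdot> one_minus a \<in> homset C x S" and db: "?g \<cdot> one_minus b \<in> homset C x S"
    using compo_closed[OF ca g] compo_closed[OF cb g] .
  have "hadd C (?g \<cdot> one_minus a) (?g \<cdot> one_minus b) = f \<cdot> z \<cdot> hadd C (one_minus a) (one_minus b)"
    using compo_add_right[OF ca cb g] compo_assoc[OF hadd_hom[OF ca cb] z(1) f] by simp
  also have "\<dots> = hzero C x S" unfolding z(2) by (rule compo_hzero_right[OF f x_obs])
  finally have "form S (?g \<cdot> one_minus a) ?g + form S (?g \<cdot> one_minus b) ?g = 0"
    using V.herm_add_left[of "?g \<cdot> one_minus a" "?g \<cdot> one_minus b" ?g] V.herm_zero_left[of ?g] da db by simp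
  then have "form S (?g \<cdot> one_minus a) (?g \<cdot> one_minus a) + form S (?g \<cdot> one_minus b) (?g \<cdot> one_minus b) = 0"
    unfolding form_one_minus[OF a S g] form_one_minus[OF b S g] .
  then have "Re (form S (?g \<cdot> one_minus a) (?g \<cdot> one_minus a)) + Re (form S (?g \<cdot> one_minus b) (?g \<cdot> one_minus b)) = 0"
    by (simp flip: plus_complex.sel(1))
  then have "Re (form S (?g \<cdot> one_minus a) (?g \<cdot> one_minus a)) = 0"
    using V.herm_nonneg[of "?g \<cdot> one_minus a"] V.herm_nonneg[of "?g \<cdot> one_minus b"] da db by simp
  then have "?g \<cdot> one_minus a = hzero C x S" using V.herm_definite[of "?g \<cdot> one_minus a"] da by simp
  then have "?g = ?g \<cdot> a"
    using hdiff_eq_zero[OF g compo_closed[OF a(1) g]] compo_one_minus[OF a(1) g] by simp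
  then show "f \<cdot> z \<cdot> a = f \<cdot> z" using compo_assoc[OF a(1) z(1) f] by simp
qed

text \<open>The squared norm of \<open>g \<cdot> N\<close> is the form at \<open>g \<cdot> N \<cdot> N\<close> and \<open>g\<close>.\<close>
lemma selfadjoint_square_kernel:
  assumes N: "N \<in> homset C x x" "selfadjoint N"
    and z: "z \<in> homset C x x" "(z \<cdot> N) \<cdot> N = hzero C x x"
  shows "z \<cdot> N = hzero C x x"
proof (rule hom_simple_faithful[OF reps compo_closed[OF N(1) z(1)] hzero_hom[OF x_obs x_obs]])
  fix S f assume S: "S \<in> R" and f: "f \<in> homset C x S"
  interpret V: fin_dim_basis "hom_space C x S" "B S" by (rule hom_basis[OF S])
  let ?g = "f \<cdot> z"
  have g: "?g \<in> homset C x S" by (rule compo_closed[OF z(1) f])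
  have gN: "?g \<cdot> N \<in> homset C x S" by (rule compo_closed[OF N(1) g])
  have zN: "z \<cdot> N \<in> homset C x x" by (rule compo_closed[OF N(1) z(1)])
  have "(?g \<cdot> N) \<cdot> N = f \<cdot> (z \<cdot> N) \<cdot> N"
    using compo_assoc[OF N(1) z(1) f] compo_assoc[OF N(1) zN f] by simp
  also have "\<dots> = hzero C x S" unfolding z(2) by (rule compo_hzero_right[OF f x_obs])
  finally have "form S (?g \<cdot> N) (?g \<cdot> N) = 0"
    using selfadjointD[OF N(2) S gN g] V.herm_zero_left[of ?g] by simp
  then have "?g \<cdot> N = hzero C x S" using V.herm_definite[of "?g \<cdot> N"] gN by simp
  then show "f \<cdot> z \<cdot> N = f \<cdot> hzero C x x"
    using compo_assoc[OF N(1) z(1) f] compo_hzero_right[OF f x_obs] by simp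
qed

inductive_set polys for N where
  iden: "iden C x \<in> polys N"
| mult: "t \<in> polys N \<Longrightarrow> t \<cdot> N \<in> polys N"
| add: "\<lbrakk>t \<in> polys N; u \<in> polys N\<rbrakk> \<Longrightarrow> hadd C t u \<in> polys N"
| scale: "t \<in> polys N \<Longrightarrow> hscale C c t \<in> polys N"

lemma polys_commute:
  assumes N: "N \<in> homset C x x" and "t \<in> polys N"
  shows "t \<in> homset C x x \<and> t \<cdot> N = N \<cdot> t"
  using assms(2)
proof induction
  case iden
  then show ?case using N by (simp add: in_hom_iff)
next
  case (mult t)
  then have "(t \<cdot> N) \<cdot> N = N \<cdot> t \<cdot> N" using N by (simp add: in_hom_iff)
  then show ?case using mult compo_closed[OF N] by blast
next
  case (add t u)
  then show ?case using N by (auto simp: in_hom_iff compo_linear)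
next
  case (scale t c)
  then show ?case using N by (auto simp: in_hom_iff compo_linear)
qed

text \<open>A product of commuting symmetric arrows is symmetric, and symmetry is linear. The coefficients may be
  arbitrary complex numbers here, whereas selfadjointness would only pass to real polynomials.\<close>
lemma polys_symmetric:
  assumes N: "N \<in> homset C x x" and sym: "(N \<otimes>\<^sub>a iden C x) \<cdot> dcoev Dx = (iden C x \<otimes>\<^sub>a N) \<cdot> dcoev Dx"
    and "t \<in> polys N"
  shows "(t \<otimes>\<^sub>a iden C x) \<cdot> dcoev Dx = (iden C x \<otimes>\<^sub>a t) \<cdot> dcoev Dx"
  using assms(3)
proof induction
  note X [simp] = left_dual_simps(6-8)[OF dual_x]
  have [simp]: "N \<in> arrs C" "src C N = x" "tgt C N = x" using N by (auto simp: in_hom_iff)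
  {
    case iden
    then show ?case by simp
  next
    case (mult t)
    then have [simp]: "t \<in> arrs C" "src C t = x" "tgt C t = x" and tN: "t \<cdot> N = N \<cdot> t"
      using polys_commute[OF N] by (auto simp: in_hom_iff)
    have "((t \<cdot> N) \<otimes>\<^sub>a iden C x) \<cdot> dcoev Dx = (t \<otimes>\<^sub>a iden C x) \<cdot> (N \<otimes>\<^sub>a iden C x) \<cdot> dcoev Dx"
      by (simp add: tarr_exchange_assoc)
    also have "\<dots> = (iden C x \<otimes>\<^sub>a N) \<cdot> (t \<otimes>\<^sub>a iden C x) \<cdot> dcoev Dx"
      unfolding sym by (simp add: tarr_exchange_assoc)
    also have "\<dots> = (iden C x \<otimes>\<^sub>a (t \<cdot> N)) \<cdot> dcoev Dx"
      unfolding mult.IH tN by (simp add: tarr_exchange_assoc)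
    finally show ?case .
  next
    case (add t u)
    then have h: "t \<in> homset C x x" "u \<in> homset C x x"
      using polys_commute[OF N] by auto
    then have [simp]: "t \<in> arrs C" "src C t = x" "tgt C t = x" "u \<in> arrs C" "src C u = x" "tgt C u = x"
      by (auto simp: in_hom_iff)
    show ?case
      using add.IH by (simp add: tarr_add_left[OF h] tarr_add_right[OF _ h] compo_hadd_left)
  next
    case (scale t c)
    then have [simp]: "t \<in> arrs C" "src C t = x" "tgt C t = x"
      using polys_commute[OF N] by (auto simp: in_hom_iff)
    show ?case
      using scale.IH by (simp add: tarr_scale_left tarr_scale_right compo_hscale_left)
  }
qed

text \<open>Finite dimension of \<open>End(X)\<close> makes some power \<open>N\<^sup>j\<close> a combination of higher powers, that is
  \<open>N\<^sup>j = t \<cdot> N\<^sup>j\<^sup>+\<^sup>1\<close>. Then \<open>1 - t \<cdot> N\<close> annihilates \<open>N\<^sup>j\<close>, and the exponent can be lowered to \<open>1\<close> because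
  \<open>N\<close> is selfadjoint.\<close>
lemma kernel_projection:
  assumes N: "N \<in> homset C x x" "selfadjoint N"
  shows "\<exists>t\<in>polys N. one_minus (t \<cdot> N) \<cdot> N = hzero C x x"
proof -
  interpret E: complex_module "hom_space C x x" by (rule complex_module_hom[OF x_obs x_obs])
  define pw where "pw = rec_nat (iden C x) (\<lambda>_ u. u \<cdot> N)"
  have pw [simp]: "pw 0 = iden C x" "\<And>n. pw (Suc n) = pw n \<cdot> N" by (simp_all add: pw_def)
  have pp: "pw n \<in> polys N" for n by (induction n) (auto intro: polys.intros)
  note ph = polys_commute[OF N(1) pp]
  have pa [simp]: "pw n \<in> arrs C" "src C (pw n) = x" "tgt C (pw n) = x" for n
    using ph[of n] by (auto simp: in_hom_iff)
  have Na [simp]: "N \<in> arrs C" "src C N = x" "tgt C N = x" using N by (auto simp: in_hom_iff)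
  have pw_add: "pw (m + n) = pw m \<cdot> pw n" for m n by (induction n) simp_all
  obtain j where j: "pw j \<in> E.cspan (pw ` {j<..})"
    using E.fin_dim_sequence[of pw] fin_dim_end ph by auto
  have "\<exists>t\<in>polys N. u = t \<cdot> pw (Suc j)" if "u \<in> E.cspan (pw ` {j<..})" for u
    using that
  proof induction
    case zero
    have "hscale C 0 (iden C x) = hzero C x x" by (rule hscale_zero) (simp add: in_hom_iff)
    moreover have "hzero C x x \<cdot> pw (Suc j) = hzero C x x"
      using ph by (intro compo_hzero_left[OF _ x_obs]) blast
    ultimately show ?case using polys.scale[OF polys.iden, of 0 N] by force
  next
    case (add_scale a v c)
    then obtain t k where t: "t \<in> polys N" "v = t \<cdot> pw (Suc j)" and k: "k > j" "a = pw k" by auto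
    have th: "t \<in> arrs C" "src C t = x" "tgt C t = x"
      using polys_commute[OF N(1) t(1)] by (auto simp: in_hom_iff)
    have "k = (k - Suc j) + Suc j" using k by simp
    then have "a = pw (k - Suc j) \<cdot> pw (Suc j)" using k(2) pw_add by metis
    then have "hadd C (hscale C c a) v = hadd C (hscale C c (pw (k - Suc j))) t \<cdot> pw (Suc j)"
      using th t(2) by (simp add: compo_linear del: pw)
    then show ?case using polys.add[OF polys.scale[OF pp] t(1)] by auto
  qed
  from this[OF j] obtain t where t: "t \<in> polys N" and pj: "pw j = t \<cdot> pw (Suc j)" by blast
  have th: "t \<in> homset C x x" and tN: "t \<cdot> N = N \<cdot> t" using polys_commute[OF N(1) t] by auto
  have ta [simp]: "t \<in> arrs C" "src C t = x" "tgt C t = x" using th by (auto simp: in_hom_iff)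
  let ?r = "one_minus (t \<cdot> N)"
  have tNh: "t \<cdot> N \<in> homset C x x" by (rule compo_closed[OF N(1) th])
  have rh: "?r \<in> homset C x x" by (rule one_minus_hom[OF tNh])
  then have ra [simp]: "?r \<in> arrs C" "src C ?r = x" "tgt C ?r = x" by (auto simp: in_hom_iff)
  have "(t \<cdot> N) \<cdot> pw j = pw j" using pj ph[of j] by simp
  then have rj: "?r \<cdot> pw j = hzero C x x"
    using one_minus_compo[OF tNh, of "pw j" x] hdiff_self[of "pw j"] ph[of j] by simp
  have "?r \<cdot> N = hzero C x x" if "?r \<cdot> pw n = hzero C x x" for n
    using that
  proof (induction n)
    case 0
    then have "?r = hzero C x x" by simp
    then show ?case using compo_hzero_left[OF N(1) x_obs] by metis
  next
    case (Suc n)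
    show ?case
    proof (cases n)
      case 0
      then show ?thesis using Suc.prems by simp
    next
      case n: (Suc m)
      have rm: "?r \<cdot> pw m \<in> homset C x x" by (rule compo_closed[OF _ rh]) (use ph in blast)
      have "((?r \<cdot> pw m) \<cdot> N) \<cdot> N = hzero C x x" using Suc.prems n by simp
      then have "(?r \<cdot> pw m) \<cdot> N = hzero C x x" by (rule selfadjoint_square_kernel[OF N rm])
      then show ?thesis using n Suc.IH by simp
    qed
  qed
  from this[OF rj] show ?thesis using t by blast
qed

section \<open>Meets and joins of the idempotents\<close>

text \<open>The idempotents \<open>i \<cdot> i\<^sup>*\<close> of the Frobenius \<open>B\<close>-subalgebras \<open>(A, i)\<close> of \<open>X\<close>.\<close>
definition basis_idem where
  "basis_idem q \<longleftrightarrow> subalgebra_idem X q \<and> selfadjoint q"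

lemma basis_idemD:
  assumes "basis_idem q"
  shows "q \<in> homset C x x" "q \<cdot> q = q" "selfadjoint q" "q \<cdot> funit X = funit X"
    "q \<cdot> fmul X \<cdot> (q \<otimes>\<^sub>a q) = fmul X \<cdot> (q \<otimes>\<^sub>a q)"
    "(q \<otimes>\<^sub>a iden C x) \<cdot> dcoev Dx = (iden C x \<otimes>\<^sub>a q) \<cdot> dcoev Dx"
  using assms by (auto simp: basis_idem_def subalgebra_idem_def)

lemma basis_idem_iden: "basis_idem (iden C x)"
  using selfadjoint_iden frobenius_simps[OF frob] left_dual_simps[OF dual_x]
  by (simp add: basis_idem_def subalgebra_idem_def in_hom_iff)

text \<open>The meet is the kernel projection \<open>q = 1 - t \<cdot> N\<close> of \<open>N = (1 - a) + (1 - b)\<close>. It fixes all arrows fixed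
  by \<open>a\<close> and \<open>b\<close>, in particular the unit and the product of two arrows in its image.\<close>
lemma basis_idem_meet:
  assumes a: "basis_idem a" and b: "basis_idem b"
  shows "\<exists>q. basis_idem q \<and> a \<cdot> q = q \<and> b \<cdot> q = q \<and>
    (\<forall>w. \<forall>u\<in>homset C w x. a \<cdot> u = u \<and> b \<cdot> u = u \<longrightarrow> q \<cdot> u = u)"
proof -
  note A = basis_idemD[OF a] and B' = basis_idemD[OF b]
  note Xs [simp] = frobenius_simps(1-10)[OF frob]
  note Ds [simp] = left_dual_simps(6-8)[OF dual_x]
  have [simp]: "a \<in> arrs C" "src C a = x" "tgt C a = x" "b \<in> arrs C" "src C b = x" "tgt C b = x"
    using A(1) B'(1) by (auto simp: in_hom_iff)
  have ih: "iden C x \<in> homset C x x" by (simp add: in_hom_iff)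
  define N where "N = hadd C (one_minus a) (one_minus b)"
  note ca = one_minus_hom[OF A(1)] and cb = one_minus_hom[OF B'(1)]
  have Nh: "N \<in> homset C x x" unfolding N_def by (rule hadd_hom[OF ca cb])
  have Nsa: "selfadjoint N" unfolding N_def
    using selfadjoint_add ca cb selfadjoint_one_minus A B' by blast
  have csym: "(one_minus d \<otimes>\<^sub>a iden C x) \<cdot> dcoev Dx = (iden C x \<otimes>\<^sub>a one_minus d) \<cdot> dcoev Dx"
    if d: "basis_idem d" for d
  proof -
    note D = basis_idemD[OF d]
    have da: "d \<in> arrs C" "src C d = x" "tgt C d = x" using D(1) by (auto simp: in_hom_iff)
    show ?thesis
      using da D(6) tarr_add_left[OF ih hscale_hom[OF D(1)], of "iden C x"]
        tarr_add_right[OF _ ih hscale_hom[OF D(1)], of "iden C x"]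
      by (simp add: one_minus_def tarr_scale_left tarr_scale_right compo_linear)
  qed
  have Nsym: "(N \<otimes>\<^sub>a iden C x) \<cdot> dcoev Dx = (iden C x \<otimes>\<^sub>a N) \<cdot> dcoev Dx"
    using tarr_add_left[OF ca cb, of "iden C x"] tarr_add_right[OF _ ca cb, of "iden C x"]
      csym[OF a] csym[OF b] ca cb
    by (simp add: N_def in_hom_iff compo_hadd_left)
  obtain t where t: "t \<in> polys N" and rN: "one_minus (t \<cdot> N) \<cdot> N = hzero C x x"
    using kernel_projection[OF Nh Nsa] by blast
  have th: "t \<in> homset C x x" and tN: "t \<cdot> N = N \<cdot> t" using polys_commute[OF Nh t] by auto
  have tNh: "t \<cdot> N \<in> homset C x x" by (rule compo_closed[OF Nh th])
  define q where "q = one_minus (t \<cdot> N)"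
  have qp: "q \<in> polys N" unfolding q_def one_minus_def by (intro polys.intros t)
  have qh: "q \<in> homset C x x" unfolding q_def by (rule one_minus_hom[OF tNh])
  have qa [simp]: "q \<in> arrs C" "src C q = x" "tgt C q = x" using qh by (auto simp: in_hom_iff)
  have qsym: "(q \<otimes>\<^sub>a iden C x) \<cdot> dcoev Dx = (iden C x \<otimes>\<^sub>a q) \<cdot> dcoev Dx"
    by (rule polys_symmetric[OF Nh Nsym qp])
  have qN: "q \<cdot> N = hzero C x x" unfolding q_def by (rule rN)
  have qtN: "q \<cdot> t \<cdot> N = hzero C x x"
    unfolding tN using compo_assoc[OF th Nh qh] qN compo_hzero_left[OF th x_obs] by simp
  have qq: "q \<cdot> q = q"
  proof -
    have "q \<cdot> q = hadd C q (hscale C (-1) (q \<cdot> t \<cdot> N))"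
      by (subst (2) q_def) (rule compo_one_minus[OF tNh qh])
    also have "\<dots> = q"
      using hadd_zero[OF qh] hscale_zero[OF hzero_hom[OF x_obs x_obs]]
        hscale_hscale[of "hzero C x x" "-1" 0] by (simp add: qtN)
    finally show ?thesis .
  qed
  have qsa: "selfadjoint q"
    unfolding selfadjoint_def
  proof (intro ballI)
    fix S f h assume S: "S \<in> R" and f: "f \<in> homset C x S" and h: "h \<in> homset C x S"
    interpret V: fin_dim_basis "hom_space C x S" "B S" by (rule hom_basis[OF S])
    \<comment> \<open>\<open>t\<close> need not be selfadjoint, so neither is \<open>t \<cdot> N\<close> at first sight; instead \<open>u \<cdot> q\<close> is orthogonal to
      \<open>v - v \<cdot> q = v \<cdot> t \<cdot> N\<close> because \<open>q \<cdot> N = 0\<close>.\<close>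
    have half: "form S (u \<cdot> q) v = form S (u \<cdot> q) (v \<cdot> q)" if u: "u \<in> homset C x S" and v: "v \<in> homset C x S" for u v
    proof -
      have uq: "u \<cdot> q \<in> homset C x S" and vq: "v \<cdot> q \<in> homset C x S"
        and vt: "v \<cdot> t \<in> homset C x S" and vtN: "v \<cdot> t \<cdot> N \<in> homset C x S"
        using compo_closed[OF qh u] compo_closed[OF qh v] compo_closed[OF th v] compo_closed[OF tNh v] .
      have "form S (u \<cdot> q) (v \<cdot> t \<cdot> N) = form S ((u \<cdot> q) \<cdot> N) (v \<cdot> t)"
        using selfadjointD[OF Nsa S uq vt] compo_assoc[OF Nh th v] by simp
      also have "(u \<cdot> q) \<cdot> N = hzero C x S"
        using compo_assoc[OF Nh qh u] qN compo_hzero_right[OF u x_obs] by simp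
      finally have z: "form S (u \<cdot> q) (v \<cdot> t \<cdot> N) = 0" using V.herm_zero_left by simp
      have "form S (u \<cdot> q) (v \<cdot> q) = form S (u \<cdot> q) v + cnj (-1) * form S (u \<cdot> q) (v \<cdot> t \<cdot> N)"
        using V.herm_add_right[of "u \<cdot> q" v "hscale C (-1) (v \<cdot> t \<cdot> N)"]
          V.herm_scale_right[of "u \<cdot> q" "v \<cdot> t \<cdot> N" "-1"] compo_one_minus[OF tNh v]
          uq v vtN hscale_hom[OF vtN] by (simp add: q_def)
      then show ?thesis by (simp add: z)
    qed
    have fq: "f \<cdot> q \<in> homset C x S" and hq: "h \<cdot> q \<in> homset C x S"
      using compo_closed[OF qh] f h by auto
    have "form S f (h \<cdot> q) = cnj (form S (h \<cdot> q) f)" using V.herm_cnj[of f "h \<cdot> q"] f hq by simp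
    also have "\<dots> = cnj (form S (h \<cdot> q) (f \<cdot> q))" by (simp add: half[OF h f])
    also have "\<dots> = form S (f \<cdot> q) (h \<cdot> q)" using V.herm_cnj[of "f \<cdot> q" "h \<cdot> q"] fq hq by simp
    finally show "form S (f \<cdot> q) h = form S f (h \<cdot> q)" by (simp add: half[OF f h])
  qed
  have "q \<cdot> a = q"
    by (rule kernel_of_complement_sum[OF A(1,3,2) B'(1,3,2) qh]) (use qN N_def in simp)
  then have aq: "a \<cdot> q = q" using selfadjoint_commute qh qsa A by blast
  have "q \<cdot> b = q"
  proof (rule kernel_of_complement_sum[OF B'(1,3,2) A(1,3,2) qh])
    interpret E: complex_module "hom_space C x x" by (rule complex_module_hom[OF x_obs x_obs])
    show "q \<cdot> hadd C (one_minus b) (one_minus a) = hzero C x x"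
      using E.a_comm[of "one_minus a" "one_minus b"] ca cb qN by (simp add: N_def)
  qed
  then have bq: "b \<cdot> q = q" using selfadjoint_commute qh qsa B' by blast
  have fix_q: "q \<cdot> u = u" if u: "u \<in> homset C w x" and au: "a \<cdot> u = u" and bu: "b \<cdot> u = u" for u w
  proof -
    have w: "w \<in> obs C" using hom_obs[OF u] by blast
    have z: "hadd C (hzero C w x) (hzero C w x) = hzero C w x"
      by (rule hadd_zero[OF hzero_hom[OF w x_obs]])
    have "N \<cdot> u = hzero C w x"
      unfolding N_def using compo_add_left[OF u ca cb] one_minus_compo[OF A(1) u] one_minus_compo[OF B'(1) u]
        au bu hdiff_self[OF u] z by simp
    then have "(t \<cdot> N) \<cdot> u = hzero C w x"
      using compo_assoc[OF u Nh th] compo_hzero_right[OF th w] by simp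
    then have "q \<cdot> u = hadd C u (hscale C (-1) (hscale C 0 u))"
      using one_minus_compo[OF tNh u] hscale_zero[OF u] by (simp add: q_def)
    also have "\<dots> = hadd C u (hscale C 0 u)" using u by (subst hscale_hscale) (auto simp: in_hom_iff)
    also have "\<dots> = u" using hadd_zero[OF u] hscale_zero[OF u] by simp
    finally show ?thesis .
  qed
  have qe: "q \<cdot> funit X = funit X"
    by (rule fix_q[of _ "tunit C"]) (use A B' in \<open>simp_all add: in_hom_iff\<close>)
  have clos: "d \<cdot> fmul X \<cdot> (q \<otimes>\<^sub>a q) = fmul X \<cdot> (q \<otimes>\<^sub>a q)" if d: "basis_idem d" and dq: "d \<cdot> q = q" for d
  proof -
    note D = basis_idemD[OF d]
    have [simp]: "d \<in> arrs C" "src C d = x" "tgt C d = x" using D(1) by (auto simp: in_hom_iff)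
    have e: "fmul X \<cdot> (q \<otimes>\<^sub>a q) = (fmul X \<cdot> (d \<otimes>\<^sub>a d)) \<cdot> (q \<otimes>\<^sub>a q)"
      by (simp add: tarr_exchange dq)
    let ?s = "fmul X \<cdot> (d \<otimes>\<^sub>a d) \<cdot> (q \<otimes>\<^sub>a q)"
    have "fmul X \<cdot> (q \<otimes>\<^sub>a q) = (d \<cdot> fmul X \<cdot> (d \<otimes>\<^sub>a d)) \<cdot> (q \<otimes>\<^sub>a q)"
      unfolding D(5) by (rule e)
    then have es: "fmul X \<cdot> (q \<otimes>\<^sub>a q) = d \<cdot> ?s" by simp
    have "d \<cdot> d \<cdot> ?s = d \<cdot> ?s" by (rule compo_eq_assoc[OF D(2)]) simp_all
    then show ?thesis unfolding es .
  qed
  \<comment> \<open>by (rule fix_q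
    Products in the image of \<open>q\<close> are fixed by \<open>a\<close> and by \<open>b\<close>, hence by \<open>q\<close>.\<close>
  have qm: "q \<cdot> fmul X \<cdot> (q \<otimes>\<^sub>a q) = fmul X \<cdot> (q \<otimes>\<^sub>a q)"
    by (rule fix_q[of _ "x \<otimes>\<^sub>o x"]) (simp_all add: in_hom_iff clos[OF a aq] clos[OF b bq])
  have "basis_idem q"
    using qh qq qe qm qsym qsa by (simp add: basis_idem_def subalgebra_idem_def)
  then show ?thesis using aq bq fix_q by blast
qed

definition idem_le where "idem_le a b \<longleftrightarrow> a \<cdot> b = a \<and> a = b \<cdot> a"

lemma idem_leI:
  assumes "basis_idem a" "basis_idem b" "b \<cdot> a = a"
  shows "idem_le a b"
proof -
  note A = basis_idemD(1,3)[OF assms(1)] and B' = basis_idemD(1,3)[OF assms(2)]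
  have "a \<cdot> b = a" by (rule selfadjoint_commute[OF B' A A assms(3)])
  then show ?thesis using assms(3) by (simp add: idem_le_def)
qed

lemma idem_le_refl: "basis_idem a \<Longrightarrow> idem_le a a"
  unfolding idem_le_def using basis_idemD(2)[of a] by simp

lemma idem_le_antisym:
  assumes "idem_le a b" "idem_le b a"
  shows "a = b"
proof -
  have "a = b \<cdot> a" using assms(1) unfolding idem_le_def by blast
  also have "\<dots> = b" using assms(2) unfolding idem_le_def by blast
  finally show ?thesis .
qed

lemma idem_le_trans:
  assumes a: "basis_idem a" and b: "basis_idem b" and c: "basis_idem c"
    and ab: "idem_le a b" and bc: "idem_le b c"
  shows "idem_le a c"
proof (rule idem_leI[OF a c])
  note h = basis_idemD(1)[OF a] basis_idemD(1)[OF b] basis_idemD(1)[OF c]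
  have ba: "b \<cdot> a = a" and cb: "c \<cdot> b = b" using ab bc unfolding idem_le_def by metis+
  have "c \<cdot> a = c \<cdot> b \<cdot> a" unfolding ba ..
  also have "\<dots> = (c \<cdot> b) \<cdot> a" by (rule compo_assoc[OF h, symmetric])
  also have "\<dots> = a" unfolding cb by (rule ba)
  finally show "c \<cdot> a = a" .
qed

text \<open>In an infinite strictly decreasing sequence \<open>s\<close>, the idempotent \<open>s (Suc j)\<close> acts as the identity on all
  later terms and therefore on their span; so no \<open>s j\<close> lies in the span of later terms, contrary to
  finite dimensionality.\<close>
lemma minimal_idem:
  assumes U: "\<And>u. u \<in> U \<Longrightarrow> basis_idem u" and ne: "U \<noteq> {}"
  shows "\<exists>z\<in>U. \<forall>u\<in>U. idem_le u z \<longrightarrow> u = z"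
proof (rule ccontr)
  assume "\<not> ?thesis"
  then have step: "\<forall>z. z \<in> U \<longrightarrow> (\<exists>u. u \<in> U \<and> idem_le u z \<and> u \<noteq> z)" by blast
  obtain z0 where z0: "z0 \<in> U" using ne by blast
  obtain d where d: "\<And>z. z \<in> U \<Longrightarrow> d z \<in> U \<and> idem_le (d z) z \<and> d z \<noteq> z" using step by metis
  define s where "s n = (d ^^ n) z0" for n
  have sU: "s n \<in> U" for n by (induction n) (auto simp: s_def z0 d)
  have s: "idem_le (s (Suc n)) (s n)" "s (Suc n) \<noteq> s n" for n
    using d[OF sU[of n]] by (auto simp: s_def)
  have mono: "idem_le (s (n + k)) (s n)" for n k
  proof (induction k)
    case 0
    then show ?case using idem_le_refl[OF U[OF sU]] by simp
  next
    case (Suc k)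
    show ?case using idem_le_trans[OF U[OF sU] U[OF sU] U[OF sU] s(1)[of "n + k"] Suc] by simp
  qed
  interpret E: complex_module "hom_space C x x" by (rule complex_module_hom[OF x_obs x_obs])
  have sh: "s n \<in> homset C x x" for n using basis_idemD(1)[OF U[OF sU]] .
  then obtain j where j: "s j \<in> E.cspan (s ` {j<..})"
    using E.fin_dim_sequence[of s] fin_dim_end by auto
  have "v \<in> homset C x x \<and> s (Suc j) \<cdot> v = v" if "v \<in> E.cspan (s ` {j<..})" for v
    using that
  proof induction
    case zero
    show ?case using compo_hzero_right[OF sh x_obs] hzero_hom by simp
  next
    case (add_scale a v c)
    then obtain k where k: "k > j" "a = s k" by auto
    then have "idem_le a (s (Suc j))" using mono[of "Suc j" "k - Suc j"] by simp
    then have a: "a \<in> homset C x x" "s (Suc j) \<cdot> a = a"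
      using sh k(2) by (simp_all add: idem_le_def)
    note ca = hscale_hom[OF a(1), of c]
    have "s (Suc j) \<cdot> hadd C (hscale C c a) v = hadd C (hscale C c a) v"
      using compo_add_right[OF ca _ sh] compo_scale_right[OF a(1) sh] a add_scale.IH by simp
    then show ?case using hadd_hom[OF ca] add_scale.IH by simp
  qed
  from this[OF j] have "s (Suc j) \<cdot> s j = s j" by blast
  moreover have "s (Suc j) \<cdot> s j = s (Suc j)" using s(1)[of j] by (simp add: idem_le_def)
  ultimately show False using s(2)[of j] by simp
qed

text \<open>A minimal upper bound is below every upper bound, as its meet with the latter is again an upper bound.\<close>
lemma basis_idem_join:
  assumes a: "basis_idem a" and b: "basis_idem b"
  shows "\<exists>z. basis_idem z \<and> idem_le a z \<and> idem_le b z \<and>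
    (\<forall>u. basis_idem u \<and> idem_le a u \<and> idem_le b u \<longrightarrow> idem_le z u)"
proof -
  define U where "U = {u. basis_idem u \<and> idem_le a u \<and> idem_le b u}"
  have "idem_le d (iden C x)" if "basis_idem d" for d
    by (rule idem_leI[OF that basis_idem_iden iden_left[OF basis_idemD(1)[OF that]]])
  then have "iden C x \<in> U"
    using basis_idem_iden a b unfolding U_def by blast
  then obtain z where z: "z \<in> U" and min: "\<And>u. \<lbrakk>u \<in> U; idem_le u z\<rbrakk> \<Longrightarrow> u = z"
    using minimal_idem[of U] unfolding U_def by blast
  have "idem_le z u" if u: "basis_idem u" "idem_le a u" "idem_le b u" for u
  proof -
    have zb: "basis_idem z" using z by (simp add: U_def)
    obtain q where q: "basis_idem q" "z \<cdot> q = q" "u \<cdot> q = q"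
      and fq: "\<And>w v. \<lbrakk>v \<in> homset C w x; z \<cdot> v = v; u \<cdot> v = v\<rbrakk> \<Longrightarrow> q \<cdot> v = v"
      using basis_idem_meet[OF zb u(1)] by blast
    have le: "idem_le d q" if d: "basis_idem d" "idem_le d z" "idem_le d u" for d
    proof (rule idem_leI[OF d(1) q(1)])
      have "z \<cdot> d = d" "u \<cdot> d = d" using d(2,3) unfolding idem_le_def by metis+
      then show "q \<cdot> d = d" by (rule fq[OF basis_idemD(1)[OF d(1)]])
    qed
    have "q \<in> U" using le[OF a] le[OF b] q(1) z u by (simp add: U_def)
    then have "q = z" using min idem_leI[OF q(1) zb q(2)] by blast
    then show ?thesis using idem_leI[OF q(1) u(1) q(3)] by simp
  qed
  then show ?thesis using z unfolding U_def by blast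
qed

end

section \<open>The lattice of classes\<close>

lemma partial_orderI:
  fixes L (structure)
  assumes eq: "eq L = (=)"
    and refl: "\<And>x. x \<in> carrier L \<Longrightarrow> x \<sqsubseteq> x"
    and antisym: "\<And>x y. \<lbrakk>x \<sqsubseteq> y; y \<sqsubseteq> x; x \<in> carrier L; y \<in> carrier L\<rbrakk> \<Longrightarrow> x = y"
    and trans: "\<And>x y z. \<lbrakk>x \<sqsubseteq> y; y \<sqsubseteq> z; x \<in> carrier L; y \<in> carrier L; z \<in> carrier L\<rbrakk> \<Longrightarrow> x \<sqsubseteq> z"
  shows "partial_order L"
  apply unfold_locales
  unfolding eq
  apply (simp_all only: refl)
  apply (erule (3) antisym)
  apply (erule (4) trans)
  done

lemma Upper_pair:
  "\<lbrakk>P \<in> carrier L; Q \<in> carrier L\<rbrakk> \<Longrightarrow> u \<in> Upper L {P, Q} \<longleftrightarrow> u \<in> carrier L \<and> P \<sqsubseteq>\<^bsub>L\<^esub> u \<and> Q \<sqsubseteq>\<^bsub>L\<^esub> u"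
  by (auto simp: Upper_def)

lemma Lower_pair:
  "\<lbrakk>P \<in> carrier L; Q \<in> carrier L\<rbrakk> \<Longrightarrow> u \<in> Lower L {P, Q} \<longleftrightarrow> u \<in> carrier L \<and> u \<sqsubseteq>\<^bsub>L\<^esub> P \<and> u \<sqsubseteq>\<^bsub>L\<^esub> Q"
  by (auto simp: Lower_def)

context frobenius_with_basis
begin

lemma basis_subalgebra_idem:
  assumes "frobenius_basis_subalgebra C X R B p"
  shows "basis_idem (sub_idem C X p)" "frobenius_subalgebra C X p"
proof -
  obtain A i where p: "p = (A, i)" by (cases p)
  have sub: "frobenius_subalgebra C X (A, i)"
    using assms by (simp add: p frobenius_basis_subalgebra_def)
  then show "frobenius_subalgebra C X p" by (simp add: p)
  show "basis_idem (sub_idem C X p)"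
    unfolding p using rigid_iff_selfadjoint[OF sub] idem_of_subalgebra[OF frob sub] assms
    by (simp add: basis_idem_def p)
qed

lemma basis_subalgebra_of_idem:
  assumes q: "basis_idem q" and k: "k \<in> homset C a x" and h: "h \<in> homset C x a"
    and hk: "h \<cdot> k = iden C a" and kh: "k \<cdot> h = q"
  shows "\<exists>K. fobj K = a \<and> frobenius_basis_subalgebra C X R B (K, k) \<and> sub_idem C X (K, k) = q"
proof -
  obtain K where K: "fobj K = a" "frobenius_subalgebra C X (K, k)" "frob_dual_arr C K X k = h"
    using subalgebra_of_idem[OF frob _ k h hk kh] q by (auto simp: basis_idem_def)
  then have "sub_idem C X (K, k) = q" by (simp add: sub_idem_def kh)
  then show ?thesis using K rigid_iff_selfadjoint[OF K(2)] q by (auto simp: basis_idem_def)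
qed

lemma split_by_mono:
  assumes "is_mono C k" and k: "k \<in> homset C a x" and h: "h \<in> homset C x a"
    and "k \<cdot> h \<cdot> k = k"
  shows "h \<cdot> k = iden C a"
  using assms compo_closed[OF k h] iden_closed[of a] hom_obs[OF k] iden_right[OF k]
  by (auto simp: is_mono_def in_hom_iff)

text \<open>The kernel of \<open>1 - q\<close> is the image of \<open>q\<close>.\<close>
lemma idem_splits:
  assumes q: "q \<in> homset C x x" "q \<cdot> q = q"
  shows "\<exists>a k h. k \<in> homset C a x \<and> h \<in> homset C x a \<and> h \<cdot> k = iden C a \<and> k \<cdot> h = q"
proof -
  note cq = one_minus_hom[OF q(1)]
  obtain k where "is_kernel C (one_minus q) k" using kernels[of "one_minus q"] cq by (auto simp: in_hom_iff)
  then have k: "k \<in> homset C (src C k) x" and z: "one_minus q \<cdot> k = hzero C (src C k) x"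
    and univ: "\<And>w h. \<lbrakk>h \<in> homset C w x; one_minus q \<cdot> h = hzero C w x\<rbrakk>
      \<Longrightarrow> \<exists>!u. u \<in> homset C w (src C k) \<and> k \<cdot> u = h"
    using cq by (auto simp: is_kernel_def in_hom_iff)
  have mono: "is_mono C k" unfolding is_mono_def
  proof (intro conjI allI ballI impI)
    show "k \<in> arrs C" using k by (simp add: in_hom_iff)
    fix w g h assume g: "g \<in> homset C w (src C k)" and h: "h \<in> homset C w (src C k)" and eq: "k \<cdot> g = k \<cdot> h"
    have "one_minus q \<cdot> k \<cdot> g = hzero C w x"
      using compo_assoc[OF g k cq] compo_hzero_left[OF g x_obs] z by simp
    from univ[OF compo_closed[OF g k] this] show "g = h" using g h eq by auto
  qed
  have "one_minus q \<cdot> q = hzero C x x" using one_minus_compo[OF q(1) q(1)] q(2) hdiff_self[OF q(1)] by simp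
  then obtain h where h: "h \<in> homset C x (src C k)" "k \<cdot> h = q" using univ[OF q(1)] by blast
  have qk: "k = q \<cdot> k"
    using hdiff_eq_zero[OF k compo_closed[OF k q(1)]] one_minus_compo[OF q(1) k] z by simp
  have "k \<cdot> h \<cdot> k = k" using compo_assoc[OF k h(1) k] h(2) qk by simp
  then show ?thesis using split_by_mono[OF mono k h(1)] k h by blast
qed

lemma basis_subalgebra_exists:
  assumes q: "basis_idem q"
  shows "\<exists>p. frobenius_basis_subalgebra C X R B p \<and> sub_idem C X p = q"
  using idem_splits[OF basis_idemD(1,2)[OF q]] basis_subalgebra_of_idem[OF q] by blast

abbreviation "L \<equiv> frobenius_basis_subalgebra_poset C X R B"

lemma carrier_L: "carrier L = {sub_class C X p | p. frobenius_basis_subalgebra C X R B p}"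
  by (simp add: frobenius_basis_subalgebra_poset_def)

lemma eq_L: "eq L = (=)"
  by (simp add: frobenius_basis_subalgebra_poset_def frobenius_subalgebra_poset_def)

text \<open>The order on classes is decided by any representatives.\<close>
lemma le_L:
  assumes "frobenius_subalgebra C X p" "frobenius_subalgebra C X p'"
  shows "sub_class C X p \<sqsubseteq>\<^bsub>L\<^esub> sub_class C X p' \<longleftrightarrow> idem_le (sub_idem C X p) (sub_idem C X p')"
proof -
  have "sub_class C X p \<sqsubseteq>\<^bsub>L\<^esub> sub_class C X p' \<longleftrightarrow>
      (\<exists>q\<in>sub_class C X p. \<exists>q'\<in>sub_class C X p'. idem_le (sub_idem C X q) (sub_idem C X q'))"
    by (simp add: frobenius_basis_subalgebra_poset_def frobenius_subalgebra_poset_def idem_le_def)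
  moreover have "p \<in> sub_class C X p" "p' \<in> sub_class C X p'"
    using assms unfolding sub_class_def by blast+
  moreover have "sub_idem C X q = sub_idem C X r" if "q \<in> sub_class C X r" for q r
    using that unfolding sub_class_def by blast
  ultimately show ?thesis by metis
qed

lemma class_eq_iff:
  assumes "frobenius_subalgebra C X p" "frobenius_subalgebra C X p'"
  shows "sub_class C X p = sub_class C X p' \<longleftrightarrow> sub_idem C X p = sub_idem C X p'"
  using assms by (auto simp: sub_class_def)

lemma carrierE:
  assumes "P \<in> carrier L"
  obtains p where "P = sub_class C X p" "frobenius_basis_subalgebra C X R B p"
    "frobenius_subalgebra C X p" "basis_idem (sub_idem C X p)"
proof -
  obtain p where p: "P = sub_class C X p" "frobenius_basis_subalgebra C X R B p"
    using assms unfolding carrier_L by blast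
  show thesis by (rule that[OF p basis_subalgebra_idem(2)[OF p(2)] basis_subalgebra_idem(1)[OF p(2)]])
qed

lemma partial_order_L: "partial_order L"
proof (rule partial_orderI[OF eq_L])
  fix P assume "P \<in> carrier L"
  then obtain p where p: "P = sub_class C X p" "frobenius_subalgebra C X p" "basis_idem (sub_idem C X p)"
    by (rule carrierE)
  show "P \<sqsubseteq>\<^bsub>L\<^esub> P" unfolding p(1) le_L[OF p(2) p(2)] by (rule idem_le_refl[OF p(3)])
next
  fix P Q assume le: "P \<sqsubseteq>\<^bsub>L\<^esub> Q" "Q \<sqsubseteq>\<^bsub>L\<^esub> P" and P: "P \<in> carrier L" and Q: "Q \<in> carrier L"
  obtain p where p: "P = sub_class C X p" "frobenius_subalgebra C X p"
    using P by (rule carrierE)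
  obtain q where q: "Q = sub_class C X q" "frobenius_subalgebra C X q"
    using Q by (rule carrierE)
  show "P = Q"
    using le idem_le_antisym
    unfolding p(1) q(1) le_L[OF p(2) q(2)] le_L[OF q(2) p(2)] class_eq_iff[OF p(2) q(2)] by blast
next
  fix P Q T assume le: "P \<sqsubseteq>\<^bsub>L\<^esub> Q" "Q \<sqsubseteq>\<^bsub>L\<^esub> T"
    and P: "P \<in> carrier L" and Q: "Q \<in> carrier L" and T: "T \<in> carrier L"
  obtain p where p: "P = sub_class C X p" "frobenius_subalgebra C X p" "basis_idem (sub_idem C X p)"
    using P by (rule carrierE)
  obtain q where q: "Q = sub_class C X q" "frobenius_subalgebra C X q" "basis_idem (sub_idem C X q)"
    using Q by (rule carrierE)
  obtain t where t: "T = sub_class C X t" "frobenius_subalgebra C X t" "basis_idem (sub_idem C X t)"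
    using T by (rule carrierE)
  show "P \<sqsubseteq>\<^bsub>L\<^esub> T"
    using le idem_le_trans[OF p(3) q(3) t(3)]
    unfolding p(1) q(1) t(1) le_L[OF p(2) q(2)] le_L[OF q(2) t(2)] le_L[OF p(2) t(2)] by blast
qed

lemma greatest_lower:
  assumes p: "frobenius_basis_subalgebra C X R B p" and p': "frobenius_basis_subalgebra C X R B p'"
    and m: "frobenius_basis_subalgebra C X R B m"
    and le: "sub_idem C X p \<cdot> sub_idem C X m = sub_idem C X m"
      "sub_idem C X p' \<cdot> sub_idem C X m = sub_idem C X m"
    and fixed: "\<And>u. \<lbrakk>u \<in> homset C x x; sub_idem C X p \<cdot> u = u; sub_idem C X p' \<cdot> u = u\<rbrakk>
      \<Longrightarrow> sub_idem C X m \<cdot> u = u"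
  shows "greatest L (sub_class C X m) (Lower L {sub_class C X p, sub_class C X p'})"
  unfolding greatest_def
proof (intro conjI ballI)
  note bp = basis_subalgebra_idem[OF p] and bp' = basis_subalgebra_idem[OF p']
    and bm = basis_subalgebra_idem[OF m]
  show "Lower L {sub_class C X p, sub_class C X p'} \<subseteq> carrier L" by (simp add: Lower_def)
  have c: "sub_class C X p \<in> carrier L" "sub_class C X p' \<in> carrier L" "sub_class C X m \<in> carrier L"
    using p p' m unfolding carrier_L by blast+
  show "sub_class C X m \<in> Lower L {sub_class C X p, sub_class C X p'}"
    unfolding Lower_pair[OF c(1,2)] le_L[OF bm(2) bp(2)] le_L[OF bm(2) bp'(2)]
    using c(3) idem_leI[OF bm(1) bp(1) le(1)] idem_leI[OF bm(1) bp'(1) le(2)] by blast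
  fix T assume T: "T \<in> Lower L {sub_class C X p, sub_class C X p'}"
  then have "T \<in> carrier L" unfolding Lower_pair[OF c(1,2)] by blast
  then obtain t where t: "T = sub_class C X t" "frobenius_subalgebra C X t" "basis_idem (sub_idem C X t)"
    by (rule carrierE)
  have "idem_le (sub_idem C X t) (sub_idem C X p)" "idem_le (sub_idem C X t) (sub_idem C X p')"
    using T unfolding Lower_pair[OF c(1,2)] t(1) le_L[OF t(2) bp(2)] le_L[OF t(2) bp'(2)] by blast+
  then have "sub_idem C X p \<cdot> sub_idem C X t = sub_idem C X t"
    "sub_idem C X p' \<cdot> sub_idem C X t = sub_idem C X t"
    unfolding idem_le_def by metis+
  from fixed[OF basis_idemD(1)[OF t(3)] this] show "T \<sqsubseteq>\<^bsub>L\<^esub> sub_class C X m"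
    unfolding t(1) le_L[OF t(2) bm(2)] by (rule idem_leI[OF t(3) bm(1)])
qed

lemma lattice_L: "lattice L"
proof -
  interpret partial_order L by (rule partial_order_L)
  show ?thesis
  proof unfold_locales
    fix P Q assume P: "P \<in> carrier L" and Q: "Q \<in> carrier L"
    obtain p where p: "P = sub_class C X p" "frobenius_basis_subalgebra C X R B p"
      "frobenius_subalgebra C X p" "basis_idem (sub_idem C X p)" using P by (rule carrierE)
    obtain q where q: "Q = sub_class C X q" "frobenius_basis_subalgebra C X R B q"
      "frobenius_subalgebra C X q" "basis_idem (sub_idem C X q)" using Q by (rule carrierE)
    obtain z where z: "basis_idem z" "idem_le (sub_idem C X p) z" "idem_le (sub_idem C X q) z"
      and least: "\<And>u. \<lbrakk>basis_idem u; idem_le (sub_idem C X p) u; idem_le (sub_idem C X q) u\<rbrakk> \<Longrightarrow> idem_le z u"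
      using basis_idem_join[OF p(4) q(4)] by blast
    obtain s where s: "frobenius_basis_subalgebra C X R B s" "sub_idem C X s = z"
      using basis_subalgebra_exists[OF z(1)] by blast
    note bs = basis_subalgebra_idem(2)[OF s(1)]
    have "least L (sub_class C X s) (Upper L {P, Q})"
      unfolding least_def
    proof (intro conjI ballI)
      show "Upper L {P, Q} \<subseteq> carrier L" by (simp add: Upper_def)
      have sc: "sub_class C X s \<in> carrier L" using s(1) unfolding carrier_L by blast
      show "sub_class C X s \<in> Upper L {P, Q}"
        unfolding Upper_pair[OF P Q] unfolding p(1) q(1) le_L[OF p(3) bs] le_L[OF q(3) bs] s(2)
        using z sc by blast
      fix T assume "T \<in> Upper L {P, Q}"
      then have T: "T \<in> carrier L" "P \<sqsubseteq>\<^bsub>L\<^esub> T" "Q \<sqsubseteq>\<^bsub>L\<^esub> T" unfolding Upper_pair[OF P Q] by blast+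
      from T(1) obtain t where t: "T = sub_class C X t" "frobenius_subalgebra C X t" "basis_idem (sub_idem C X t)"
        by (rule carrierE)
      show "sub_class C X s \<sqsubseteq>\<^bsub>L\<^esub> T"
        using T(2,3) least[OF t(3)]
        unfolding p(1) q(1) t(1) le_L[OF p(3) t(2)] le_L[OF q(3) t(2)] le_L[OF bs t(2)] s(2) by blast
    qed
    then show "\<exists>s. least L s (Upper L {P, Q})" by blast
    obtain m where m: "basis_idem m" "sub_idem C X p \<cdot> m = m" "sub_idem C X q \<cdot> m = m"
      and fm: "\<And>w u. \<lbrakk>u \<in> homset C w x; sub_idem C X p \<cdot> u = u; sub_idem C X q \<cdot> u = u\<rbrakk> \<Longrightarrow> m \<cdot> u = u"
      using basis_idem_meet[OF p(4) q(4)] by blast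
    obtain r where r: "frobenius_basis_subalgebra C X R B r" "sub_idem C X r = m"
      using basis_subalgebra_exists[OF m(1)] by blast
    have "greatest L (sub_class C X r) (Lower L {P, Q})"
      unfolding p(1) q(1) by (rule greatest_lower[OF p(2) q(2) r(1), unfolded r(2), OF m(2,3) fm])
    then show "\<exists>s. greatest L s (Lower L {P, Q})" by blast
  qed
qed

text \<open>The pullback inclusion \<open>k\<close> is fixed by both idempotents and hence by the idempotent \<open>q\<close> of the meet;
  conversely \<open>q\<close> factors through the pullback, so \<open>k\<close> splits \<open>q\<close>.\<close>
lemma intersection_is_meet:
  assumes p: "frobenius_basis_subalgebra C X R B (A, i)" and p': "frobenius_basis_subalgebra C X R B (A', i')"
    and int: "is_intersection C i i' k"
  shows "\<exists>K. fobj K = src C k \<and> frobenius_basis_subalgebra C X R B (K, k) \<and>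
    sub_class C X (A, i) \<sqinter>\<^bsub>L\<^esub> sub_class C X (A', i') = sub_class C X (K, k)"
proof -
  let ?b = "sub_idem C X (A, i)" and ?b' = "sub_idem C X (A', i')"
  note bp = basis_subalgebra_idem[OF p] and bp' = basis_subalgebra_idem[OF p']
  define h where "h = frob_dual_arr C A X i"
  define h' where "h' = frob_dual_arr C A' X i'"
  have dual_hom: "frob_dual_arr C D X j \<in> homset C x (fobj D)"
    if "frobenius_subalgebra C X (D, j)" for D j
    using that dual_arr_hom[OF frob_left_dual dual_x, of D j]
    by (auto simp: frobenius_subalgebra_def frob_dual_arr_def frob_dual_def)
  have i: "i \<in> homset C (fobj A) x" "is_mono C i" "h \<cdot> i = iden C (fobj A)" "?b = i \<cdot> h"
    using bp(2) by (auto simp: frobenius_subalgebra_def h_def sub_idem_def)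
  have i': "i' \<in> homset C (fobj A') x" "is_mono C i'" "h' \<cdot> i' = iden C (fobj A')" "?b' = i' \<cdot> h'"
    using bp'(2) by (auto simp: frobenius_subalgebra_def h'_def sub_idem_def)
  have hh: "h \<in> homset C x (fobj A)" and hh': "h' \<in> homset C x (fobj A')"
    using dual_hom[OF bp(2)] dual_hom[OF bp'(2)] by (auto simp: h_def h'_def)
  obtain u v where pb: "is_pullback C i i' u v" and k: "k = i \<cdot> u" using int by (auto simp: is_intersection_def)
  have si: "src C i = fobj A" "src C i' = fobj A'" using i(1) i'(1) by (simp_all add: in_hom_iff)
  note pb' = pb[unfolded is_pullback_def si]
  have u: "u \<in> homset C (src C u) (fobj A)" using pb' unfolding in_hom_iff by blast
  have "v \<in> homset C (src C v) (fobj A')" "src C v = src C u" using pb' unfolding in_hom_iff by simp_all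
  then have v: "v \<in> homset C (src C u) (fobj A')" by simp
  have com: "i \<cdot> u = i' \<cdot> v" using pb' by blast
  have univ: "\<exists>!f. f \<in> homset C w (src C u) \<and> u \<cdot> f = s \<and> v \<cdot> f = t"
    if "s \<in> homset C w (fobj A)" "t \<in> homset C w (fobj A')" "i \<cdot> s = i' \<cdot> t" for w s t
    using pb' that by blast
  have kh: "k \<in> homset C (src C u) x" unfolding k by (rule compo_closed[OF u i(1)])
  then have sk: "src C k = src C u" by (simp add: in_hom_iff)
  have mono: "is_mono C k" unfolding is_mono_def
  proof (intro conjI allI ballI impI)
    show "k \<in> arrs C" using kh by (simp add: in_hom_iff)
    fix w f g assume "f \<in> homset C w (src C k)" "g \<in> homset C w (src C k)" and eq: "k \<cdot> f = k \<cdot> g"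
    then have f: "f \<in> homset C w (src C u)" and g: "g \<in> homset C w (src C u)" by (simp_all add: sk)
    have "i \<cdot> u \<cdot> f = i \<cdot> u \<cdot> g"
      using eq compo_assoc[OF f u i(1)] compo_assoc[OF g u i(1)] by (simp add: k)
    then have ufg: "u \<cdot> f = u \<cdot> g"
      using i(1,2) compo_closed[OF f u] compo_closed[OF g u] by (auto simp: is_mono_def in_hom_iff)
    have "i' \<cdot> v \<cdot> f = i' \<cdot> v \<cdot> g"
      using eq compo_assoc[OF f v i'(1)] compo_assoc[OF g v i'(1)] by (simp add: k com)
    then have vfg: "v \<cdot> f = v \<cdot> g"
      using i'(1,2) compo_closed[OF f v] compo_closed[OF g v] by (auto simp: is_mono_def in_hom_iff)
    have "i \<cdot> u \<cdot> f = i' \<cdot> v \<cdot> f"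
      using compo_assoc[OF f u i(1)] compo_assoc[OF f v i'(1)] com by simp
    from univ[OF compo_closed[OF f u] compo_closed[OF f v] this] show "f = g"
      using f g ufg vfg by auto
  qed
  have absorb: "(j \<cdot> r) \<cdot> j \<cdot> w = j \<cdot> w"
    if j: "j \<in> homset C d x" and r: "r \<in> homset C x d" and rj: "r \<cdot> j = iden C d" and w: "w \<in> homset C e d"
    for j r d e w
  proof -
    have "(j \<cdot> r) \<cdot> j \<cdot> w = j \<cdot> (r \<cdot> j) \<cdot> w" using j r w by (simp add: in_hom_iff)
    then show ?thesis unfolding rj using w by (simp add: in_hom_iff)
  qed
  have bk: "?b \<cdot> k = k" unfolding i(4) k by (rule absorb[OF i(1) hh i(3) u])
  have bk': "?b' \<cdot> k = k" unfolding i'(4) k com by (rule absorb[OF i'(1) hh' i'(3) v])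
  obtain q where q: "basis_idem q" "?b \<cdot> q = q" "?b' \<cdot> q = q"
    and fq: "\<And>w u. \<lbrakk>u \<in> homset C w x; ?b \<cdot> u = u; ?b' \<cdot> u = u\<rbrakk> \<Longrightarrow> q \<cdot> u = u"
    using basis_idem_meet[OF bp(1) bp'(1)] by blast
  note qh = basis_idemD(1)[OF q(1)]
  have "i \<cdot> h \<cdot> q = i' \<cdot> h' \<cdot> q"
    using compo_assoc[OF qh hh i(1)] compo_assoc[OF qh hh' i'(1)] q(2,3) by (simp add: i(4) i'(4))
  then obtain g where g: "g \<in> homset C x (src C u)" "u \<cdot> g = h \<cdot> q"
    using univ[OF compo_closed[OF qh hh] compo_closed[OF qh hh']] by blast
  have kg: "k \<cdot> g = q"
    using compo_assoc[OF g(1) u i(1)] compo_assoc[OF qh hh i(1)] g(2) q(2) by (simp add: k i(4))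
  have "k \<cdot> g \<cdot> k = k" using compo_assoc[OF kh g(1) kh] kg fq[OF kh bk bk'] by simp
  then have gk: "g \<cdot> k = iden C (src C u)" by (rule split_by_mono[OF mono kh g(1)])
  obtain K where K: "fobj K = src C u" "frobenius_basis_subalgebra C X R B (K, k)" "sub_idem C X (K, k) = q"
    using basis_subalgebra_of_idem[OF q(1) kh g(1) gk kg] by blast
  have "greatest L (sub_class C X (K, k)) (Lower L {sub_class C X (A, i), sub_class C X (A', i')})"
    by (rule greatest_lower[OF p p' K(2), unfolded K(3), OF q(2,3) fq])
  moreover interpret lattice L by (rule lattice_L)
  have "greatest L (sub_class C X (A, i) \<sqinter>\<^bsub>L\<^esub> sub_class C X (A', i'))
      (Lower L {sub_class C X (A, i), sub_class C X (A', i')})"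
    unfolding meet_def inf_def
    by (rule someI_ex) (rule inf_of_two_exists; use p p' in \<open>auto simp: carrier_L\<close>)
  ultimately have "sub_class C X (A, i) \<sqinter>\<^bsub>L\<^esub> sub_class C X (A', i') = sub_class C X (K, k)"
    using greatest_unique by blast
  then show ?thesis using K sk by auto
qed

end

theorem theorem5p15:
  fixes C :: "('o, 'm) lmcat" and X :: "('o, 'm) frob"
    and R :: "'o set" and B :: "'o \<Rightarrow> 'm set"
  assumes "linear_abelian_rigid_category C"
    and schur: "\<And>S. is_simple C S \<Longrightarrow> homset C S S = range (\<lambda>c. hscale C c (iden C S))"
    and "frobenius_algebra C X"
    and "semisimple_finite_length C (fobj X)"
    and "object_basis C (fobj X) R B"
  shows "lattice (frobenius_basis_subalgebra_poset C X R B) \<and>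
    (\<forall>A i A' i' k.
       frobenius_basis_subalgebra C X R B (A, i) \<and> frobenius_basis_subalgebra C X R B (A', i') \<and>
       is_intersection C i i' k \<longrightarrow>
       (\<exists>K. fobj K = src C k \<and> frobenius_basis_subalgebra C X R B (K, k) \<and>
          sub_class C X (A, i) \<sqinter>\<^bsub>frobenius_basis_subalgebra_poset C X R B\<^esub> sub_class C X (A', i')
            = sub_class C X (K, k)))"
proof -
  interpret linear_abelian_rigid_category C by fact
  interpret frobenius_with_basis C X R B
    by unfold_locales (use assms in auto)
  show ?thesis using lattice_L intersection_is_meet by blast
qed

end
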